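(* Let $(\mathcal M,g)$ be a closed connected Riemannian manifold of dimension $n$, and let $p\in\{1,\dots,n\}$. Assume that $A(\alpha,t)$ is independent of $t$ and that for every $(x,t)\in\mathcal M\times\mathbb R$ and $\alpha\in T_x^*\mathcal M$, $$\Bigl(D_\alpha^2\bigl[(A(\cdot,t))(v,v)\bigr]\Bigr)(\beta,\beta)\le0,\qquad\forall(\beta,v)\in T_x^*\mathcal M\times T_x\mathcal M .$$ Let $\underline u\in C^2(\mathcal M)$ and let $\tilde\phi$ be a positive function on $\mathcal M$. If there exist positive constants $\delta$ and $R$, depending only on $\mathcal M,g,n,p,A(\alpha,t),\varphi(\alpha,t)$ and $\underline u$, such that for any $x\in\mathcal M$ $$\bigl\{\xi\in\Gamma_p:\sigma_p^{1/p}(\xi)=\tilde\phi(x)\bigr\}\cap\Bigl(\bigl\{\lambda\bigl(g^{-1}(A(\mathrm d\underline u,\underline u)+\nabla^2\underline u)\bigr)(x)-\delta\mathbf 1_n\bigr\}+\Gamma_n\Bigr)\subset \mathrm B_R(0),$$ then $\underline u$ satisfies the pseudo-subsolution condition.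
   Context: Notation. $\sigma_p(\mu)=\sum_{1\le j_1<\dots<j_p\le n}\mu_{j_1}\cdots\mu_{j_p}$ for $\mu\in\mathbb R^n$; $\Gamma_p=\{\mu\in\mathbb R^n:\sigma_q(\mu)>0\ \forall q\in\{1,\dots,p\}\}$; $\mathbf 1_n=(1,\dots,1)^T$; $\mathrm B_R(0)$ is the open ball in $\mathbb R^n$; sums of sets are Minkowski sums. "Closed" means compact without boundary. $\pi:T^*\mathcal M\to\mathcal M$ is the projection. $A$ is a smooth map assigning to each $(\alpha,t)\in T^*\mathcal M\times\mathbb R$ a symmetric bilinear form $A(\alpha,t)$ on $T_{\pi(\alpha)}\mathcal M$, with components $A_{jk}(\alpha,t)$ in local coordinates; $\varphi(\alpha,t)$ is a positive smooth function on $T^*\mathcal M\times\mathbb R$. For $u\in C^2(\mathcal M)$, $\mathrm du$ is its differential, $\nabla^2u$ (components $\nabla_{jk}u$) its Hessian for the Levi-Civita connection, and $A(\mathrm du,u)$ is the tensor field $x\mapsto A(\mathrm du(x),u(x))$. For a symmetric $(0,2)$-tensor field $B$, $\lambda(g^{-1}B)(x)\in\mathbb R^n$ is the vector of eigenvalues, in non-decreasing order, of the matrix product $(g^{jk}(x))(B_{jk}(x))$ in any local coordinates, where $(g^{jk})=(g_{jk})^{-1}$. $|\alpha|_g=(g^{jk}\alpha_j\alpha_k)^{1/2}$. Repeated indices are summed. For $\psi\in C^2(T_x^*\mathcal M)$, $D_\alpha[\psi](\beta)$ and $D^2_\alpha[\psi](\beta,\gamma)$ denote the first and second (Fréchet)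 derivatives of $\psi$ at $\alpha$ on the vector space $T_x^*\mathcal M$; $(A(\cdot,t))(v,v)$ and $A_{jk}(\cdot,t)$ are here regarded as functions on $T_x^*\mathcal M$. The general $p$-Hessian equation for $u\in C^2(\mathcal M)$ is: for all $x\in\mathcal M$, $$\sigma_p^{1/p}\bigl(\lambda(g^{-1}(A(\mathrm du,u)+\nabla^2u))(x)\bigr)=\varphi(\mathrm du(x),u(x)),\qquad \lambda(g^{-1}(A(\mathrm du,u)+\nabla^2u))(x)\in\Gamma_p .$$ A solution is a $u$ satisfying both requirements. For a solution $u$ and $x\in\mathcal M$, in local coordinates, $F^{jk}_{u,x}$ is the partial derivative with respect to $b_{jk}$ of the function of the real $n\times n$ matrix $\mathbf B=(b_{jk})$ given by $\sigma_p^{1/p}$ of the eigenvalues of $\frac12(g^{jk}(x))(\mathbf B+\mathbf B^T)$, evaluated at $\mathbf B=\bigl(A_{jk}(\mathrm du,u)+\nabla_{jk}u\bigr)(x)$. $\lambda_1$ of a matrix denotes its minimum eigenvalue. $\underline u\in C^2(\mathcal M)$ satisfies the pseudo-subsolution condition if: for any $C\in[0,+\infty)$ there exist constants $\delta_1>0$ and $M_1\ge0$, depending only on $\mathcal M,g,n,p,A,\varphi,\underline u,C$, such that for any solution $u\in C^2(\mathcal M)$ with $\max_{\mathcal M}|u|+\max_{\mathcal M}|\mathrm du|_g\le C$ and any $x\in\mathcal M$ (in local coordinates at $x$), $$F^{jk}_{u,x}\nabla_{jk}(\underline u-u)(x)+F^{jk}_{u,x}\Bigl(D_{\mathrm du(x)}\bigl[A_{jk}(\cdot,u(x))\bigr]\Bigr)\bigl(\mathrm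 d(\underline u-u)(x)\bigr)\ge\delta_1F^{jk}_{u,x}g_{jk}(x)-M_1\lambda_1\bigl((F^{jk}_{u,x})(g_{jk}(x))\bigr)-M_1 .$$ *)

theory Defs
  imports "HOL-Analysis.Analysis"
begin

type_synonym 'n rvec = "real ^ 'n"
type_synonym 'n rmat = "real ^ 'n ^ 'n"

section \<open>Symmetric functions and eigenvalues\<close>

definition elem_sym :: "nat \<Rightarrow> 'n::finite rvec \<Rightarrow> real" where
  "elem_sym p \<mu> = (\<Sum>S | S \<subseteq> (UNIV :: 'n set) \<and> card S = p. \<Prod>j\<in>S. \<mu> $ j)"

definition Gamma_cone :: "nat \<Rightarrow> ('n::finite rvec) set" where
  "Gamma_cone p = {\<mu>. \<forall>q\<in>{1..p}. elem_sym q \<mu> > 0}"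

text \<open>The eigenvalues are counted with algebraic multiplicity. The definition is meaningful only
  for matrices with real spectrum; it is applied below to products of a positive definite symmetric
  matrix and a symmetric matrix, which have real spectrum. The order on the index type \<open>'n\<close> is used
  only to speak of the eigenvalues in non-decreasing order.\<close>

definition eigvals :: "'n::{finite, linorder} rmat \<Rightarrow> 'n rvec" where
  "eigvals X = (THE v. mono (\<lambda>i. v $ i) \<and> (\<forall>t. det (mat t - X) = (\<Prod>i\<in>UNIV. t - v $ i)))"

definition min_eigval :: "'n::finite rmat \<Rightarrow> real" where
  "min_eigval X = Min {t. \<exists>v. v \<noteq> 0 \<and> X *v v = t *\<^sub>R v}"


section \<open>Differentiability classes\<close>

definition partial :: "'n::finite \<Rightarrow> ('n rvec \<Rightarrow> real) \<Rightarrow> 'n rvec \<Rightarrow> real" where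
  "partial j f y = frechet_derivative f (at y) (axis j 1)"

text \<open>\<open>second_frechet \<psi> a b c\<close> is \<open>D\<^sup>2\<close> of \<open>\<psi>\<close> at \<open>a\<close>, evaluated on the directions \<open>b\<close> and \<open>c\<close>.\<close>

definition second_frechet ::
    "('a::real_normed_vector \<Rightarrow> real) \<Rightarrow> 'a \<Rightarrow> 'a \<Rightarrow> 'a \<Rightarrow> real" where
  "second_frechet \<psi> a b c =
     frechet_derivative (\<lambda>a'. frechet_derivative \<psi> (at a') b) (at a) c"

text \<open>\<open>Ck_on\<close> is meant for open sets \<open>S\<close> of Euclidean spaces.\<close>

primrec Ck_on :: "nat \<Rightarrow> ('a::euclidean_space \<Rightarrow> 'b::real_normed_vector) \<Rightarrow> 'a set \<Rightarrow> bool" where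
  "Ck_on 0 f S \<longleftrightarrow> continuous_on S f"
| "Ck_on (Suc k) f S \<longleftrightarrow>
     (\<forall>x\<in>S. f differentiable (at x)) \<and>
     (\<forall>v. Ck_on k (\<lambda>x. frechet_derivative f (at x) v) S)"

definition smooth_on :: "('a::euclidean_space \<Rightarrow> 'b::real_normed_vector) \<Rightarrow> 'a set \<Rightarrow> bool" where
  "smooth_on f S \<longleftrightarrow> (\<forall>k. Ck_on k f S)"


section \<open>Smooth manifolds and geometric objects on them\<close>

text \<open>The manifold is a whole topological space \<open>'m\<close>. A chart is an open set together with a
  coordinate map, whose values outside that set are irrelevant. The images of charts are open in
  \<open>\<real>\<^sup>n\<close>, so there is no boundary. The atlas need not be maximal.\<close>

type_synonym ('m, 'n) chart = "'m set \<times> ('m \<Rightarrow> 'n rvec)"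

definition chart_inv :: "('m, 'n::finite) chart \<Rightarrow> 'n rvec \<Rightarrow> 'm" where
  "chart_inv c = inv_into (fst c) (snd c)"

definition transition ::
    "('m, 'n::finite) chart \<Rightarrow> ('m, 'n) chart \<Rightarrow> 'n rvec \<Rightarrow> 'n rvec" where
  "transition c c' = snd c' \<circ> chart_inv c"

definition smooth_atlas :: "('m::topological_space, 'n::finite) chart set \<Rightarrow> bool" where
  "smooth_atlas Atl \<longleftrightarrow>
     (\<Union>c\<in>Atl. fst c) = UNIV \<and>
     (\<forall>c\<in>Atl. open (fst c) \<and> open (snd c ` fst c) \<and>
        homeomorphism (fst c) (snd c ` fst c) (snd c) (chart_inv c)) \<and>
     (\<forall>c\<in>Atl. \<forall>c'\<in>Atl. smooth_on (transition c c') (snd c ` (fst c \<inter> fst c')))"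

text \<open>Vectors, covectors and bilinear forms at a point are given by their components in every chart
  of the atlas around that point, which transform in the usual way: with \<open>J = (\<partial>y'\<^sup>i / \<partial>y\<^sup>j)\<close> the
  Jacobian at \<open>x\<close> of the change from the coordinates \<open>y\<close> of \<open>c\<close> to the coordinates \<open>y'\<close> of \<open>c'\<close>, a
  covector with components \<open>a\<close> in \<open>c'\<close> has components \<open>J\<^sup>T a\<close> in \<open>c\<close>, and a bilinear form with
  matrix \<open>B\<close> in \<open>c'\<close> has matrix \<open>J\<^sup>T B J\<close> in \<open>c\<close>.\<close>

definition chart_jac ::
    "('m, 'n::finite) chart \<Rightarrow> ('m, 'n) chart \<Rightarrow> 'm \<Rightarrow> 'n rmat" where
  "chart_jac c c' x = jacobian (transition c c') (at (snd c x))"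

type_synonym ('m, 'n) metric = "('m, 'n) chart \<Rightarrow> 'm \<Rightarrow> 'n rmat"

definition riemannian_metric ::
    "('m::topological_space, 'n::finite) chart set \<Rightarrow> ('m, 'n) metric \<Rightarrow> bool" where
  "riemannian_metric Atl g \<longleftrightarrow>
     (\<forall>c\<in>Atl. smooth_on (\<lambda>y. g c (chart_inv c y)) (snd c ` fst c)) \<and>
     (\<forall>c\<in>Atl. \<forall>x\<in>fst c. transpose (g c x) = g c x \<and> (\<forall>v. v \<noteq> 0 \<longrightarrow> v \<bullet> (g c x *v v) > 0)) \<and>
     (\<forall>c\<in>Atl. \<forall>c'\<in>Atl. \<forall>x\<in>fst c \<inter> fst c'.
        g c x = transpose (chart_jac c c' x) ** g c' x ** chart_jac c c' x)"

text \<open>A function on \<open>T\<^sup>*M \<times> \<real>\<close> or a map assigning to each \<open>(\<alpha>, t)\<close> a bilinear form on the tangent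
  space at \<open>\<pi>(\<alpha>)\<close> takes as arguments a chart, the base point \<open>x = \<pi>(\<alpha>)\<close>, the components of \<open>\<alpha>\<close> in
  that chart, and \<open>t\<close>.\<close>

type_synonym ('m, 'n) cotangent_form =
  "('m, 'n) chart \<Rightarrow> 'm \<Rightarrow> 'n rvec \<Rightarrow> real \<Rightarrow> 'n rmat"

type_synonym ('m, 'n) cotangent_fun = "('m, 'n) chart \<Rightarrow> 'm \<Rightarrow> 'n rvec \<Rightarrow> real \<Rightarrow> real"

definition smooth_symmetric_form ::
    "('m::topological_space, 'n::finite) chart set \<Rightarrow> ('m, 'n) cotangent_form \<Rightarrow> bool" where
  "smooth_symmetric_form Atl A \<longleftrightarrow>
     (\<forall>c\<in>Atl. smooth_on (\<lambda>(y, a, t). A c (chart_inv c y) a t) ((snd c ` fst c) \<times> UNIV \<times> UNIV)) \<and>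
     (\<forall>c\<in>Atl. \<forall>x\<in>fst c. \<forall>a t. transpose (A c x a t) = A c x a t) \<and>
     (\<forall>c\<in>Atl. \<forall>c'\<in>Atl. \<forall>x\<in>fst c \<inter> fst c'. \<forall>a t.
        A c x (transpose (chart_jac c c' x) *v a) t =
          transpose (chart_jac c c' x) ** A c' x a t ** chart_jac c c' x)"

definition smooth_positive_fun ::
    "('m::topological_space, 'n::finite) chart set \<Rightarrow> ('m, 'n) cotangent_fun \<Rightarrow> bool" where
  "smooth_positive_fun Atl \<phi> \<longleftrightarrow>
     (\<forall>c\<in>Atl. smooth_on (\<lambda>(y, a, t). \<phi> c (chart_inv c y) a t) ((snd c ` fst c) \<times> UNIV \<times> UNIV)) \<and>
     (\<forall>c\<in>Atl. \<forall>x\<in>fst c. \<forall>a t. \<phi> c x a t > 0) \<and>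
     (\<forall>c\<in>Atl. \<forall>c'\<in>Atl. \<forall>x\<in>fst c \<inter> fst c'. \<forall>a t.
        \<phi> c x (transpose (chart_jac c c' x) *v a) t = \<phi> c' x a t)"

definition C2_fun :: "('m::topological_space, 'n::finite) chart set \<Rightarrow> ('m \<Rightarrow> real) \<Rightarrow> bool" where
  "C2_fun Atl u \<longleftrightarrow> (\<forall>c\<in>Atl. Ck_on 2 (u \<circ> chart_inv c) (snd c ` fst c))"

definition differential :: "('m, 'n::finite) chart \<Rightarrow> ('m \<Rightarrow> real) \<Rightarrow> 'm \<Rightarrow> 'n rvec" where
  "differential c u x = (\<chi> j. partial j (u \<circ> chart_inv c) (snd c x))"

definition covector_norm :: "('m, 'n::finite) metric \<Rightarrow> ('m, 'n) chart \<Rightarrow> 'm \<Rightarrow> 'n rvec \<Rightarrow> real" where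
  "covector_norm g c x a = sqrt (\<Sum>j\<in>UNIV. \<Sum>k\<in>UNIV. matrix_inv (g c x) $ j $ k * a $ j * a $ k)"

text \<open>The Christoffel symbol with upper index \<open>i\<close> and lower indices \<open>j\<close>, \<open>k\<close> of the Levi-Civita
  connection, and the Hessian \<open>\<nabla>\<^sub>j\<^sub>k u = \<partial>\<^sub>j \<partial>\<^sub>k u - \<Gamma>\<^sup>i\<^sub>j\<^sub>k \<partial>\<^sub>i u\<close>.\<close>

definition christoffel ::
    "('m, 'n::finite) metric \<Rightarrow> ('m, 'n) chart \<Rightarrow> 'm \<Rightarrow> 'n \<Rightarrow> 'n \<Rightarrow> 'n \<Rightarrow> real" where
  "christoffel g c x i j k =
     (let dg = (\<lambda>j k l. partial j (\<lambda>y. g c (chart_inv c y) $ k $ l) (snd c x))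
      in (1/2) * (\<Sum>l\<in>UNIV. matrix_inv (g c x) $ i $ l * (dg j k l + dg k j l - dg l j k)))"

definition hessian ::
    "('m, 'n::finite) metric \<Rightarrow> ('m, 'n) chart \<Rightarrow> ('m \<Rightarrow> real) \<Rightarrow> 'm \<Rightarrow> 'n rmat" where
  "hessian g c u x =
     (\<chi> j k. partial j (partial k (u \<circ> chart_inv c)) (snd c x)
        - (\<Sum>i\<in>UNIV. christoffel g c x i j k * differential c u x $ i))"


section \<open>The general p-Hessian equation\<close>

definition augmented_hessian ::
    "('m, 'n::finite) metric \<Rightarrow> ('m, 'n) cotangent_form \<Rightarrow> ('m, 'n) chart \<Rightarrow> ('m \<Rightarrow> real) \<Rightarrow> 'm
      \<Rightarrow> 'n rmat" where
  "augmented_hessian g A c u x = A c x (differential c u x) (u x) + hessian g c u x"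

definition hessian_eigvals ::
    "('m, 'n::{finite, linorder}) metric \<Rightarrow> ('m, 'n) cotangent_form \<Rightarrow> ('m, 'n) chart
      \<Rightarrow> ('m \<Rightarrow> real) \<Rightarrow> 'm \<Rightarrow> 'n rvec" where
  "hessian_eigvals g A c u x = eigvals (matrix_inv (g c x) ** augmented_hessian g A c u x)"

definition is_solution ::
    "('m::topological_space, 'n::{finite, linorder}) chart set \<Rightarrow> ('m, 'n) metric \<Rightarrow> nat
      \<Rightarrow> ('m, 'n) cotangent_form \<Rightarrow> ('m, 'n) cotangent_fun \<Rightarrow> ('m \<Rightarrow> real) \<Rightarrow> bool" where
  "is_solution Atl g p A \<phi> u \<longleftrightarrow>
     C2_fun Atl u \<and>
     (\<forall>c\<in>Atl. \<forall>x\<in>fst c.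
        root p (elem_sym p (hessian_eigvals g A c u x)) = \<phi> c x (differential c u x) (u x) \<and>
        hessian_eigvals g A c u x \<in> Gamma_cone p)"

definition hessian_op :: "nat \<Rightarrow> 'n::{finite, linorder} rmat \<Rightarrow> 'n rmat \<Rightarrow> real" where
  "hessian_op p G B = root p (elem_sym p (eigvals ((1/2) *\<^sub>R (matrix_inv G ** (B + transpose B)))))"

text \<open>\<open>axis j (axis k 1)\<close> is the matrix whose only nonzero entry is a 1 in row \<open>j\<close>, column \<open>k\<close>, so
  the entries below are the partial derivatives of \<open>hessian_op\<close> with respect to \<open>b\<^sub>j\<^sub>k\<close>.\<close>

definition F_coeff ::
    "('m, 'n::{finite, linorder}) metric \<Rightarrow> nat \<Rightarrow> ('m, 'n) cotangent_form \<Rightarrow> ('m, 'n) chart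
      \<Rightarrow> ('m \<Rightarrow> real) \<Rightarrow> 'm \<Rightarrow> 'n rmat" where
  "F_coeff g p A c u x =
     (\<chi> j k. deriv (\<lambda>s. hessian_op p (g c x)
        (augmented_hessian g A c u x + s *\<^sub>R axis j (axis k 1))) 0)"

text \<open>Here \<open>w\<close> is the candidate pseudo-subsolution. In the bound on \<open>u\<close>, the value \<open>|du|\<^sub>g\<close> at \<open>x\<close> does not depend on the chart, so the second
  supremum is the maximum of \<open>|du|\<^sub>g\<close> over the compact manifold.\<close>

definition pseudo_subsolution ::
    "('m::topological_space, 'n::{finite, linorder}) chart set \<Rightarrow> ('m, 'n) metric \<Rightarrow> nat
      \<Rightarrow> ('m, 'n) cotangent_form \<Rightarrow> ('m, 'n) cotangent_fun \<Rightarrow> ('m \<Rightarrow> real) \<Rightarrow> bool" where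
  "pseudo_subsolution Atl g p A \<phi> w \<longleftrightarrow>
     (\<forall>C\<ge>0. \<exists>\<delta>\<^sub>1>0. \<exists>M\<^sub>1\<ge>0. \<forall>u.
        is_solution Atl g p A \<phi> u \<and>
        (SUP x. \<bar>u x\<bar>)
          + Sup {covector_norm g c x (differential c u x) | c x. c \<in> Atl \<and> x \<in> fst c} \<le> C \<longrightarrow>
        (\<forall>c\<in>Atl. \<forall>x\<in>fst c.
           let F = F_coeff g p A c u x; w_u = (\<lambda>z. w z - u z) in
           (\<Sum>j\<in>UNIV. \<Sum>k\<in>UNIV. F $ j $ k * hessian g c w_u x $ j $ k)
           + (\<Sum>j\<in>UNIV. \<Sum>k\<in>UNIV. F $ j $ k *
                frechet_derivative (\<lambda>a. A c x a (u x) $ j $ k)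
                  (at (differential c u x)) (differential c w_u x))
           \<ge> \<delta>\<^sub>1 * (\<Sum>j\<in>UNIV. \<Sum>k\<in>UNIV. F $ j $ k * g c x $ j $ k)
              - M\<^sub>1 * min_eigval (F ** g c x) - M\<^sub>1))"

end

theory Submission
  imports Defs
begin

text \<open>Fix a point and a frame, orthonormal for the metric, in which the augmented Hessian of the solution
\<open>u\<close> is diagonal with entries \<open>d\<^sub>1 \<le> \<dots> \<le> d\<^sub>n\<close>. The coefficient matrix \<open>F\<close> is then diagonal too; its
entries \<open>f\<^sub>i\<close> are the partial derivatives of \<open>\<sigma>\<^sub>p\<close> to the power \<open>1/p\<close> at \<open>d\<close>, and they are nonnegative
and decreasing in \<open>i\<close>. Since \<open>A\<close> is concave in the covector, \<open>A(dw)\<close> lies below its tangent at \<open>du\<close>, so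
the left-hand side of the condition is at least the sum of \<open>f\<^sub>i (W\<^sub>i\<^sub>i - d\<^sub>i)\<close>, where \<open>W\<close> is the augmented
Hessian of the candidate \<open>w\<close> in the frame. The diagonal of \<open>W\<close> is the image of its vector \<open>\<mu>\<close> of
increasing eigenvalues under a doubly stochastic matrix, and \<open>f\<close> and \<open>\<mu>\<close> are oppositely ordered, so the
sum of \<open>f\<^sub>i W\<^sub>i\<^sub>i\<close> is at least the sum of \<open>f\<^sub>i \<mu>\<^sub>i\<close> (\<open>doubly_stochastic_rearrangement\<close>). The sum of
\<open>f\<^sub>i d\<^sub>i\<close> equals \<open>\<phi>(du, u)\<close> by homogeneity, and this is bounded because the covectors of length at most
\<open>C\<close> over a compact manifold form a compact set.

What remains is a lower bound for the sum of \<open>f\<^sub>i \<mu>\<^sub>i\<close>. Suppose that \<open>\<mu> - (\<delta>/2) 1 + K e\<^sub>n\<close> belongs to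
\<open>\<Gamma>\<^sub>p\<close> for some \<open>K \<ge> 0\<close> that is the same at all points. The gradient of \<open>\<sigma>\<^sub>p\<close> at a point of \<open>\<Gamma>\<^sub>p\<close> pairs
nonnegatively with \<open>\<Gamma>\<^sub>p\<close> (\<open>garding_inequality\<close>), so the sum of \<open>f\<^sub>i \<mu>\<^sub>i\<close> is at least \<open>\<delta>/2\<close> times the
sum of the \<open>f\<^sub>i\<close> minus \<open>K f\<^sub>n\<close>. The sum of the \<open>f\<^sub>i\<close> is the trace of \<open>F g\<close> and \<open>f\<^sub>n\<close> is its least
eigenvalue, which is the assertion with \<open>\<delta>\<^sub>1 = \<delta>/2\<close> and \<open>M\<^sub>1\<close> the maximum of \<open>K\<close> and the bound for \<open>\<phi>\<close>.

The vector does belong to \<open>\<Gamma>\<^sub>p\<close> as soon as \<open>K\<close> is large. A vector outside \<open>\<Gamma>\<^sub>p\<close>, translated upwards along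
the diagonal, enters \<open>\<Gamma>\<^sub>p\<close> through a zero of \<open>\<sigma>\<^sub>p\<close> and so meets every level set of \<open>\<sigma>\<^sub>p\<close> in \<open>\<Gamma>\<^sub>p\<close>
(\<open>garding_cone_shift_level\<close>). Hence a failure would produce a point of the set in the hypothesis whose last
component is at least \<open>R\<close>. The set in the hypothesis may belong to any positive level \<open>\<phi>'(x)\<close>, whatever the
right-hand side \<open>\<phi>\<close> of the equation, because the translates meet all of them.

A uniform \<open>K\<close> requires a lower bound for \<open>\<mu>\<^sub>n\<close>. In dimension at least two the hypothesis itself gives
\<open>\<mu>\<^sub>n > - R\<close>, by the same argument applied to \<open>R (e\<^sub>i - e\<^sub>j)\<close>, a vector with component sum zero and so outside \<open>\<Gamma>\<^sub>p\<close>.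
In dimension one the set in the hypothesis has at most one element and puts no lower bound on \<open>\<mu>\<close>;
there \<open>\<mu>\<close> is the quotient of the augmented Hessian by the metric, a continuous function that does
not depend on the chart, and compactness bounds it.\<close>

section \<open>Elementary symmetric functions and the Garding cones\<close>

text \<open>The index set is a parameter because the inductions below delete one index after another.\<close>

definition esym :: "nat \<Rightarrow> 'a set \<Rightarrow> ('a \<Rightarrow> real) \<Rightarrow> real" where
  "esym k I x = (\<Sum>S | S \<subseteq> I \<and> card S = k. prod x S)"

definition garding_cone :: "nat \<Rightarrow> 'a set \<Rightarrow> ('a \<Rightarrow> real) \<Rightarrow> bool" where
  "garding_cone p I x \<longleftrightarrow> (\<forall>q\<in>{1..p}. esym q I x > 0)"

lemma esym_0 [simp]: "finite I \<Longrightarrow> esym 0 I x = 1"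
proof -
  assume "finite I"
  then have "{S. S \<subseteq> I \<and> card S = 0} = {{}}"
    by (auto dest: finite_subset)
  then show ?thesis by (simp add: esym_def)
qed

lemma finite_subsets_of_card [simp]: "finite I \<Longrightarrow> finite {S. S \<subseteq> I \<and> card S = k}"
  by (rule finite_subset[of _ "Pow I"]) auto

lemma esym_eq_0_of_card_less:
  assumes "finite I" "card I < k"
  shows "esym k I x = 0"
proof -
  have "{S. S \<subseteq> I \<and> card S = k} = {}"
    using assms card_mono[of I] by (auto simp: not_le[symmetric])
  then show ?thesis by (simp only: esym_def sum.empty)
qed

text \<open>Double counting: a set of size \<open>Suc k\<close> with a marked element \<open>i\<close> is the same as an element \<open>i\<close> with a set
of size \<open>k\<close> that avoids it.\<close>

lemma sum_subsets_remove:
  fixes h :: "'a \<Rightarrow> 'a set \<Rightarrow> real"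
  assumes "finite I"
  shows "(\<Sum>S | S \<subseteq> I \<and> card S = Suc k. \<Sum>i\<in>S. h i (S - {i})) =
         (\<Sum>i\<in>I. \<Sum>T | T \<subseteq> I - {i} \<and> card T = k. h i T)"
proof -
  have "(\<Sum>S | S \<subseteq> I \<and> card S = Suc k. \<Sum>i\<in>S. h i (S - {i})) =
      (\<Sum>(S, i)\<in>Sigma {S. S \<subseteq> I \<and> card S = Suc k} (\<lambda>S. S). h i (S - {i}))"
    by (rule sum.Sigma) (use assms in \<open>auto intro: finite_subset\<close>)
  also have "\<dots> = (\<Sum>(i, T)\<in>Sigma I (\<lambda>i. {T. T \<subseteq> I - {i} \<and> card T = k}). h i T)"
    by (rule sum.reindex_bij_witness[where i="\<lambda>(i, T). (insert i T, i)"
          and j="\<lambda>(S, i). (i, S - {i})"])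
      (use assms in \<open>auto simp: card_insert_if finite_subset[of _ I] finite_subset[of _ "I - {_}"] insert_absorb\<close>)
  also have "\<dots> = (\<Sum>i\<in>I. \<Sum>T | T \<subseteq> I - {i} \<and> card T = k. h i T)"
    by (rule sum.Sigma[symmetric]) (use assms in auto)
  finally show ?thesis .
qed

text \<open>Each monomial of degree \<open>Suc k\<close> arises \<open>Suc k\<close> times on the left, once for each of its variables.\<close>

lemma esym_euler:
  assumes "finite I"
  shows "(\<Sum>i\<in>I. x i * esym k (I - {i}) x) = real (Suc k) * esym (Suc k) I x"
proof -
  have "(\<Sum>i\<in>I. x i * esym k (I - {i}) x) =
      (\<Sum>S | S \<subseteq> I \<and> card S = Suc k. \<Sum>i\<in>S. x i * prod x (S - {i}))"
    unfolding esym_def sum_distrib_left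
    by (rule sum_subsets_remove[OF assms, symmetric])
  also have "\<dots> = (\<Sum>S | S \<subseteq> I \<and> card S = Suc k. real (Suc k) * prod x S)"
  proof (rule sum.cong, simp, clarify)
    fix S assume S: "S \<subseteq> I" "card S = Suc k"
    have "finite S" using S assms finite_subset by blast
    then have "(\<Sum>i\<in>S. x i * prod x (S - {i})) = (\<Sum>i\<in>S. prod x S)"
      by (intro sum.cong refl) (simp add: prod.remove[symmetric])
    then show "(\<Sum>i\<in>S. x i * prod x (S - {i})) = real (Suc k) * prod x S"
      using S by simp
  qed
  finally show ?thesis by (simp add: esym_def sum_distrib_left)
qed

lemma esym_split:
  assumes "finite I" "i \<in> I"
  shows "esym (Suc k) I x = esym (Suc k) (I - {i}) x + x i * esym k (I - {i}) x"
proof -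
  let ?A = "{S. S \<subseteq> I - {i} \<and> card S = Suc k}" and ?B = "{S. S \<subseteq> I - {i} \<and> card S = k}"
  have fS: "finite S" if "S \<subseteq> I" for S using that assms finite_subset by blast
  have eq: "{S. S \<subseteq> I \<and> card S = Suc k} = ?A \<union> insert i ` ?B"
  proof (intro set_eqI iffI)
    fix S assume S: "S \<in> {S. S \<subseteq> I \<and> card S = Suc k}"
    show "S \<in> ?A \<union> insert i ` ?B"
    proof (cases "i \<in> S")
      case True
      then have "S = insert i (S - {i})" "S - {i} \<in> ?B" using S fS[of S] by auto
      then show ?thesis by blast
    qed (use S in auto)
  qed (use assms fS in \<open>auto simp: card_insert_if subset_Diff_insert\<close>)
  have "esym (Suc k) I x = sum (prod x) ?A + sum (prod x) (insert i ` ?B)"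
    unfolding esym_def eq by (rule sum.union_disjoint) (use assms in auto)
  also have "sum (prod x) (insert i ` ?B) = (\<Sum>T\<in>?B. prod x (insert i T))"
    by (subst sum.reindex) (auto simp: inj_on_def)
  also have "\<dots> = (\<Sum>T\<in>?B. x i * prod x T)"
    by (intro sum.cong refl) (use fS in \<open>auto simp: subset_Diff_insert\<close>)
  finally show ?thesis by (simp add: esym_def sum_distrib_left)
qed

lemma sum_esym_remove:
  assumes "finite I"
  shows "(\<Sum>i\<in>I. esym k (I - {i}) x) = (real (card I) - real k) * esym k I x"
proof (cases k)
  case 0
  then show ?thesis using assms by simp
next
  case (Suc m)
  have "(\<Sum>i\<in>I. esym k (I - {i}) x) = (\<Sum>i\<in>I. esym k I x - x i * esym m (I - {i}) x)"
    by (intro sum.cong refl) (simp add: Suc esym_split[OF assms])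
  also have "\<dots> = real (card I) * esym k I x - real k * esym k I x"
    unfolding sum_subtractf esym_euler[OF assms] by (simp add: Suc)
  finally show ?thesis by (simp add: algebra_simps)
qed

lemma esym_has_derivative_line:
  assumes "finite I"
  shows "((\<lambda>s. esym (Suc k) I (\<lambda>i. x i + s * y i)) has_real_derivative
      (\<Sum>i\<in>I. y i * esym k (I - {i}) (\<lambda>i. x i + s * y i))) (at s)"
proof -
  have "((\<lambda>s. \<Prod>i\<in>S. x i + s * y i) has_real_derivative
      (\<Sum>i\<in>S. y i * (\<Prod>j\<in>S - {i}. x j + s * y j))) (at s)" for S
  proof -
    have "((\<lambda>s. \<Prod>i\<in>S. x i + s * y i) has_derivative
      (\<lambda>h. \<Sum>i\<in>S. (h * y i) * (\<Prod>j\<in>S - {i}. x j + s * y j))) (at s)"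
      by (rule has_derivative_prod) (auto intro!: derivative_eq_intros)
    then show ?thesis
      unfolding has_field_derivative_def
      by (rule has_derivative_eq_rhs) (auto simp: sum_distrib_left algebra_simps)
  qed
  then have "((\<lambda>s. esym (Suc k) I (\<lambda>i. x i + s * y i)) has_real_derivative
      (\<Sum>S | S \<subseteq> I \<and> card S = Suc k. \<Sum>i\<in>S. y i * (\<Prod>j\<in>S - {i}. x j + s * y j))) (at s)"
    unfolding esym_def by (intro DERIV_sum)
  also have "(\<Sum>S | S \<subseteq> I \<and> card S = Suc k. \<Sum>i\<in>S. y i * (\<Prod>j\<in>S - {i}. x j + s * y j)) =
      (\<Sum>i\<in>I. y i * esym k (I - {i}) (\<lambda>i. x i + s * y i))"
    unfolding esym_def sum_distrib_left by (rule sum_subsets_remove[OF assms])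
  finally show ?thesis .
qed

lemma esym_ge_power:
  assumes "finite I" "k \<le> card I" "c > 0" "\<And>i. i \<in> I \<Longrightarrow> c \<le> x i"
  shows "c ^ k \<le> esym k I x"
proof -
  obtain S where S: "S \<subseteq> I" "card S = k" "finite S"
    using obtain_subset_with_card_n[OF assms(2)] by auto
  have nn: "0 \<le> prod x T" if "T \<subseteq> I" for T
    by (rule prod_nonneg) (use assms that in \<open>fastforce\<close>)
  have "c ^ k = (\<Prod>i\<in>S. c)" using S by simp
  also have "\<dots> \<le> prod x S" by (rule prod_mono) (use S assms in force)
  also have "\<dots> \<le> esym k I x"
    unfolding esym_def by (rule member_le_sum) (use S assms nn in auto)
  finally show ?thesis .
qed

lemma esym_scale: "esym k I (\<lambda>i. t * x i) = t ^ k * esym k I x"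
proof -
  have "(\<Prod>i\<in>S. t * x i) = t ^ k * prod x S" if "card S = k" for S
    using that by (simp add: prod.distrib)
  then show ?thesis by (simp add: esym_def sum_distrib_left)
qed

lemma esym_pos:
  assumes "finite I" "k \<le> card I" "\<And>i. i \<in> I \<Longrightarrow> 0 < x i"
  shows "0 < esym k I x"
proof (cases "I = {}")
  case True
  then show ?thesis using assms by simp
next
  case False
  have "0 < Min (x ` I)" using assms False by simp
  moreover have "Min (x ` I) ^ k \<le> esym k I x"
    by (rule esym_ge_power) (use assms False in auto)
  ultimately show ?thesis by (meson less_le_trans zero_less_power)
qed

lemma continuous_on_esym_shift: "continuous_on A (\<lambda>s. esym k I (\<lambda>i. x i + s))"
  unfolding esym_def by (intro continuous_intros)

lemma esym_shift_limit:
  assumes "\<And>t. s < t \<Longrightarrow> 0 \<le> esym k I (\<lambda>i. x i + t)"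
  shows "0 \<le> esym k I (\<lambda>i. x i + s)"
proof (rule tendsto_lowerbound)
  have "continuous_on UNIV (\<lambda>s. esym k I (\<lambda>i. x i + s))" by (rule continuous_on_esym_shift)
  then have "isCont (\<lambda>s. esym k I (\<lambda>i. x i + s)) s" by (simp add: continuous_on_eq_continuous_at)
  then show "((\<lambda>s. esym k I (\<lambda>i. x i + s)) \<longlongrightarrow> esym k I (\<lambda>i. x i + s)) (at_right s)"
    by (simp add: isCont_def filterlim_at_split)
  show "\<forall>\<^sub>F t in at_right s. 0 \<le> esym k I (\<lambda>i. x i + t)"
    using assms by (auto simp: eventually_at_filter)
qed simp

lemma garding_cone_esym_pos:
  "garding_cone p I x \<Longrightarrow> finite I \<Longrightarrow> q \<le> p \<Longrightarrow> 0 < esym q I x"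
  by (cases q) (auto simp: garding_cone_def)

lemma garding_cone_mono: "garding_cone p I x \<Longrightarrow> q \<le> p \<Longrightarrow> garding_cone q I x"
  by (auto simp: garding_cone_def)

lemma garding_cone_Suc:
  "garding_cone (Suc p) I x \<longleftrightarrow> garding_cone p I x \<and> 0 < esym (Suc p) I x"
  by (auto simp: garding_cone_def le_Suc_eq)

lemma garding_cone_card:
  assumes "garding_cone p I x" "finite I"
  shows "p \<le> card I"
proof (rule ccontr)
  assume "\<not> p \<le> card I"
  then have "esym p I x = 0" using assms by (intro esym_eq_0_of_card_less) auto
  then show False using garding_cone_esym_pos[OF assms, of p] by simp
qed

lemma garding_cone_positive:
  assumes "finite I" "p \<le> card I" "\<And>i. i \<in> I \<Longrightarrow> 0 < x i"
  shows "garding_cone p I x"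
  using assms by (auto simp: garding_cone_def intro!: esym_pos)

text \<open>Along the diagonal the derivative of a symmetric function is a positive multiple of the one of one
degree less (\<open>sum_esym_remove\<close>).\<close>

lemma esym_shift_strict_mono:
  assumes "finite I" "k < card I" "s < t"
    and "\<And>r. s \<le> r \<Longrightarrow> 0 < esym k I (\<lambda>i. x i + r)"
  shows "esym (Suc k) I (\<lambda>i. x i + s) < esym (Suc k) I (\<lambda>i. x i + t)"
proof (rule DERIV_pos_imp_increasing[OF assms(3)])
  fix r assume r: "s \<le> r" "r \<le> t"
  have "((\<lambda>s. esym (Suc k) I (\<lambda>i. x i + s)) has_real_derivative
      (real (card I) - real k) * esym k I (\<lambda>i. x i + r)) (at r)"
    using esym_has_derivative_line[OF assms(1), of k x "\<lambda>_. 1" r]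
    by (simp add: sum_esym_remove[OF assms(1)])
  then show "\<exists>d. ((\<lambda>s. esym (Suc k) I (\<lambda>i. x i + s)) has_real_derivative d) (at r) \<and> 0 < d"
    using assms(2) assms(4)[OF r(1)] by (intro exI[of _ "(real (card I) - real k) * esym k I (\<lambda>i. x i + r)"]) simp
qed

lemma garding_cone_shift:
  assumes "garding_cone p I x" "finite I" "0 \<le> s"
  shows "garding_cone p I (\<lambda>i. x i + s)"
  using assms(1,3)
proof (induction p arbitrary: s)
  case 0
  then show ?case by (simp add: garding_cone_def)
next
  case (Suc p)
  have p: "p < card I" using garding_cone_card[OF Suc.prems(1) assms(2)] by simp
  have c: "garding_cone p I (\<lambda>i. x i + r)" if "0 \<le> r" for r
    using Suc that by (auto simp: garding_cone_Suc)
  have "0 < esym (Suc p) I (\<lambda>i. x i + s)"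
  proof (cases "s = 0")
    case True
    then show ?thesis using Suc.prems by (simp add: garding_cone_Suc)
  next
    case False
    have "esym (Suc p) I (\<lambda>i. x i + 0) < esym (Suc p) I (\<lambda>i. x i + s)"
      by (rule esym_shift_strict_mono[OF assms(2) p])
        (use False Suc.prems c garding_cone_esym_pos[OF _ assms(2), of p _ p] in auto)
    then show ?thesis using Suc.prems by (simp add: garding_cone_Suc)
  qed
  then show ?case using c Suc.prems by (simp add: garding_cone_Suc)
qed

text \<open>A substitute for Newton's inequality at a zero: if the function of degree \<open>Suc k\<close> vanishes, then without
the variable \<open>i\<close> it equals \<open>- x\<^sub>i\<close> times the function of degree \<open>k\<close> without \<open>i\<close>, and Euler's identity turns the
function of the next degree into minus a weighted sum of squares.\<close>

lemma esym_nonpos_after_zero: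
  assumes "finite I" "esym (Suc k) I x = 0"
    and "\<And>i. i \<in> I \<Longrightarrow> 0 \<le> esym k (I - {i}) x"
  shows "esym (Suc (Suc k)) I x \<le> 0"
proof -
  have "real (Suc (Suc k)) * esym (Suc (Suc k)) I x = (\<Sum>i\<in>I. x i * esym (Suc k) (I - {i}) x)"
    by (rule esym_euler[OF assms(1), symmetric])
  also have "\<dots> = (\<Sum>i\<in>I. - ((x i)\<^sup>2 * esym k (I - {i}) x))"
  proof (intro sum.cong refl)
    fix i assume "i \<in> I"
    then have "esym (Suc k) (I - {i}) x = - x i * esym k (I - {i}) x"
      using esym_split[OF assms(1), of i k x] assms(2) by simp
    then show "x i * esym (Suc k) (I - {i}) x = - ((x i)\<^sup>2 * esym k (I - {i}) x)"
      by (simp add: power2_eq_square)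
  qed
  also have "\<dots> \<le> 0" by (rule sum_nonpos) (use assms in simp)
  finally show ?thesis by (simp add: mult_le_0_iff)
qed

lemma ex_shift_ge:
  assumes "finite I"
  obtains s where "s0 \<le> s" "\<And>i. i \<in> I \<Longrightarrow> c \<le> (x i :: real) + s"
proof
  show "s0 \<le> max s0 (Max (insert 0 ((\<lambda>i. c - x i) ` I)))" by simp
  fix i assume "i \<in> I"
  then have "c - x i \<le> Max (insert 0 ((\<lambda>i. c - x i) ` I))" using assms by (intro Max_ge) auto
  then show "c \<le> x i + max s0 (Max (insert 0 ((\<lambda>i. c - x i) ` I)))" by linarith
qed

text \<open>If the function of degree \<open>Suc p\<close> without the variable \<open>i\<close> were not positive at \<open>x\<close>, it would vanish at a
point of the diagonal ray from \<open>x\<close>. There \<open>esym_nonpos_after_zero\<close> makes the full function of the next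
degree nonpositive, whereas the ray stays in the cone.\<close>

lemma garding_cone_remove:
  assumes "garding_cone (Suc p) I x" "finite I" "i \<in> I"
  shows "garding_cone p (I - {i}) x"
  using assms
proof (induction p arbitrary: I x i)
  case 0
  then show ?case by (simp add: garding_cone_def)
next
  case (Suc p)
  let ?b = "I - {i}"
  have fb: "finite ?b" using Suc by simp
  have b: "garding_cone p ?b x" using Suc by (auto simp: garding_cone_Suc)
  have card: "Suc p \<le> card ?b" using garding_cone_card[OF Suc.prems(1,2)] Suc.prems by simp
  have bs: "0 < esym p ?b (\<lambda>i. x i + r)" if "0 \<le> r" for r
    using garding_cone_shift[OF b fb that] fb by (rule garding_cone_esym_pos) simp
  have "0 < esym (Suc p) ?b x"
  proof (rule ccontr)
    assume neg: "\<not> 0 < esym (Suc p) ?b x"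
    obtain s1 where s1: "0 \<le> s1" "\<And>j. j \<in> ?b \<Longrightarrow> 1 \<le> x j + s1"
      using ex_shift_ge[OF fb, of 0 1 x] by auto
    have pos: "0 < esym (Suc p) ?b (\<lambda>j. x j + s1)"
      by (rule esym_pos[OF fb card]) (use s1 in force)
    obtain s where s: "0 \<le> s" "esym (Suc p) ?b (\<lambda>j. x j + s) = 0"
      using IVT'[of "\<lambda>s. esym (Suc p) ?b (\<lambda>j. x j + s)" 0 0 s1, OF _ _ s1(1) continuous_on_esym_shift]
        pos neg by auto
    \<comment> \<open>The induction hypothesis applies beyond \<open>s\<close>, where the function of degree \<open>Suc p\<close> is positive.\<close>
    have "0 \<le> esym p (?b - {j}) (\<lambda>j. x j + s)" if j: "j \<in> ?b" for j
    proof (rule esym_shift_limit)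
      fix t assume t: "s < t"
      have "esym (Suc p) ?b (\<lambda>j. x j + s) < esym (Suc p) ?b (\<lambda>j. x j + t)"
        by (rule esym_shift_strict_mono[OF fb _ t]) (use card bs s in auto)
      moreover have "garding_cone p ?b (\<lambda>j. x j + t)"
        by (rule garding_cone_shift[OF b fb]) (use s t in simp)
      ultimately have "garding_cone (Suc p) ?b (\<lambda>j. x j + t)"
        using s by (simp add: garding_cone_Suc)
      then have "garding_cone p (?b - {j}) (\<lambda>j. x j + t)" using Suc.IH fb j by blast
      then show "0 \<le> esym p (?b - {j}) (\<lambda>j. x j + t)"
        using garding_cone_esym_pos[of p _ _ p] fb by fastforce
    qed
    then have "esym (Suc (Suc p)) ?b (\<lambda>j. x j + s) \<le> 0"
      by (rule esym_nonpos_after_zero[OF fb s(2)])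
    then have "esym (Suc (Suc p)) I (\<lambda>j. x j + s) \<le> 0"
      using esym_split[OF Suc.prems(2,3), of "Suc p" "\<lambda>j. x j + s"] s by simp
    moreover have "garding_cone (Suc (Suc p)) I (\<lambda>j. x j + s)"
      by (rule garding_cone_shift[OF Suc.prems(1,2) s(1)])
    ultimately show False by (simp add: garding_cone_Suc)
  qed
  then show ?case using b by (simp add: garding_cone_Suc)
qed

definition esym_quot :: "nat \<Rightarrow> 'a set \<Rightarrow> ('a \<Rightarrow> real) \<Rightarrow> real" where
  "esym_quot p I x = esym (Suc p) I x / esym p I x"

text \<open>Each summand is a concave function, homogeneous of degree one, of the coordinate and of the quotient
of one degree less. This is how superadditivity passes from one degree to the next.\<close>

lemma esym_quot_Suc:
  assumes "garding_cone (Suc p) I x" "finite I"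
  shows "real (Suc (Suc p)) * esym_quot (Suc p) I x =
    (\<Sum>i\<in>I. x i - (x i)\<^sup>2 / (x i + esym_quot p (I - {i}) x))"
proof -
  have pos: "0 < esym (Suc p) I x" using assms by (simp add: garding_cone_Suc)
  have "real (Suc (Suc p)) * esym_quot (Suc p) I x =
      (\<Sum>i\<in>I. x i * esym (Suc p) (I - {i}) x) / esym (Suc p) I x"
    unfolding esym_quot_def using esym_euler[OF assms(2), of x "Suc p"] by simp
  also have "\<dots> = (\<Sum>i\<in>I. x i - (x i)\<^sup>2 / (x i + esym_quot p (I - {i}) x))"
    unfolding sum_divide_distrib
  proof (intro sum.cong refl)
    fix i assume i: "i \<in> I"
    have q: "0 < esym p (I - {i}) x"
      using garding_cone_remove[OF assms i] assms(2) by (auto intro: garding_cone_esym_pos)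
    have split: "esym (Suc p) I x = esym (Suc p) (I - {i}) x + x i * esym p (I - {i}) x"
      by (rule esym_split[OF assms(2) i])
    have "x i + esym_quot p (I - {i}) x = esym (Suc p) I x / esym p (I - {i}) x"
      unfolding esym_quot_def split using q by (simp add: field_simps)
    then have "x i - (x i)\<^sup>2 / (x i + esym_quot p (I - {i}) x)
        = x i - (x i)\<^sup>2 * esym p (I - {i}) x / esym (Suc p) I x" by simp
    also have "\<dots> = (x i * esym (Suc p) I x - (x i)\<^sup>2 * esym p (I - {i}) x) / esym (Suc p) I x"
      using pos by (simp add: field_simps)
    also have "x i * esym (Suc p) I x - (x i)\<^sup>2 * esym p (I - {i}) x = x i * esym (Suc p) (I - {i}) x"
      unfolding split by (simp add: algebra_simps power2_eq_square)
    finally show "x i * esym (Suc p) (I - {i}) x / esym (Suc p) I x =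
        x i - (x i)\<^sup>2 / (x i + esym_quot p (I - {i}) x)" by simp
  qed
  finally show ?thesis .
qed

lemma square_quot_subadditive:
  fixes a b c d e :: real
  assumes "0 < c" "0 < d" "c + d \<le> e"
  shows "(a + b)\<^sup>2 / e \<le> a\<^sup>2 / c + b\<^sup>2 / d"
proof -
  have "(a + b)\<^sup>2 / e \<le> (a + b)\<^sup>2 / (c + d)"
    using assms by (intro divide_left_mono mult_pos_pos) auto
  also have "\<dots> \<le> a\<^sup>2 / c + b\<^sup>2 / d"
  proof -
    have "(a + b)\<^sup>2 * (c * d) \<le> (a\<^sup>2 * d + b\<^sup>2 * c) * (c + d)"
      using zero_le_power2[of "a * d - b * c"] by (simp add: algebra_simps power2_eq_square)
    then show ?thesis using assms by (simp add: divide_simps mult_ac)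
  qed
  finally show ?thesis .
qed

text \<open>The inequality of Marcus and Lopes. The cone is closed under addition for the same reason: a positive
quotient carries positivity from one degree to the next, so both claims are proved together.\<close>

lemma esym_quot_superadditive:
  assumes "garding_cone p I x" "garding_cone p I y" "finite I"
  shows "garding_cone p I (\<lambda>i. x i + y i) \<and>
    esym_quot p I x + esym_quot p I y \<le> esym_quot p I (\<lambda>i. x i + y i)"
  using assms
proof (induction p arbitrary: I x y)
  case 0
  have "esym (Suc 0) I z = sum z I" for z :: "'a \<Rightarrow> real"
    using esym_euler[OF 0(3), of z 0] 0(3) by simp
  then show ?case using 0 by (simp add: garding_cone_def esym_quot_def sum.distrib)
next
  case (Suc p)
  let ?z = "\<lambda>i. x i + y i"
  have x: "garding_cone p I x" "0 < esym (Suc p) I x" and y: "garding_cone p I y" "0 < esym (Suc p) I y"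
    using Suc.prems by (auto simp: garding_cone_Suc)
  have px: "0 < esym p I x" "0 < esym p I y" 
    using x y Suc.prems(3) by (auto intro: garding_cone_esym_pos)
  have IH: "garding_cone p I ?z" "esym_quot p I x + esym_quot p I y \<le> esym_quot p I ?z"
    using Suc.IH[OF x(1) y(1) Suc.prems(3)] by auto
  have "0 < esym p I ?z" using IH(1) Suc.prems(3) by (auto intro: garding_cone_esym_pos)
  moreover have "0 < esym_quot p I x" "0 < esym_quot p I y" using x y px by (auto simp: esym_quot_def)
  then have "0 < esym_quot p I ?z" using IH(2) by linarith
  ultimately have "0 < esym (Suc p) I ?z" by (simp add: esym_quot_def zero_less_divide_iff)
  then have z: "garding_cone (Suc p) I ?z" using IH(1) by (simp add: garding_cone_Suc)
  have d: "0 < w i + esym_quot p (I - {i}) w" if "garding_cone (Suc p) I w" "i \<in> I" for w i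
  proof -
    have q: "0 < esym p (I - {i}) w"
      using garding_cone_remove[OF that(1) Suc.prems(3) that(2)] Suc.prems(3)
      by (auto intro: garding_cone_esym_pos)
    have "w i + esym_quot p (I - {i}) w = esym (Suc p) I w / esym p (I - {i}) w"
      unfolding esym_quot_def esym_split[OF Suc.prems(3) that(2)] using q by (simp add: field_simps)
    then show ?thesis using q that by (simp add: garding_cone_Suc)
  qed
  have "real (Suc (Suc p)) * (esym_quot (Suc p) I x + esym_quot (Suc p) I y)
      = (\<Sum>i\<in>I. x i + y i - ((x i)\<^sup>2 / (x i + esym_quot p (I - {i}) x)
          + (y i)\<^sup>2 / (y i + esym_quot p (I - {i}) y)))"
    unfolding distrib_left esym_quot_Suc[OF Suc.prems(1,3)] esym_quot_Suc[OF Suc.prems(2,3)]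
    by (simp add: sum.distrib sum_subtractf)
  also have "\<dots> \<le> (\<Sum>i\<in>I. x i + y i - (x i + y i)\<^sup>2 / (x i + y i + esym_quot p (I - {i}) ?z))"
  proof (intro sum_mono diff_left_mono square_quot_subadditive)
    fix i assume i: "i \<in> I"
    show "0 < x i + esym_quot p (I - {i}) x" "0 < y i + esym_quot p (I - {i}) y"
      using d i Suc.prems by auto
    have "esym_quot p (I - {i}) x + esym_quot p (I - {i}) y \<le> esym_quot p (I - {i}) ?z"
      using Suc.IH[of "I - {i}" x y] garding_cone_remove[OF _ Suc.prems(3) i] Suc.prems by simp
    then show "x i + esym_quot p (I - {i}) x + (y i + esym_quot p (I - {i}) y)
        \<le> x i + y i + esym_quot p (I - {i}) ?z" by simp
  qed
  also have "\<dots> = real (Suc (Suc p)) * esym_quot (Suc p) I ?z"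
    by (rule esym_quot_Suc[OF z Suc.prems(3), symmetric])
  finally show ?case using z by (simp add: mult_le_cancel_left)
qed

lemma esym_mono_garding_cone:
  assumes "garding_cone p I x" "garding_cone p I y" "finite I"
  shows "esym p I x \<le> esym p I (\<lambda>i. x i + y i)"
  using assms
proof (induction p)
  case 0
  then show ?case by simp
next
  case (Suc p)
  let ?z = "\<lambda>i. x i + y i"
  have c: "garding_cone p I x" "0 < esym (Suc p) I x" "garding_cone p I y" "0 < esym (Suc p) I y"
    using Suc.prems by (auto simp: garding_cone_Suc)
  have pos: "0 < esym p I x" "0 < esym p I y" "0 < esym p I ?z"
    using c esym_quot_superadditive[OF c(1,3) assms(3)] assms(3) by (auto intro: garding_cone_esym_pos)
  have "0 < esym_quot p I x" "0 < esym_quot p I y" using c pos by (auto simp: esym_quot_def)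
  then have "esym_quot p I x \<le> esym_quot p I ?z"
    using esym_quot_superadditive[OF c(1,3) assms(3)] by linarith
  then have "esym_quot p I x * esym p I x \<le> esym_quot p I ?z * esym p I ?z"
    using \<open>0 < esym_quot p I x\<close> pos c Suc.IH assms(3) by (intro mult_mono) auto
  then show ?case using pos by (simp add: esym_quot_def)
qed

text \<open>The sum is the derivative of \<open>\<sigma>\<close> at \<open>x\<close> in the direction \<open>y\<close>, and \<open>\<sigma>\<close> does not decrease when positive
multiples of \<open>y\<close> are added.\<close>

lemma garding_inequality:
  assumes "garding_cone (Suc p) I x" "garding_cone (Suc p) I y" "finite I"
  shows "0 \<le> (\<Sum>i\<in>I. y i * esym p (I - {i}) x)"
proof (rule ccontr)
  assume neg: "\<not> 0 \<le> (\<Sum>i\<in>I. y i * esym p (I - {i}) x)"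
  have "((\<lambda>s. esym (Suc p) I (\<lambda>i. x i + s * y i)) has_real_derivative
      (\<Sum>i\<in>I. y i * esym p (I - {i}) x)) (at 0)"
    using esym_has_derivative_line[OF assms(3), of p x y 0] by simp
  then obtain d where d: "d > 0" "\<And>h. 0 < h \<Longrightarrow> h < d \<Longrightarrow>
      esym (Suc p) I (\<lambda>i. x i + h * y i) < esym (Suc p) I x"
    using DERIV_neg_dec_right[of "\<lambda>s. esym (Suc p) I (\<lambda>i. x i + s * y i)" _ 0] neg by force
  have "garding_cone (Suc p) I (\<lambda>i. (d/2) * y i)"
    using assms(2) d(1) unfolding garding_cone_def esym_scale by simp
  then have "esym (Suc p) I x \<le> esym (Suc p) I (\<lambda>i. x i + (d/2) * y i)"
    using esym_mono_garding_cone assms by blast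
  then show False using d(2)[of "d/2"] d(1) by simp
qed

text \<open>At the last point outside the cone on the ray, all symmetric functions up to degree \<open>p\<close> are nonnegative and
one of them vanishes. By \<open>esym_nonpos_after_zero\<close> the following ones then vanish too, up to degree \<open>p\<close>,
so on the ray inside the cone \<open>\<sigma>\<^sub>p\<close> takes all positive values.\<close>

lemma garding_cone_shift_level:
  assumes "finite I" "1 \<le> p" "p \<le> card I" "\<not> garding_cone p I v" "0 < c"
  obtains s where "0 \<le> s" "garding_cone p I (\<lambda>i. v i + s)" "root p (esym p I (\<lambda>i. v i + s)) = c"
proof -
  define Z where "Z = {s. 0 \<le> s \<and> \<not> garding_cone p I (\<lambda>i. v i + s)}"
  obtain s1 where s1: "0 \<le> s1" "\<And>j. j \<in> I \<Longrightarrow> 1 \<le> v j + s1"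
    using ex_shift_ge[OF assms(1), of 0 1 v] by auto
  have up: "garding_cone p I (\<lambda>i. v i + s)" if "s1 \<le> s" for s
    by (rule garding_cone_positive[OF assms(1,3)]) (use s1 that in force)
  have "x \<le> s1" if "x \<in> Z" for x
    using up[of x] that by (cases "s1 \<le> x") (auto simp: Z_def)
  then have bdd: "bdd_above Z" by (rule bdd_aboveI)
  have "Z = {0..} \<inter> (\<Union>q\<in>{1..p}. {s. esym q I (\<lambda>i. v i + s) \<le> 0})"
    by (auto simp: Z_def garding_cone_def not_less)
  moreover have "closed \<dots>"
    by (intro closed_Int closed_UN ballI closed_Collect_le continuous_on_esym_shift) auto
  ultimately have "closed Z" by simp
  moreover have "0 \<in> Z" using assms(4) by (simp add: Z_def)
  ultimately have in_Z: "Sup Z \<in> Z" using bdd by (intro closed_contains_Sup) auto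
  define s0 where "s0 = Sup Z"
  let ?z = "\<lambda>i. v i + s0"
  have s0: "0 \<le> s0" "\<not> garding_cone p I ?z" using in_Z by (auto simp: Z_def s0_def)
  have above: "garding_cone p I (\<lambda>i. v i + t)" if "s0 < t" for t
  proof (rule ccontr)
    assume "\<not> garding_cone p I (\<lambda>i. v i + t)"
    then have "t \<in> Z" using that s0 by (simp add: Z_def)
    then show False using cSup_upper[OF _ bdd] that by (force simp: s0_def)
  qed
  have nonneg: "0 \<le> esym q I ?z" if "q \<le> p" for q
    by (rule esym_shift_limit) (use above garding_cone_esym_pos[OF _ assms(1) that] in force)
  obtain q where q: "1 \<le> q" "q \<le> p" "esym q I ?z = 0"
    using s0(2) nonneg unfolding garding_cone_def not_less by (metis antisym atLeastAtMost_iff linorder_not_less)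
  have "esym p I ?z = 0"
    using q(2)
  proof (induction p rule: dec_induct)
    case base
    then show ?case using q by simp
  next
    case (step r)
    obtain k where k: "r = Suc k" using step(1) q(1) by (cases r) auto
    have "0 \<le> esym k (I - {i}) ?z" if i: "i \<in> I" for i
    proof (rule esym_shift_limit)
      fix t assume "s0 < t"
      then have "garding_cone (Suc k) I (\<lambda>i. v i + t)"
        using garding_cone_mono[OF above, of t "Suc k"] step(2) k by simp
      then have "garding_cone k (I - {i}) (\<lambda>i. v i + t)"
        by (rule garding_cone_remove[OF _ assms(1) i])
      then show "0 \<le> esym k (I - {i}) (\<lambda>i. v i + t)"
        using garding_cone_esym_pos[of k _ _ k] assms(1) by fastforce
    qed
    then have "esym (Suc r) I ?z \<le> 0"
      using esym_nonpos_after_zero[OF assms(1), of k ?z] step.IH k by auto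
    then show ?case using nonneg[of "Suc r"] step(2) by auto
  qed
  moreover obtain s2 where s2: "s0 \<le> s2" "\<And>i. i \<in> I \<Longrightarrow> c \<le> v i + s2"
    using ex_shift_ge[OF assms(1), of s0 c v] by auto
  have "c ^ p \<le> esym p I (\<lambda>i. v i + s2)" by (rule esym_ge_power[OF assms(1,3,5)]) (use s2 in auto)
  ultimately obtain s where s: "s0 \<le> s" "esym p I (\<lambda>i. v i + s) = c ^ p"
    using IVT'[of "\<lambda>s. esym p I (\<lambda>i. v i + s)" s0 "c ^ p" s2, OF _ _ s2(1) continuous_on_esym_shift]
      zero_le_power[of c p] assms(5) by auto
  have "s \<noteq> s0" using \<open>esym p I ?z = 0\<close> s assms(5) by auto
  then have "garding_cone p I (\<lambda>i. v i + s)" using above s by simp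
  then show ?thesis using that[of s] s s0 assms(2,5) by (simp add: real_root_power_cancel)
qed

section \<open>Diagonalisation of symmetric matrices\<close>

text \<open>A maximiser \<open>v\<close> of the quadratic form on the unit sphere of \<open>S\<close> is an eigenvector: moving \<open>v\<close> along
\<open>w = f v - c v\<close> would otherwise increase the form to first order.\<close>

lemma symmetric_eigenvector_exists:
  fixes f :: "'a::euclidean_space \<Rightarrow> 'a"
  assumes lin: "linear f" and sym: "\<And>x y. x \<bullet> f y = f x \<bullet> y"
    and S: "subspace S" "f ` S \<subseteq> S" "S \<noteq> {0}"
  obtains v c where "v \<in> S" "norm v = 1" "f v = c *\<^sub>R v"
proof -
  obtain z where z: "z \<in> S" "z \<noteq> 0" using S subspace_0 by blast
  let ?K = "S \<inter> sphere 0 1"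
  have "z /\<^sub>R norm z \<in> ?K" using z S by (simp add: subspace_scale)
  moreover have "compact ?K" by (intro closed_Int_compact closed_subspace S compact_sphere)
  moreover have "continuous_on ?K (\<lambda>x. x \<bullet> f x)"
    by (intro continuous_intros linear_continuous_on linear_conv_bounded_linear[THEN iffD1] lin)
  ultimately obtain v where v: "v \<in> ?K" "\<And>x. x \<in> ?K \<Longrightarrow> x \<bullet> f x \<le> v \<bullet> f v"
    using continuous_attains_sup[of ?K "\<lambda>x. x \<bullet> f x"] by blast
  define c where "c = v \<bullet> f v"
  have vS: "v \<in> S" and nv: "norm v = 1" using v by auto
  have vv: "v \<bullet> v = 1" using nv by (simp add: dot_square_norm)
  have le: "x \<bullet> f x \<le> c * (x \<bullet> x)" if "x \<in> S" for x
  proof (cases "x = 0")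
    case False
    have "x /\<^sub>R norm x \<in> ?K" using False S that by (simp add: subspace_scale)
    from v(2)[OF this] show ?thesis using False
      by (simp add: linear_scale[OF lin] c_def field_simps dot_square_norm power2_eq_square)
  qed (simp add: linear_0[OF lin])
  define w where "w = f v - c *\<^sub>R v"
  have fv: "f v \<in> S" using S(2) vS by blast
  have wS: "w \<in> S" unfolding w_def using S(1) fv vS by (intro subspace_diff subspace_scale)
  have wv: "w \<bullet> v = 0" using vv by (simp add: w_def c_def inner_diff_left inner_commute[of "f v" v])
  have ww: "f v \<bullet> w = w \<bullet> w" using wv by (simp add: w_def inner_diff_left inner_diff_right inner_commute)
  \<comment> \<open>The maximality of \<open>v\<close>, tested at \<open>v + t w\<close>.\<close>
  have quad: "2 * t * (w \<bullet> w) \<le> t\<^sup>2 * (c * (w \<bullet> w) - w \<bullet> f w)" for t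
  proof -
    have "v + t *\<^sub>R w \<in> S" using S(1) vS wS by (intro subspace_add subspace_scale)
    from le[OF this] have "(v + t *\<^sub>R w) \<bullet> (f v + t *\<^sub>R f w) \<le> c * ((v + t *\<^sub>R w) \<bullet> (v + t *\<^sub>R w))"
      by (simp add: linear_add[OF lin] linear_scale[OF lin])
    moreover have "v \<bullet> f w = w \<bullet> w" "w \<bullet> f v = w \<bullet> w" using sym[of v w] ww by (simp_all add: inner_commute)
    moreover have "v \<bullet> w = 0" using wv by (simp add: inner_commute)
    ultimately show ?thesis
      using wv vv by (simp add: inner_add_left inner_add_right c_def[symmetric] algebra_simps power2_eq_square)
  qed
  have "w \<bullet> w = 0"
  proof (rule ccontr)
    assume "w \<bullet> w \<noteq> 0"
    then have pos: "0 < w \<bullet> w" using inner_ge_zero[of w] by linarith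
    define b where "b = c * (w \<bullet> w) - w \<bullet> f w"
    \<comment> \<open>Any positive \<open>t\<close> with \<open>t b < 2 (w \<bullet> w)\<close> contradicts \<open>quad\<close>.\<close>
    define t where "t = w \<bullet> w / (\<bar>b\<bar> + 1)"
    have t: "0 < t" using pos by (simp add: t_def)
    have "2 * t * (w \<bullet> w) \<le> t\<^sup>2 * b" using quad[of t] by (simp add: b_def)
    then have "2 * (w \<bullet> w) \<le> t * b" using t by (simp add: power2_eq_square)
    also have "\<dots> \<le> t * (\<bar>b\<bar> + 1)" using t by (intro mult_left_mono) auto
    also have "\<dots> = w \<bullet> w" by (simp add: t_def)
    finally show False using pos by simp
  qed
  then have "f v = c *\<^sub>R v" by (simp add: w_def)
  then show ?thesis using that vS nv by blast
qed

text \<open>An orthonormal set of eigenvectors of the greatest possible size spans the space, because its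
orthogonal complement is invariant and would otherwise contain a further eigenvector.\<close>

lemma symmetric_eigenbasis_exists:
  fixes f :: "'a::euclidean_space \<Rightarrow> 'a"
  assumes lin: "linear f" and sym: "\<And>x y. x \<bullet> f y = f x \<bullet> y"
  obtains B where "finite B" "card B = DIM('a)" "pairwise orthogonal B"
    "\<And>b. b \<in> B \<Longrightarrow> norm b = 1 \<and> (\<exists>c. f b = c *\<^sub>R b)"
proof -
  define P where "P B \<longleftrightarrow> pairwise orthogonal B \<and> (\<forall>b\<in>B. norm b = 1 \<and> (\<exists>c. f b = c *\<^sub>R b))" for B
  have ind: "independent B \<and> finite B \<and> card B \<le> DIM('a)" if "P B" for B
  proof -
    have "0 \<notin> B" using that by (auto simp: P_def)
    then have "independent B" using that pairwise_orthogonal_independent by (auto simp: P_def)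
    then show ?thesis using independent_bound by auto
  qed
  have "P {}" by (simp add: P_def)
  then obtain B where B: "P B" "\<And>B'. P B' \<Longrightarrow> card B' \<le> card B"
    using ex_has_greatest_nat[of P "{}" card "Suc DIM('a)"] ind by (metis le_imp_less_Suc)
  have fB: "finite B" "independent B" "card B \<le> DIM('a)" using ind[OF B(1)] by auto
  define S where "S = {x. \<forall>b\<in>B. x \<bullet> b = 0}"
  have sub: "subspace S" by (auto simp: S_def subspace_def inner_add_left)
  have inv: "f ` S \<subseteq> S"
  proof (auto simp: S_def)
    fix x b assume x: "\<forall>b\<in>B. x \<bullet> b = 0" and b: "b \<in> B"
    obtain c where "f b = c *\<^sub>R b" using B(1) b unfolding P_def by blast
    then show "f x \<bullet> b = 0" using x b by (simp add: sym[symmetric])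
  qed
  have "S = {0}"
  proof (rule ccontr)
    assume "S \<noteq> {0}"
    then obtain v c where v: "v \<in> S" "norm v = 1" "f v = c *\<^sub>R v"
      using symmetric_eigenvector_exists[OF lin sym sub inv] by blast
    have "P (insert v B)"
      using v B(1) unfolding P_def S_def
      by (auto simp: pairwise_insert orthogonal_def inner_commute)
    moreover have "v \<notin> B" using v by (auto simp: S_def)
    ultimately show False using B(2)[of "insert v B"] fB by simp
  qed
  have "span B = UNIV"
  proof (rule ccontr)
    assume "span B \<noteq> UNIV"
    then obtain a where a: "a \<noteq> 0" "\<forall>x\<in>span B. a \<bullet> x = 0"
      using span_not_UNIV_orthogonal by blast
    then have "a \<in> S" by (auto simp: S_def span_base)
    then show False using a \<open>S = {0}\<close> by simp
  qed
  then have "card B = DIM('a)" using fB by (metis dim_span_eq_card_independent dim_UNIV)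
  then show ?thesis using that[of B] B(1) fB by (auto simp: P_def)
qed

definition diag_mat :: "real ^ 'n \<Rightarrow> real ^ 'n ^ 'n::finite" where
  "diag_mat d = (\<chi> i j. if i = j then d $ i else 0)"

lemma matrix_mult_diag_mat: "(X ** diag_mat d) $ i $ j = X $ i $ j * d $ j"
  by (simp add: matrix_matrix_mult_def diag_mat_def if_distrib[of "\<lambda>x. _ * x"] cong: if_cong)

lemma diag_mat_mult_vec: "(diag_mat d *v x) $ i = d $ i * x $ i"
  by (simp add: matrix_vector_mult_def diag_mat_def if_distrib[of "\<lambda>x. x * _"] cong: if_cong)

lemma inner_matrix_vector_mult:
  fixes X :: "real ^ 'n ^ 'm"
  shows "x \<bullet> (X *v y) = (transpose X *v x) \<bullet> y"
  by (metis dot_lmul_matrix vector_transpose_matrix transpose_transpose)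

lemma congruence_entry:
  fixes P Q :: "real ^ 'k ^ 'n" and X :: "real ^ 'n ^ 'n"
  shows "(transpose P ** X ** Q) $ i $ j = column i P \<bullet> (X *v column j Q)"
  by (simp add: matrix_matrix_mult_def matrix_vector_mult_def column_def transpose_def inner_vec_def
      sum_distrib_left sum_distrib_right mult_ac)
    (rule sum.swap)

lemma spectral_theorem:
  fixes X :: "real ^ 'n ^ 'n::finite"
  assumes "transpose X = X"
  obtains Q d where "orthogonal_matrix Q" "transpose Q ** X ** Q = diag_mat d"
proof -
  have "x \<bullet> (X *v y) = (X *v x) \<bullet> y" for x y by (simp add: inner_matrix_vector_mult assms)
  then obtain B where B: "finite B" "card B = DIM(real^'n)" "pairwise orthogonal B"
    "\<And>b. b \<in> B \<Longrightarrow> norm b = 1 \<and> (\<exists>c. X *v b = c *\<^sub>R b)"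
    using symmetric_eigenbasis_exists[OF matrix_vector_mul_linear, of X] by metis
  then obtain h where h: "bij_betw h (UNIV :: 'n set) B"
    by (metis DIM_cart DIM_real finite_class.finite_UNIV finite_same_card_bij mult.right_neutral)
  define Q :: "real ^ 'n ^ 'n" where "Q = (\<chi> i j. h j $ i)"
  have col: "column j Q = h j" for j by (simp add: Q_def column_def)
  have hB: "h j \<in> B" for j using h by (auto simp: bij_betw_def)
  have hinj: "h i \<noteq> h j" if "i \<noteq> j" for i j using h that by (auto simp: bij_betw_def inj_on_def)
  have orth: "h i \<bullet> h j = (if i = j then 1 else 0)" for i j
  proof (cases "i = j")
    case True
    then show ?thesis using B(4)[OF hB[of i]] by (simp add: dot_square_norm)
  next
    case False
    then show ?thesis using B(3) hB hinj[OF False] by (auto simp: pairwise_def orthogonal_def)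
  qed
  have "orthogonal_matrix Q"
    unfolding orthogonal_matrix_orthonormal_columns col
    using orth B(4) hB by (auto simp: orthogonal_def)
  moreover have "transpose Q ** X ** Q = diag_mat (\<chi> i. h i \<bullet> (X *v h i))"
  proof (simp add: vec_eq_iff congruence_entry col diag_mat_def, intro allI impI)
    fix i j :: 'n assume ij: "i \<noteq> j"
    obtain c where "X *v h j = c *\<^sub>R h j" using B(4)[OF hB] by blast
    then show "h i \<bullet> (X *v h j) = 0" using orth[of i j] ij by simp
  qed
  ultimately show ?thesis using that by blast
qed

lemma ex_sorting_permutation:
  fixes d :: "'n::{finite,linorder} \<Rightarrow> 'a::linorder"
  obtains \<pi> :: "'n \<Rightarrow> 'n" where "bij \<pi>" "mono (\<lambda>i. d (\<pi> i))"
proof -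
  define ys where "ys = sorted_list_of_set (UNIV :: 'n set)"
  define xs where "xs = sort_key d ys"
  have ys: "distinct ys" "set ys = UNIV" "sorted ys" by (auto simp: ys_def)
  have xs: "distinct xs" "set xs = UNIV" "length xs = length ys" "sorted (map d xs)"
    using ys by (auto simp: xs_def)
  define N where "N = length ys"
  have bY: "bij_betw ((!) ys) {..<N} UNIV" using ys N_def by (intro bij_betw_nth) auto
  have bx: "bij_betw ((!) xs) {..<N} UNIV" using xs N_def by (intro bij_betw_nth) auto
  define \<pi> where "\<pi> = (!) xs \<circ> the_inv_into {..<N} ((!) ys)"
  have "bij \<pi>" unfolding \<pi>_def by (rule bij_betw_trans[OF bij_betw_the_inv_into[OF bY] bx])
  moreover have "mono (\<lambda>i. d (\<pi> i))"
  proof (rule monoI)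
    fix i j :: 'n assume le: "i \<le> j"
    have ex: "\<exists>k<N. i = ys ! k" for i
      using bY unfolding bij_betw_def by (metis UNIV_I imageE lessThan_iff)
    obtain k where k: "k < N" "i = ys ! k" using ex by blast
    obtain l where l: "l < N" "j = ys ! l" using ex by blast
    have inj: "inj_on ((!) ys) {..<N}" using bY by (simp add: bij_betw_def)
    have "k \<le> l"
    proof (rule ccontr)
      assume "\<not> k \<le> l"
      then have "j \<le> i" using sorted_nth_mono[OF ys(3), of l k] k l by (simp add: N_def)
      then have "ys ! k = ys ! l" using le k l by simp
      then show False using inj_onD[OF inj, of k l] k(1) l(1) \<open>\<not> k \<le> l\<close> by simp
    qed
    then have "d (xs ! k) \<le> d (xs ! l)"
      using sorted_nth_mono[OF xs(4), of k l] l xs(3) by (simp add: N_def)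
    then show "d (\<pi> i) \<le> d (\<pi> j)"
      using k l inj by (simp add: \<pi>_def the_inv_into_f_f)
  qed
  ultimately show ?thesis using that by blast
qed

lemma sorted_spectral_theorem:
  fixes X :: "'n::{finite,linorder} rmat"
  assumes "transpose X = X"
  obtains Q d where "orthogonal_matrix Q" "transpose Q ** X ** Q = diag_mat d" "mono (($) d)"
proof -
  obtain Q d where Q: "orthogonal_matrix Q" "transpose Q ** X ** Q = diag_mat d"
    using spectral_theorem[OF assms] by blast
  obtain \<pi> :: "'n \<Rightarrow> 'n" where pi: "bij \<pi>" "mono (\<lambda>i. d $ \<pi> i)" using ex_sorting_permutation[of "($) d"] by blast
  define R where "R = (\<chi> i j. Q $ i $ \<pi> j)"
  have col: "column j R = column (\<pi> j) Q" for j by (simp add: R_def column_def)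
  have inj: "\<pi> i = \<pi> j \<longleftrightarrow> i = j" for i j using pi(1) by (auto simp: bij_def inj_def)
  have "orthogonal_matrix R"
    using Q(1) inj unfolding orthogonal_matrix_orthonormal_columns col by auto
  moreover have "transpose R ** X ** R = diag_mat (\<chi> i. d $ \<pi> i)"
  proof -
    have "(transpose R ** X ** R) $ i $ j = (transpose Q ** X ** Q) $ \<pi> i $ \<pi> j" for i j
      by (simp add: congruence_entry col)
    then show ?thesis by (simp add: vec_eq_iff Q(2) diag_mat_def inj)
  qed
  moreover have "mono (($) (\<chi> i. d $ \<pi> i))" using pi(2) by (simp add: mono_def)
  ultimately show ?thesis using that by blast
qed

lemma transpose_congruence: 
  fixes X :: "real^'n^'n" and P :: "real^'k^'n"
  shows "transpose (transpose P ** X ** P) = transpose P ** transpose X ** P"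
  by (simp add: matrix_transpose_mul matrix_mul_assoc)

text \<open>Rescaling the eigenvectors of \<open>G\<close> gives a frame orthonormal for \<open>G\<close>; a rotation of it, which keeps this
property, diagonalises \<open>B\<close>.\<close>

lemma simultaneous_diagonalization:
  fixes G B :: "'n::{finite,linorder} rmat"
  assumes G: "transpose G = G" "\<And>v. v \<noteq> 0 \<Longrightarrow> 0 < v \<bullet> (G *v v)" and B: "transpose B = B"
  obtains P :: "'n rmat" and d :: "'n rvec" where "transpose P ** G ** P = mat 1" "transpose P ** B ** P = diag_mat d" "mono (($) d)"
proof -
  obtain Q e where Q: "orthogonal_matrix Q" "transpose Q ** G ** Q = diag_mat e"
    using spectral_theorem[OF G(1)] by blast
  have e: "0 < e $ i" for i
  proof -
    have "norm (column i Q) = 1" using Q(1) unfolding orthogonal_matrix_orthonormal_columns by blast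
    then have "0 < column i Q \<bullet> (G *v column i Q)" by (intro G(2)) auto
    also have "\<dots> = diag_mat e $ i $ i" unfolding Q(2)[symmetric] congruence_entry ..
    finally show ?thesis by (simp add: diag_mat_def)
  qed
  define P where "P = (\<chi> i j. Q $ i $ j / sqrt (e $ j))"
  have colP: "column j P = (1 / sqrt (e $ j)) *\<^sub>R column j Q" for j
    by (simp add: P_def column_def vec_eq_iff)
  have P: "transpose P ** G ** P = mat 1"
  proof -
    have "(transpose P ** G ** P) $ i $ j
        = (transpose Q ** G ** Q) $ i $ j / (sqrt (e $ i) * sqrt (e $ j))" for i j
      by (simp add: congruence_entry colP matrix_vector_mult_scaleR)
    then show ?thesis using e by (simp add: vec_eq_iff Q(2) diag_mat_def mat_def less_imp_neq[symmetric] less_imp_le)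
  qed
  obtain R d where R: "orthogonal_matrix R" "transpose R ** (transpose P ** B ** P) ** R = diag_mat d"
      "mono (($) d)"
    using sorted_spectral_theorem[of "transpose P ** B ** P"] B by (auto simp: transpose_congruence)
  have c: "transpose (P ** R) ** X ** (P ** R) = transpose R ** (transpose P ** X ** P) ** R" for X
    by (simp add: matrix_transpose_mul matrix_mul_assoc)
  have "transpose (P ** R) ** G ** (P ** R) = mat 1"
    unfolding c P using R(1) by (simp add: orthogonal_matrix)
  then show ?thesis using that[of "P ** R" d] R by (simp add: c)
qed

section \<open>Characteristic polynomials and principal minors\<close>

lemma proots_linear_factor: "proots [:- a, 1:] = {#a::real#}"
proof (rule multiset_eqI)
  fix x
  have "order x [:- a, 1:] = (if x = a then 1 else 0)"
    using order_power_n_n[of a 1] by (auto intro: order_0I)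
  then show "count (proots [:- a, 1:]) x = count {#a#} x" by simp
qed

text \<open>The two polynomials have the same multiset of roots, and a monotone enumeration of a multiset is unique.\<close>

lemma mono_eq_of_prod_eq:
  fixes v w :: "'n::{finite,linorder} \<Rightarrow> real"
  assumes "mono v" "mono w" "\<And>t. (\<Prod>i\<in>UNIV. t - v i) = (\<Prod>i\<in>UNIV. t - w i)"
  shows "v = w"
proof -
  define q where "q v = (\<Prod>i\<in>UNIV. [:- v i, 1:])" for v :: "'n \<Rightarrow> real"
  have "poly (q v) = poly (q w)"
    using assms(3) by (intro ext) (simp add: q_def poly_prod)
  then have "q v = q w" by (simp add: poly_eq_poly_eq_iff)
  moreover have "proots (q u) = image_mset u (mset_set UNIV)" for u
  proof -
    have "proots (q u) = (\<Sum>i\<in>UNIV. {#u i#})"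
      unfolding q_def by (subst proots_prod) (auto simp: proots_linear_factor)
    also have "\<dots> = image_mset u (mset_set UNIV)"
      by (simp add: sum_unfold_sum_mset)
    finally show ?thesis .
  qed
  ultimately have eq: "image_mset v (mset_set UNIV) = image_mset w (mset_set UNIV)" by metis
  define ys where "ys = sorted_list_of_set (UNIV :: 'n set)"
  have ys: "mset ys = mset_set UNIV" "sorted ys" "set ys = UNIV"
    using mset_set_set[of ys] by (simp_all add: ys_def)
  have "sorted (map u ys)" if "mono u" for u :: "'n \<Rightarrow> real"
    using ys(2) that by (auto simp: sorted_map sorted_wrt_iff_nth_less mono_def)
  moreover have "mset (map v ys) = mset (map w ys)" using eq ys by simp
  ultimately have "map v ys = map w ys"
    using assms by (metis properties_for_sort)
  then show ?thesis using ys(3) by (auto simp: map_eq_conv)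
qed

lemma eigvals_eqI:
  fixes X :: "'n::{finite,linorder} rmat"
  assumes "mono (($) v)" "\<And>t. det (mat t - X) = (\<Prod>i\<in>UNIV. t - v $ i)"
  shows "eigvals X = v"
  unfolding eigvals_def
proof (rule the_equality)
  fix u :: "'n rvec" assume u: "mono (($) u) \<and> (\<forall>t. det (mat t - X) = (\<Prod>i\<in>UNIV. t - u $ i))"
  then have "($) u = ($) v" by (intro mono_eq_of_prod_eq) (use assms in auto)
  then show "u = v" by (simp add: vec_eq_iff fun_eq_iff)
qed (use assms in auto)

definition similar_to_diag :: "real ^ 'n ^ 'n \<Rightarrow> real ^ 'n::finite \<Rightarrow> bool" where
  "similar_to_diag X d \<longleftrightarrow> (\<exists>P P'. P' ** P = mat 1 \<and> P' ** X ** P = diag_mat d)"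

lemma similar_to_diag_conjugate:
  assumes "similar_to_diag X d" "P' ** P = mat 1"
  shows "similar_to_diag (P ** X ** P') d"
proof -
  obtain R R' where R: "R' ** R = mat 1" "R' ** X ** R = diag_mat d"
    using assms by (auto simp: similar_to_diag_def)
  have "(R' ** P') ** (P ** R) = R' ** (P' ** P) ** R" by (simp add: matrix_mul_assoc)
  moreover have "(R' ** P') ** (P ** X ** P') ** (P ** R) = R' ** (P' ** P) ** X ** (P' ** P) ** R"
    by (simp add: matrix_mul_assoc)
  ultimately have "(R' ** P') ** (P ** R) = mat 1"
    "(R' ** P') ** (P ** X ** P') ** (P ** R) = diag_mat d"
    using assms(2) R by simp_all
  then show ?thesis unfolding similar_to_diag_def by blast
qed

lemma matrix_scaleR_mult_left: "(c *\<^sub>R X) ** Y = c *\<^sub>R (X ** (Y :: real ^ 'k ^ 'n))"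
  by (simp add: vec_eq_iff matrix_matrix_mult_def sum_distrib_left mult_ac)

lemma matrix_scaleR_mult_right: "X ** (c *\<^sub>R Y) = c *\<^sub>R (X ** (Y :: real ^ 'k ^ 'n))"
  by (simp add: vec_eq_iff matrix_matrix_mult_def sum_distrib_left mult_ac)

lemma matrix_mult_add_left: "(X + Y) ** Z = X ** Z + Y ** (Z :: real ^ 'k ^ 'n)"
  by (simp add: vec_eq_iff matrix_matrix_mult_def sum.distrib algebra_simps)

lemma matrix_mult_add_right: "Z ** (X + Y) = Z ** X + Z ** (Y :: real ^ 'k ^ 'n)"
  by (simp add: vec_eq_iff matrix_matrix_mult_def sum.distrib algebra_simps)

lemma mat_eq_scaleR: "mat t = t *\<^sub>R (mat 1 :: real ^ 'n ^ 'n)"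
  by (simp add: vec_eq_iff mat_def)

lemma det_similar_to_diag:
  assumes "similar_to_diag X d"
  shows "det (mat t + s *\<^sub>R X) = (\<Prod>i\<in>UNIV. t + s * d $ i)"
proof -
  obtain P P' where P: "P' ** P = mat 1" "P' ** X ** P = diag_mat d"
    using assms by (auto simp: similar_to_diag_def)
  have "det (mat t + s *\<^sub>R X) = det (P' ** (mat t + s *\<^sub>R X) ** P)"
    using arg_cong[OF P(1), of det] by (simp add: det_mul)
  also have "P' ** (mat t + s *\<^sub>R X) ** P = mat t + s *\<^sub>R diag_mat d"
    unfolding mat_eq_scaleR[of t]
    by (simp add: matrix_mult_add_left matrix_mult_add_right matrix_scaleR_mult_left
        matrix_scaleR_mult_right P flip: P(2))
  also have "det \<dots> = (\<Prod>i\<in>UNIV. t + s * d $ i)"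
    by (subst det_diagonal) (auto simp: mat_def diag_mat_def)
  finally show ?thesis .
qed

lemma eigvals_similar_to_diag:
  assumes "similar_to_diag X d" "mono (($) d)"
  shows "eigvals X = d"
  using det_similar_to_diag[OF assms(1), of _ "-1"] by (intro eigvals_eqI assms) simp

text \<open>The sum of the principal minors of size \<open>k\<close>, written out with the Leibniz formula.\<close>

definition minor_sum :: "nat \<Rightarrow> real ^ 'n ^ 'n::finite \<Rightarrow> real" where
  "minor_sum k X = (\<Sum>S | S \<subseteq> UNIV \<and> card S = k. \<Sum>\<pi> | \<pi> permutes S.
     of_int (sign \<pi>) * (\<Prod>i\<in>S. X $ i $ \<pi> i))"

lemma sum_Pow_by_card:
  fixes h :: "'n::finite set \<Rightarrow> real"
  shows "(\<Sum>S\<in>Pow UNIV. h S) = (\<Sum>k\<le>CARD('n). \<Sum>S | S \<subseteq> UNIV \<and> card S = k. h S)"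
proof -
  have "(\<Sum>k\<le>CARD('n). \<Sum>S | S \<in> Pow UNIV \<and> card S = k. h S) = (\<Sum>S\<in>Pow UNIV. h S)"
    by (rule sum.group) (auto intro: card_mono)
  then show ?thesis by simp
qed

lemma prod_plus_eq_esym:
  fixes d :: "'n::finite \<Rightarrow> real"
  shows "(\<Prod>i\<in>UNIV. t + d i) = (\<Sum>k\<le>CARD('n). esym k UNIV d * t ^ (CARD('n) - k))"
proof -
  have "(\<Prod>i\<in>UNIV. t + d i) = (\<Sum>S\<in>Pow UNIV. prod d S * t ^ (CARD('n) - card S))"
    using prod_add[of "UNIV :: 'n set" d "\<lambda>_. t"]
    by (simp add: add.commute card_Diff_subset)
  then show ?thesis
    unfolding sum_Pow_by_card esym_def sum_distrib_right by simp
qed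

text \<open>Expand each Leibniz product of \<open>t + X\<close> over the set \<open>S\<close> of rows whose factor is taken from \<open>X\<close>. The remaining
factors are nonzero only if the permutation fixes all other rows, that is, if it permutes \<open>S\<close>.\<close>

lemma det_plus_eq_minor_sum:
  fixes X :: "real ^ 'n ^ 'n::finite"
  shows "det (mat t + X) = (\<Sum>k\<le>CARD('n). minor_sum k X * t ^ (CARD('n) - k))"
proof -
  let ?n = "CARD('n)"
  let ?X = "\<lambda>S \<pi>. of_int (sign \<pi>) * (\<Prod>i\<in>S. X $ i $ \<pi> i)"
  have summand: "of_int (sign \<pi>) * (\<Prod>i\<in>UNIV. (mat t + X) $ i $ \<pi> i) =
      (\<Sum>S\<in>Pow UNIV. if \<pi> permutes S then ?X S \<pi> * t ^ (?n - card S) else 0)"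
    if \<pi>: "\<pi> permutes UNIV" for \<pi> :: "'n \<Rightarrow> 'n"
  proof -
    have rest: "(\<Prod>i\<in>UNIV - S. if i = \<pi> i then t else 0) =
        (if \<pi> permutes S then t ^ (?n - card S) else 0)" for S
    proof (cases "\<pi> permutes S")
      case True
      then have "(\<Prod>i\<in>UNIV - S. if i = \<pi> i then t else 0) = (\<Prod>i\<in>UNIV - S. t)"
        by (intro prod.cong) (auto simp: permutes_not_in)
      then show ?thesis using True by (simp add: card_Diff_subset)
    next
      case False
      then obtain i where "i \<notin> S" "i \<noteq> \<pi> i"
        using \<pi> by (auto simp: permutes_def)
      then show ?thesis using False by (auto intro!: prod_zero)
    qed
    have "(\<Prod>i\<in>UNIV. (mat t + X) $ i $ \<pi> i) =
        (\<Prod>i\<in>UNIV. X $ i $ \<pi> i + (if i = \<pi> i then t else 0))"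
      by (intro prod.cong) (auto simp: mat_def)
    also have "\<dots> = (\<Sum>S\<in>Pow UNIV. (\<Prod>i\<in>S. X $ i $ \<pi> i) *
        (\<Prod>i\<in>UNIV - S. if i = \<pi> i then t else 0))"
      by (rule prod_add) simp
    finally show ?thesis
      unfolding rest by (simp add: sum_distrib_left mult_ac if_distrib cong: if_cong)
  qed
  have "det (mat t + X) = (\<Sum>\<pi> | \<pi> permutes UNIV. \<Sum>S\<in>Pow UNIV.
      if \<pi> permutes S then ?X S \<pi> * t ^ (?n - card S) else 0)"
    unfolding det_def by (intro sum.cong refl summand) simp
  also have "\<dots> = (\<Sum>S\<in>Pow UNIV. \<Sum>\<pi> | \<pi> permutes UNIV.
      if \<pi> permutes S then ?X S \<pi> * t ^ (?n - card S) else 0)"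
    by (rule sum.swap)
  also have "\<dots> = (\<Sum>S\<in>Pow UNIV. (\<Sum>\<pi> | \<pi> permutes S. ?X S \<pi>) * t ^ (?n - card S))"
  proof (intro sum.cong refl)
    fix S :: "'n set"
    have "{\<pi>. \<pi> permutes S} = {\<pi> \<in> {\<pi>. \<pi> permutes UNIV}. \<pi> permutes S}"
      using permutes_subset[of _ S UNIV] by auto
    then show "(\<Sum>\<pi> | \<pi> permutes UNIV. if \<pi> permutes S then ?X S \<pi> * t ^ (?n - card S) else 0) =
        (\<Sum>\<pi> | \<pi> permutes S. ?X S \<pi>) * t ^ (?n - card S)"
      unfolding sum_distrib_right by (simp only: sum.inter_filter finite_permutations[OF finite])
  qed
  also have "\<dots> = (\<Sum>k\<le>?n. minor_sum k X * t ^ (?n - k))"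
    unfolding sum_Pow_by_card minor_sum_def sum_distrib_right by simp
  finally show ?thesis .
qed

text \<open>This makes symmetric functions of the eigenvalues polynomial in the entries of the matrix, and so
differentiable also where eigenvalues coincide.\<close>

lemma esym_eq_minor_sum:
  fixes X :: "real ^ 'n ^ 'n::finite"
  assumes "similar_to_diag X d" "k \<le> CARD('n)"
  shows "esym k UNIV (($) d) = minor_sum k X"
proof -
  let ?n = "CARD('n)"
  have rev: "(\<Sum>k\<le>?n. a k * t ^ (?n - k)) = (\<Sum>k\<le>?n. a (?n - k) * t ^ k)" for a and t :: real
    by (rule sum.reindex_bij_witness[where i="\<lambda>k. ?n - k" and j="\<lambda>k. ?n - k"]) auto
  have "(\<Sum>k\<le>?n. esym (?n - k) UNIV (($) d) * t ^ k) = (\<Sum>k\<le>?n. minor_sum (?n - k) X * t ^ k)" for t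
    using det_similar_to_diag[OF assms(1), of t 1]
    unfolding rev[symmetric, of "\<lambda>k. esym k UNIV (($) d)"] rev[symmetric, of "\<lambda>k. minor_sum k X"]
    by (simp add: prod_plus_eq_esym det_plus_eq_minor_sum)
  then have "\<forall>k\<le>?n. esym (?n - k) UNIV (($) d) = minor_sum (?n - k) X"
    unfolding polyfun_eq_coeffs[symmetric] by blast
  from this[rule_format, of "?n - k"] show ?thesis using assms(2) by simp
qed

text \<open>A permutation other than the identity moves at least two indices, so near a diagonal matrix its term is of
second order. Only the diagonal of \<open>H\<close> enters the derivative.\<close>

lemma minor_sum_has_derivative_diag:
  fixes H :: "real ^ 'n ^ 'n::finite"
  shows "((\<lambda>s. minor_sum (Suc k) (diag_mat d + s *\<^sub>R H)) has_real_derivative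
    (\<Sum>i\<in>UNIV. H $ i $ i * esym k (UNIV - {i}) (($) d))) (at 0)"
proof -
  have "((\<lambda>s. \<Prod>i\<in>S. (diag_mat d + s *\<^sub>R H) $ i $ \<pi> i) has_real_derivative
      (if \<pi> = id then (\<Sum>i\<in>S. H $ i $ i * prod (($) d) (S - {i})) else 0)) (at 0)"
    if \<pi>: "\<pi> permutes S" for S and \<pi> :: "'n \<Rightarrow> 'n"
  proof -
    have "((\<lambda>s. \<Prod>i\<in>S. (diag_mat d + s *\<^sub>R H) $ i $ \<pi> i) has_derivative
      (\<lambda>h. \<Sum>i\<in>S. (h * H $ i $ \<pi> i) * (\<Prod>j\<in>S - {i}. (diag_mat d + 0 *\<^sub>R H) $ j $ \<pi> j))) (at 0)"
      by (rule has_derivative_prod) (auto intro!: derivative_eq_intros)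
    then have "((\<lambda>s. \<Prod>i\<in>S. (diag_mat d + s *\<^sub>R H) $ i $ \<pi> i) has_real_derivative
        (\<Sum>i\<in>S. H $ i $ \<pi> i * (\<Prod>j\<in>S - {i}. diag_mat d $ j $ \<pi> j))) (at 0)"
      unfolding has_field_derivative_def
      by (rule has_derivative_eq_rhs) (auto simp: sum_distrib_left algebra_simps)
    also have "(\<Sum>i\<in>S. H $ i $ \<pi> i * (\<Prod>j\<in>S - {i}. diag_mat d $ j $ \<pi> j)) =
        (if \<pi> = id then (\<Sum>i\<in>S. H $ i $ i * prod (($) d) (S - {i})) else 0)"
    proof (cases "\<pi> = id")
      case True
      then show ?thesis by (simp add: diag_mat_def)
    next
      case False
      then obtain a where a: "\<pi> a \<noteq> a" by (auto simp: fun_eq_iff)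
      then have aS: "a \<in> S" "\<pi> a \<in> S" "\<pi> (\<pi> a) \<noteq> \<pi> a"
        using permutes_not_in[OF \<pi>] permutes_in_image[OF \<pi>] injD[OF permutes_inj[OF \<pi>], of "\<pi> a" a]
        by blast+
      \<comment> \<open>Both \<open>a\<close> and \<open>\<pi> a\<close> are moved, and at most one of them is \<open>i\<close>.\<close>
      have "(\<Prod>j\<in>S - {i}. diag_mat d $ j $ \<pi> j) = 0" for i
        by (rule prod_zero, simp, rule bexI[of _ "if i = a then \<pi> a else a"])
          (use a aS in \<open>auto simp: diag_mat_def\<close>)
      then show ?thesis using False by (simp only: if_False mult_zero_right sum.neutral_const)
    qed
    finally show ?thesis .
  qed
  then have "((\<lambda>s. minor_sum (Suc k) (diag_mat d + s *\<^sub>R H)) has_real_derivative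
     (\<Sum>S | S \<subseteq> UNIV \<and> card S = Suc k. \<Sum>\<pi> | \<pi> permutes S. of_int (sign \<pi>) *
        (if \<pi> = id then (\<Sum>i\<in>S. H $ i $ i * prod (($) d) (S - {i})) else 0))) (at 0)"
    unfolding minor_sum_def by (intro DERIV_sum DERIV_cmult) auto
  also have "(\<Sum>S | S \<subseteq> UNIV \<and> card S = Suc k. \<Sum>\<pi> | \<pi> permutes S. of_int (sign \<pi>) *
        (if \<pi> = id then (\<Sum>i\<in>S. H $ i $ i * prod (($) d) (S - {i})) else 0)) =
      (\<Sum>S | S \<subseteq> UNIV \<and> card S = Suc k. \<Sum>i\<in>S. H $ i $ i * prod (($) d) (S - {i}))"
  proof (intro sum.cong refl)
    fix S :: "'n set"
    let ?c = "\<Sum>i\<in>S. H $ i $ i * prod (($) d) (S - {i})"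
    have "(\<Sum>\<pi> | \<pi> permutes S. of_int (sign \<pi>) * (if \<pi> = id then ?c else 0)) =
        (\<Sum>\<pi> | \<pi> permutes S. if \<pi> = id then ?c else 0)"
      by (intro sum.cong refl) (auto simp: sign_id)
    also have "\<dots> = ?c"
      by (subst sum.delta) (auto simp: finite_permutations permutes_id)
    finally show "(\<Sum>\<pi> | \<pi> permutes S. of_int (sign \<pi>) * (if \<pi> = id then ?c else 0)) = ?c" .
  qed
  also have "\<dots> = (\<Sum>i\<in>UNIV. H $ i $ i * esym k (UNIV - {i}) (($) d))"
    unfolding esym_def sum_distrib_left by (rule sum_subsets_remove) simp
  finally show ?thesis .
qed

lemma matrix_inv_eqI:
  fixes A :: "real ^ 'n ^ 'n"
  assumes "A ** B = mat 1"
  shows "matrix_inv A = B"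
proof -
  have "B ** A = mat 1" using assms by (simp add: matrix_left_right_inverse)
  then have "A ** matrix_inv A = mat 1 \<and> matrix_inv A ** A = mat 1"
    unfolding matrix_inv_def using assms by (intro someI_ex[of "\<lambda>X. A ** X = mat 1 \<and> X ** A = mat 1"]) blast
  then have "matrix_inv A = matrix_inv A ** (A ** B)" using assms by simp
  also have "\<dots> = B" using \<open>A ** matrix_inv A = mat 1 \<and> _\<close> by (simp add: matrix_mul_assoc)
  finally show ?thesis .
qed

lemma matrix_eq_dim1:
  fixes X Y :: "real ^ 'n ^ 'n"
  assumes n: "(UNIV :: 'n set) = {i}" and eq: "X $ i $ i = Y $ i $ i"
  shows "X = Y"
proof -
  have "X $ j $ k = Y $ j $ k" for j k
  proof -
    have "j = i" "k = i" using n by blast+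
    then show ?thesis using eq by simp
  qed
  then show ?thesis by (simp add: vec_eq_iff)
qed

lemma eigvals_dim1:
  fixes G X :: "'n::{finite,linorder} rmat"
  assumes n: "(UNIV :: 'n set) = {i}" and G: "G $ i $ i \<noteq> 0"
  shows "eigvals (matrix_inv G ** X) $ i = X $ i $ i / G $ i $ i"
proof -
  define N :: "'n rmat" where "N = (\<chi> j k. 1 / G $ i $ i)"
  have "G ** N = mat 1"
    by (rule matrix_eq_dim1[OF n]) (simp add: matrix_matrix_mult_def mat_def N_def n G)
  then have inv: "matrix_inv G = N" by (rule matrix_inv_eqI)
  define d :: "'n rvec" where "d = (\<chi> j. X $ i $ i / G $ i $ i)"
  have "matrix_inv G ** X = diag_mat d"
    by (rule matrix_eq_dim1[OF n]) (simp add: matrix_matrix_mult_def diag_mat_def N_def d_def inv n)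
  moreover have "similar_to_diag (diag_mat d) d"
    unfolding similar_to_diag_def by (intro exI[of _ "mat 1"]) simp
  moreover have "mono (($) d)" by (simp add: mono_def d_def)
  ultimately have "eigvals (matrix_inv G ** X) = d" using eigvals_similar_to_diag by metis
  then show ?thesis by (simp add: d_def)
qed

section \<open>The linearised operator in a diagonalising frame\<close>

lemma elem_sym_eq_esym: "elem_sym p \<mu> = esym p UNIV (($) \<mu>)"
  by (simp add: elem_sym_def esym_def)

lemma Gamma_cone_iff: "\<mu> \<in> Gamma_cone p \<longleftrightarrow> garding_cone p UNIV (($) \<mu>)"
  by (simp add: Gamma_cone_def garding_cone_def elem_sym_eq_esym)

lemma frame_inverse:
  fixes P G :: "real ^ 'n ^ 'n"
  assumes "transpose P ** G ** P = mat 1"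
  shows "P ** transpose P ** G = mat 1" "matrix_inv G = P ** transpose P"
proof -
  have "P ** (transpose P ** G) = mat 1"
    using assms by (simp add: matrix_left_right_inverse)
  then show 1: "P ** transpose P ** G = mat 1" by (simp add: matrix_mul_assoc)
  then have "G ** (P ** transpose P) = mat 1"
    by (simp add: matrix_left_right_inverse)
  then show "matrix_inv G = P ** transpose P" by (rule matrix_inv_eqI)
qed

text \<open>For a frame \<open>P\<close> orthonormal for \<open>G\<close>, the inverse of \<open>G\<close> is \<open>P P\<^sup>T\<close>, so the product of the inverse of \<open>G\<close> with \<open>S\<close> is
conjugate to the matrix of \<open>S\<close> in the frame.\<close>

lemma pencil_similar_to_diag:
  fixes P G S :: "real ^ 'n ^ 'n"
  assumes "transpose P ** G ** P = mat 1" "similar_to_diag (transpose P ** S ** P) d"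
  shows "similar_to_diag (matrix_inv G ** S) d"
proof -
  have "P ** (transpose P ** S ** P) ** (transpose P ** G) = P ** transpose P ** S ** (P ** transpose P ** G)"
    by (simp add: matrix_mul_assoc)
  also have "\<dots> = matrix_inv G ** S" by (simp add: frame_inverse[OF assms(1)])
  finally show ?thesis using similar_to_diag_conjugate[OF assms(2,1)] by simp
qed

lemma orthogonal_similar_to_diag:
  "orthogonal_matrix Q \<Longrightarrow> transpose Q ** X ** Q = diag_mat d \<Longrightarrow> similar_to_diag X d"
  unfolding similar_to_diag_def orthogonal_matrix by blast

lemma elem_sym_eigvals_pencil:
  fixes P G S :: "'n::{finite,linorder} rmat"
  assumes P: "transpose P ** G ** P = mat 1" and S: "transpose S = S" and p: "p \<le> CARD('n)"
  shows "elem_sym p (eigvals (matrix_inv G ** S)) = minor_sum p (transpose P ** S ** P)"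
proof -
  obtain Q and d :: "'n rvec" where Q: "orthogonal_matrix Q" "transpose Q ** (transpose P ** S ** P) ** Q = diag_mat d"
      "mono (($) d)"
    using sorted_spectral_theorem[of "transpose P ** S ** P"] S by (auto simp: transpose_congruence)
  have X: "similar_to_diag (transpose P ** S ** P) d" using Q by (auto intro: orthogonal_similar_to_diag)
  have "eigvals (matrix_inv G ** S) = d"
    by (rule eigvals_similar_to_diag[OF pencil_similar_to_diag[OF P X] Q(3)])
  then show ?thesis using esym_eq_minor_sum[OF X p] by (simp add: elem_sym_eq_esym)
qed

lemma eigvals_pencil:
  fixes G S P :: "'n::{finite,linorder} rmat"
  assumes "transpose P ** G ** P = mat 1" "similar_to_diag (transpose P ** S ** P) d" "mono (($) d)"
  shows "eigvals (matrix_inv G ** S) = d"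
  by (rule eigvals_similar_to_diag[OF pencil_similar_to_diag[OF assms(1,2)] assms(3)])

lemma hessian_op_eq_minor_sum:
  fixes P G B :: "'n::{finite,linorder} rmat"
  assumes "transpose P ** G ** P = mat 1" "p \<le> CARD('n)"
  shows "hessian_op p G B = root p (minor_sum p (transpose P ** ((1/2) *\<^sub>R (B + transpose B)) ** P))"
proof -
  have "transpose ((1/2) *\<^sub>R (B + transpose B)) = (1/2) *\<^sub>R (B + transpose B)"
    by (simp add: vec_eq_iff transpose_def)
  from elem_sym_eigvals_pencil[OF assms(1) this assms(2)] show ?thesis
    by (simp add: hessian_op_def matrix_scaleR_mult_right)
qed

text \<open>The gradient at \<open>d\<close> of \<open>\<sigma>\<^sub>p\<close> to the power \<open>1/p\<close>.\<close>

definition grad_weight :: "nat \<Rightarrow> real ^ 'n::finite \<Rightarrow> real ^ 'n" where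
  "grad_weight p d = (\<chi> i. esym (p - 1) (UNIV - {i}) (($) d) /
     (real p * root p (esym p UNIV (($) d)) ^ (p - 1)))"

text \<open>In the frame \<open>P\<close> the operator becomes a root of \<open>minor_sum\<close> along a line through a diagonal matrix. The direction is
the symmetrised \<open>E\<close>, which has the same quadratic form as \<open>E\<close>.\<close>

lemma hessian_op_has_derivative:
  fixes P G B E :: "'n::{finite,linorder} rmat"
  assumes P: "transpose P ** G ** P = mat 1" and B: "transpose B = B"
    and d: "transpose P ** B ** P = diag_mat d"
    and p: "1 \<le> p" "p \<le> CARD('n)" and pos: "0 < esym p UNIV (($) d)"
  shows "((\<lambda>s. hessian_op p G (B + s *\<^sub>R E)) has_real_derivative
    (\<Sum>i\<in>UNIV. grad_weight p d $ i * (column i P \<bullet> (E *v column i P)))) (at 0)"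
proof -
  obtain k where k: "p = Suc k" using p by (cases p) auto
  let ?E = "(1/2) *\<^sub>R (E + transpose E)"
  define H where "H = transpose P ** ?E ** P"
  have "transpose P ** ((1/2) *\<^sub>R (B + s *\<^sub>R E + transpose (B + s *\<^sub>R E))) ** P = diag_mat d + s *\<^sub>R H" for s
  proof -
    have "(1/2) *\<^sub>R (B + s *\<^sub>R E + transpose (B + s *\<^sub>R E)) = B + s *\<^sub>R ?E"
      using B by (simp add: vec_eq_iff transpose_def field_simps)
    then show ?thesis
      by (simp only: H_def matrix_mult_add_left matrix_mult_add_right matrix_scaleR_mult_left
          matrix_scaleR_mult_right d)
  qed
  then have op: "hessian_op p G (B + s *\<^sub>R E) = root p (minor_sum p (diag_mat d + s *\<^sub>R H))" for s
    using hessian_op_eq_minor_sum[OF P p(2), of "B + s *\<^sub>R E"] by simp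
  have sim: "similar_to_diag (diag_mat d) d"
    unfolding similar_to_diag_def by (intro exI[of _ "mat 1"]) simp
  then have at0: "minor_sum p (diag_mat d + 0 *\<^sub>R H) = esym p UNIV (($) d)"
    using esym_eq_minor_sum[OF sim p(2)] by simp
  have Hii: "H $ i $ i = column i P \<bullet> (E *v column i P)" for i
  proof -
    have "column i P \<bullet> (transpose E *v column i P) = column i P \<bullet> (E *v column i P)"
      by (simp add: inner_matrix_vector_mult[of _ E] inner_commute)
    then show ?thesis
      by (simp add: H_def congruence_entry matrix_vector_mult_scaleR inner_add_right
          scaleR_matrix_vector_assoc[symmetric] matrix_vector_mult_add_rdistrib)
  qed
  let ?r = "root p (esym p UNIV (($) d))"
  have "((\<lambda>s. root p (minor_sum p (diag_mat d + s *\<^sub>R H))) has_real_derivative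
      inverse (real p * ?r ^ (p - Suc 0)) * (\<Sum>i\<in>UNIV. H $ i $ i * esym k (UNIV - {i}) (($) d))) (at 0)"
    using p pos unfolding at0[symmetric]
    by (intro DERIV_chain2[of "root p"] DERIV_real_root)
      (auto simp: k minor_sum_has_derivative_diag)
  also have "inverse (real p * ?r ^ (p - Suc 0)) * (\<Sum>i\<in>UNIV. H $ i $ i * esym k (UNIV - {i}) (($) d)) =
      (\<Sum>i\<in>UNIV. grad_weight p d $ i * (column i P \<bullet> (E *v column i P)))"
    unfolding sum_distrib_left
    by (intro sum.cong refl) (simp add: grad_weight_def Hii k field_simps)
  finally show ?thesis by (simp add: op)
qed

lemma congruence_diag_entry:
  fixes P :: "real ^ 'n ^ 'n"
  shows "(P ** diag_mat w ** transpose P) $ j $ k = (\<Sum>i\<in>UNIV. w $ i * P $ j $ i * P $ k $ i)"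
  by (subst matrix_matrix_mult_def) (simp add: matrix_mult_diag_mat transpose_def mult_ac)

lemma gradient_hessian_op:
  fixes P G B :: "'n::{finite,linorder} rmat"
  assumes "transpose P ** G ** P = mat 1" "transpose B = B" "transpose P ** B ** P = diag_mat d"
    and "1 \<le> p" "p \<le> CARD('n)" "0 < esym p UNIV (($) d)"
  shows "(\<chi> j k. deriv (\<lambda>s. hessian_op p G (B + s *\<^sub>R axis j (axis k 1))) 0) =
    P ** diag_mat (grad_weight p d) ** transpose P"
proof -
  have "deriv (\<lambda>s. hessian_op p G (B + s *\<^sub>R axis j (axis k 1))) 0 =
      (\<Sum>i\<in>UNIV. grad_weight p d $ i * P $ j $ i * P $ k $ i)" for j k
  proof -
    have ax: "(axis j (axis k 1) :: 'n rmat) *v x = axis j (x $ k)" for x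
      by (simp add: vec_eq_iff matrix_vector_mult_def axis_def if_distrib[of "\<lambda>y. y * _"]
          if_distrib[of "\<lambda>f. f $ _"] cong: if_cong)
    show ?thesis
      using DERIV_imp_deriv[OF hessian_op_has_derivative[OF assms, of "axis j (axis k 1)"]]
      by (simp add: ax inner_axis column_def mult_ac)
  qed
  then show ?thesis unfolding vec_eq_iff congruence_diag_entry by simp
qed

lemma sum_congruence_diag:
  fixes P M :: "real ^ 'n ^ 'n"
  shows "(\<Sum>j\<in>UNIV. \<Sum>k\<in>UNIV. (P ** diag_mat w ** transpose P) $ j $ k * M $ j $ k) =
    (\<Sum>i\<in>UNIV. w $ i * (column i P \<bullet> (M *v column i P)))"
proof -
  have "(\<Sum>j\<in>UNIV. \<Sum>k\<in>UNIV. (P ** diag_mat w ** transpose P) $ j $ k * M $ j $ k) =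
      (\<Sum>j\<in>UNIV. \<Sum>k\<in>UNIV. \<Sum>i\<in>UNIV. w $ i * (P $ j $ i * (M $ j $ k * P $ k $ i)))"
    unfolding congruence_diag_entry sum_distrib_right by (simp add: mult_ac)
  also have "\<dots> = (\<Sum>j\<in>UNIV. \<Sum>i\<in>UNIV. \<Sum>k\<in>UNIV. w $ i * (P $ j $ i * (M $ j $ k * P $ k $ i)))"
    by (intro sum.cong refl sum.swap)
  also have "\<dots> = (\<Sum>i\<in>UNIV. \<Sum>j\<in>UNIV. \<Sum>k\<in>UNIV. w $ i * (P $ j $ i * (M $ j $ k * P $ k $ i)))"
    by (rule sum.swap)
  finally show ?thesis
    by (simp add: inner_vec_def matrix_vector_mult_def column_def sum_distrib_left)
qed

text \<open>With \<open>P\<^sup>T G\<close> inverse to \<open>P\<close>, the matrix is conjugate to the diagonal matrix of \<open>w\<close>.\<close>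

lemma min_eigval_congruence:
  fixes P G :: "real ^ 'n ^ 'n"
  assumes P: "transpose P ** G ** P = mat 1"
  shows "min_eigval (P ** diag_mat w ** transpose P ** G) = Min (range (($) w))"
proof -
  let ?F = "P ** diag_mat w ** transpose P ** G" and ?L = "transpose P ** G"
  have FP: "?F *v (P *v y) = P *v (diag_mat w *v y)" for y
    using P by (simp add: matrix_vector_mul_assoc flip: matrix_mul_assoc) 
  have LP: "?L *v (P *v y) = y" for y using P by (simp add: matrix_vector_mul_assoc)
  have PL: "P *v (?L *v v) = v" for v
    using frame_inverse(1)[OF P] by (simp add: matrix_vector_mul_assoc matrix_mul_assoc)
  have "{t. \<exists>v. v \<noteq> 0 \<and> ?F *v v = t *\<^sub>R v} = range (($) w)"
  proof (intro set_eqI iffI)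
    fix t assume "t \<in> {t. \<exists>v. v \<noteq> 0 \<and> ?F *v v = t *\<^sub>R v}"
    then obtain v where v: "v \<noteq> 0" "?F *v v = t *\<^sub>R v" by blast
    define y where "y = ?L *v v"
    have Py: "P *v y = v" by (simp add: y_def PL)
    then have "y \<noteq> 0" using v(1) by auto
    then obtain i where i: "y $ i \<noteq> 0" by (auto simp: vec_eq_iff)
    have "P *v (diag_mat w *v y) = P *v (t *\<^sub>R y)"
      using v(2) FP[of y] by (simp add: Py matrix_vector_mult_scaleR)
    then have "diag_mat w *v y = t *\<^sub>R y" using LP by metis
    then have "w $ i * y $ i = t * y $ i" by (metis diag_mat_mult_vec vector_scaleR_component real_scaleR_def)
    then show "t \<in> range (($) w)" using i by auto
  next
    fix t assume "t \<in> range (($) w)"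
    then obtain i where t: "t = w $ i" by blast
    let ?e = "axis i 1 :: real ^ 'n"
    have "diag_mat w *v ?e = t *\<^sub>R ?e"
      by (simp add: vec_eq_iff diag_mat_mult_vec t) (simp add: axis_def)
    then have "?F *v (P *v ?e) = t *\<^sub>R (P *v ?e)" by (simp add: FP matrix_vector_mult_scaleR)
    moreover have "P *v ?e \<noteq> 0" using LP[of ?e] by (metis axis_eq_0_iff matrix_vector_mult_0_right zero_neq_one)
    ultimately show "t \<in> {t. \<exists>v. v \<noteq> 0 \<and> ?F *v v = t *\<^sub>R v}" by blast
  qed
  then show ?thesis by (simp add: min_eigval_def)
qed

text \<open>The difference of the two sides is \<open>x\<^sub>j - x\<^sub>i\<close> times a symmetric function without both variables, which is
nonnegative by \<open>garding_cone_remove\<close>.\<close>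

lemma esym_remove_antimono:
  assumes "garding_cone (Suc k) I x" "finite I" "i \<in> I" "j \<in> I" "x i \<le> x j"
  shows "esym k (I - {j}) x \<le> esym k (I - {i}) x"
proof (cases "i = j \<or> k = 0")
  case True
  then show ?thesis using assms by auto
next
  case False
  then obtain l where l: "k = Suc l" by (cases k) auto
  have ij: "i \<in> I - {j}" "j \<in> I - {i}" "i \<noteq> j" using False assms by auto
  have sets: "I - {j} - {i} = I - {i} - {j}" by blast
  have c: "garding_cone l (I - {i} - {j}) x"
    using garding_cone_remove[OF garding_cone_remove[OF assms(1)[unfolded l] assms(2,3)], of j] ij assms by simp
  have "0 \<le> esym l (I - {i} - {j}) x"
    using garding_cone_esym_pos[OF c, of l] assms by simp
  then have "x i * esym l (I - {i} - {j}) x \<le> x j * esym l (I - {i} - {j}) x"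
    using assms by (intro mult_right_mono)
  then show ?thesis
    using esym_split[of "I - {i}" j l x] esym_split[of "I - {j}" i l x] ij assms
    by (simp add: l sets)
qed

text \<open>The function \<open>b\<close> is a concave function of \<open>\<eta>\<close> with slope \<open>f\<close>. A new greatest index extends it linearly, with
the slope at the greatest index so far.\<close>

lemma ex_concave_potential:
  fixes f \<eta> :: "'n::linorder \<Rightarrow> real"
  assumes "finite A" "\<And>i j. i \<le> j \<Longrightarrow> f j \<le> f i" "\<And>i j. i \<le> j \<Longrightarrow> \<eta> i \<le> \<eta> j"
  shows "\<exists>b. \<forall>i\<in>A. \<forall>k\<in>A. b k - b i \<le> f i * (\<eta> k - \<eta> i)"
  using assms(1)
proof (induction A rule: finite_linorder_max_induct)
  case empty
  then show ?case by simp
next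
  case (insert m A)
  then obtain b where b: "\<And>i k. i \<in> A \<Longrightarrow> k \<in> A \<Longrightarrow> b k - b i \<le> f i * (\<eta> k - \<eta> i)" by blast
  show ?case
  proof (cases "A = {}")
    case True
    then show ?thesis by auto
  next
    case False
    define l where "l = Max A"
    have l: "l \<in> A" "l \<le> m" "\<And>k. k \<in> A \<Longrightarrow> k \<le> l" "m \<notin> A"
      using insert False by (auto simp: l_def intro: less_imp_le)
    define b' where "b' = b(m := b l + f l * (\<eta> m - \<eta> l))"
    have b'A: "b' k = b k" if "k \<in> A" for k using that l by (auto simp: b'_def)
    have "b' k - b' i \<le> f i * (\<eta> k - \<eta> i)" if ik: "i \<in> insert m A" "k \<in> insert m A" for i k
    proof -
      consider "i = m" "k = m" | "i \<in> A" "k \<in> A" | "i \<in> A" "k = m" | "i = m" "k \<in> A" using ik by blast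
      then show ?thesis
      proof cases
        case 3
        have "(f l - f i) * (\<eta> m - \<eta> l) \<le> 0"
          using assms(2)[OF l(3)[OF 3(1)]] assms(3)[OF l(2)] by (simp add: mult_le_0_iff)
        then show ?thesis using b[OF 3(1) l(1)] 3 b'A[OF 3(1)] by (simp add: b'_def algebra_simps)
      next
        case 4
        have "k \<le> m" using l(2) l(3)[OF 4(2)] by simp
        then have "(f l - f m) * (\<eta> k - \<eta> m) \<le> 0"
          using assms(2)[OF l(2)] assms(3)[of k m] by (simp add: mult_le_0_iff)
        then show ?thesis using b[OF l(1) 4(2)] 4 b'A[OF 4(2)] by (simp add: b'_def algebra_simps)
      qed (use b b'A in auto)
    qed
    then show ?thesis by blast
  qed
qed

text \<open>Pairing \<open>D\<close> with the inequalities of \<open>ex_concave_potential\<close> makes the potential cancel, because the rows and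
the columns of \<open>D\<close> have the same sums. This is linear programming duality for the assignment problem, with the
potential as dual solution, and it avoids decomposing \<open>D\<close> into permutations.\<close>

lemma doubly_stochastic_rearrangement:
  fixes f \<eta> :: "'n::{finite,linorder} \<Rightarrow> real"
  assumes "\<And>i j. i \<le> j \<Longrightarrow> f j \<le> f i" "\<And>i j. i \<le> j \<Longrightarrow> \<eta> i \<le> \<eta> j"
    and "\<And>i k. 0 \<le> D i k" "\<And>i. (\<Sum>k\<in>UNIV. D i k) = 1" "\<And>k. (\<Sum>i\<in>UNIV. D i k) = 1"
  shows "(\<Sum>i\<in>UNIV. f i * \<eta> i) \<le> (\<Sum>i\<in>UNIV. f i * (\<Sum>k\<in>UNIV. D i k * \<eta> k))"
proof -
  obtain b where b: "\<And>i k. b k - b i \<le> f i * (\<eta> k - \<eta> i)"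
    using ex_concave_potential[of UNIV f \<eta>] assms(1,2) by auto
  have "0 = (\<Sum>k\<in>UNIV. b k * (\<Sum>i\<in>UNIV. D i k)) - (\<Sum>i\<in>UNIV. b i * (\<Sum>k\<in>UNIV. D i k))"
    by (simp add: assms)
  also have "(\<Sum>k\<in>UNIV. b k * (\<Sum>i\<in>UNIV. D i k)) = (\<Sum>i\<in>UNIV. \<Sum>k\<in>UNIV. b k * D i k)"
    unfolding sum_distrib_left by (rule sum.swap)
  also have "\<dots> - (\<Sum>i\<in>UNIV. b i * (\<Sum>k\<in>UNIV. D i k)) = (\<Sum>i\<in>UNIV. \<Sum>k\<in>UNIV. D i k * (b k - b i))"
    by (simp add: sum_subtractf sum_distrib_left algebra_simps)
  also have "\<dots> \<le> (\<Sum>i\<in>UNIV. \<Sum>k\<in>UNIV. D i k * (f i * (\<eta> k - \<eta> i)))"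
    by (intro sum_mono mult_left_mono b assms)
  also have "\<dots> = (\<Sum>i\<in>UNIV. f i * (\<Sum>k\<in>UNIV. D i k * \<eta> k) - f i * \<eta> i * (\<Sum>k\<in>UNIV. D i k))"
    by (simp add: sum_subtractf sum_distrib_left algebra_simps)
  finally show ?thesis by (simp add: assms sum_subtractf)
qed

lemma
  fixes d :: "'n::{finite,linorder} rvec"
  assumes d: "garding_cone p UNIV (($) d)" "mono (($) d)" and p: "1 \<le> p"
  shows grad_weight_nonneg: "0 \<le> grad_weight p d $ i"
    and grad_weight_antimono: "i \<le> j \<Longrightarrow> grad_weight p d $ j \<le> grad_weight p d $ i"
    and grad_weight_euler: "(\<Sum>i\<in>UNIV. grad_weight p d $ i * d $ i) = root p (esym p UNIV (($) d))"
    and grad_weight_pairing_nonneg: "garding_cone p UNIV y \<Longrightarrow> 0 \<le> (\<Sum>i\<in>UNIV. grad_weight p d $ i * y i)"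
proof -
  obtain k where k: "p = Suc k" using p by (cases p) auto
  define r where "r = root p (esym p UNIV (($) d))"
  have pos: "0 < esym p UNIV (($) d)" using garding_cone_esym_pos[OF d(1), of p] by simp
  then have r: "0 < r" using p by (simp add: r_def)
  have c: "0 < real p * r ^ (p - 1)" using r p by simp
  have w: "grad_weight p d $ i = esym k (UNIV - {i}) (($) d) / (real p * r ^ (p - 1))" for i
    by (simp add: grad_weight_def r_def k)
  have "garding_cone k (UNIV - {i}) (($) d)" for i
    by (rule garding_cone_remove) (use d(1) k in auto)
  from garding_cone_esym_pos[OF this finite order_refl] show "0 \<le> grad_weight p d $ i"
    using c by (simp add: w less_imp_le)
  show "grad_weight p d $ j \<le> grad_weight p d $ i" if "i \<le> j"
    unfolding w using c d(1) k monoD[OF d(2) that]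
    by (intro divide_right_mono esym_remove_antimono) auto
  have "(\<Sum>i\<in>UNIV. grad_weight p d $ i * d $ i) =
      (\<Sum>i\<in>UNIV. d $ i * esym k (UNIV - {i}) (($) d)) / (real p * r ^ (p - 1))"
    by (simp add: w sum_divide_distrib mult_ac)
  also have "\<dots> = real p * esym p UNIV (($) d) / (real p * r ^ (p - 1))"
    using esym_euler[of UNIV "($) d" k] by (simp add: k)
  also have "esym p UNIV (($) d) = r * r ^ (p - 1)"
    using real_root_pow_pos2[of p "esym p UNIV (($) d)"] pos by (simp add: k r_def)
  finally show "(\<Sum>i\<in>UNIV. grad_weight p d $ i * d $ i) = root p (esym p UNIV (($) d))"
    using p r unfolding r_def[symmetric] by simp
  assume y: "garding_cone p UNIV y"
  have "0 \<le> (\<Sum>i\<in>UNIV. y i * esym k (UNIV - {i}) (($) d)) / (real p * r ^ (p - 1))"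
    using garding_inequality[of k UNIV "($) d" y] d(1) y c k by simp
  also have "\<dots> = (\<Sum>i\<in>UNIV. grad_weight p d $ i * y i)"
    by (simp add: w sum_divide_distrib mult_ac)
  finally show "0 \<le> (\<Sum>i\<in>UNIV. grad_weight p d $ i * y i)" .
qed

lemma Min_range_antimono:
  fixes w :: "'n::{finite,linorder} \<Rightarrow> real"
  assumes "\<And>i j. i \<le> j \<Longrightarrow> w j \<le> w i"
  shows "Min (range w) = w (Max UNIV)"
  by (rule Min_eqI) (use assms in \<open>auto intro: Max_ge\<close>)

text \<open>The diagonal of \<open>X\<close> is the image of its eigenvalues \<open>\<mu>\<close> under the doubly stochastic matrix of the squared
entries of \<open>Q\<close>. After the rearrangement, Garding's inequality is applied to the raised vector in \<open>cone\<close>.\<close>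

lemma gradient_pairing_lower_bound:
  fixes d \<mu> :: "'n::{finite,linorder} rvec" and Q X :: "'n rmat"
  assumes d: "garding_cone p UNIV (($) d)" "mono (($) d)" and p: "1 \<le> p"
    and Q: "orthogonal_matrix Q" "transpose Q ** X ** Q = diag_mat \<mu>" "mono (($) \<mu>)"
    and cone: "garding_cone p UNIV (\<lambda>i. \<mu> $ i - \<epsilon> + (if i = Max UNIV then K else 0))"
  shows "\<epsilon> * (\<Sum>i\<in>UNIV. grad_weight p d $ i) - K * Min (range (($) (grad_weight p d)))
      - root p (esym p UNIV (($) d))
    \<le> (\<Sum>i\<in>UNIV. grad_weight p d $ i * (X $ i $ i - d $ i))"
proof -
  let ?w = "\<lambda>i. grad_weight p d $ i"
  define D where "D i k = (Q $ i $ k)\<^sup>2" for i k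
  have QQ: "transpose Q ** Q = mat 1" "Q ** transpose Q = mat 1"
    using Q(1) by (simp_all add: orthogonal_matrix_def)
  have rows: "(\<Sum>k\<in>UNIV. D i k) = 1" for i
    using arg_cong[OF QQ(2), of "\<lambda>M. M $ i $ i"]
    by (simp add: D_def matrix_matrix_mult_def transpose_def mat_def power2_eq_square)
  have cols: "(\<Sum>i\<in>UNIV. D i k) = 1" for k
    using arg_cong[OF QQ(1), of "\<lambda>M. M $ k $ k"]
    by (simp add: D_def matrix_matrix_mult_def transpose_def mat_def power2_eq_square)
  have "X = Q ** transpose Q ** X ** (Q ** transpose Q)" by (simp add: QQ)
  also have "\<dots> = Q ** diag_mat \<mu> ** transpose Q" by (simp add: matrix_mul_assoc flip: Q(2))
  finally have X: "X $ i $ i = (\<Sum>k\<in>UNIV. D i k * \<mu> $ k)" for i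
    by (simp only: congruence_diag_entry) (simp add: D_def power2_eq_square mult_ac)
  have "0 \<le> (\<Sum>i\<in>UNIV. ?w i * (\<mu> $ i - \<epsilon> + (if i = Max UNIV then K else 0)))"
    by (rule grad_weight_pairing_nonneg[OF d p cone])
  also have "\<dots> = (\<Sum>i\<in>UNIV. ?w i * \<mu> $ i) - \<epsilon> * (\<Sum>i\<in>UNIV. ?w i) + K * ?w (Max UNIV)"
  proof -
    have "?w i * (\<mu> $ i - \<epsilon> + (if i = Max UNIV then K else 0)) =
        ?w i * \<mu> $ i - \<epsilon> * ?w i + (if i = Max UNIV then K * ?w i else 0)" for i
      by (simp add: algebra_simps)
    then show ?thesis by (simp add: sum.distrib sum_subtractf sum_distrib_left)
  qed
  also have "?w (Max UNIV) = Min (range ?w)"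
    by (rule Min_range_antimono[symmetric]) (rule grad_weight_antimono[OF d p])
  finally have "\<epsilon> * (\<Sum>i\<in>UNIV. ?w i) - K * Min (range ?w) \<le> (\<Sum>i\<in>UNIV. ?w i * \<mu> $ i)" by simp
  also have "\<dots> \<le> (\<Sum>i\<in>UNIV. ?w i * X $ i $ i)"
    unfolding X
    by (rule doubly_stochastic_rearrangement)
      (use grad_weight_antimono[OF d p] monoD[OF Q(3)] rows cols in \<open>auto simp: D_def\<close>)
  finally show ?thesis
    using grad_weight_euler[OF d p]
    by (simp add: algebra_simps sum_subtractf)
qed

lemma translated_orthant_memI:
  fixes a \<xi> :: "'n::finite rvec"
  assumes "\<And>i. a $ i < \<xi> $ i"
  shows "\<xi> \<in> {a} + Gamma_cone CARD('n)"
proof -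
  have "\<xi> - a \<in> Gamma_cone CARD('n)"
    using assms by (simp add: Gamma_cone_iff garding_cone_positive)
  then show ?thesis by (auto simp: set_plus_def intro: bexI[of _ "\<xi> - a"])
qed

text \<open>The lemmas of this context draw on the boundedness hypothesis at a single point, with \<open>\<mu>\<close> the eigenvalues of the
candidate and \<open>c\<close> the level.\<close>

context
  fixes \<mu> :: "'n::{finite,linorder} rvec" and p :: nat and c R \<delta> :: real
  assumes p: "1 \<le> p" "p \<le> CARD('n)" and c: "0 < c"
    and subset_ball: "{\<xi> \<in> Gamma_cone p. root p (elem_sym p \<xi>) = c}
        \<inter> ({\<mu> - \<delta> *\<^sub>R 1} + Gamma_cone CARD('n)) \<subseteq> ball 0 R"
begin

text \<open>Otherwise a translate of \<open>v\<close> along the diagonal would lie on the level set in the cone and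
in the translated orthant, but outside the ball.\<close>

lemma garding_cone_if_shifts_leave_ball:
  assumes "\<And>i s. 0 \<le> s \<Longrightarrow> \<mu> $ i - \<delta> < v $ i + s"
    and "\<And>s. 0 \<le> s \<Longrightarrow> R \<le> norm (v + s *\<^sub>R 1)"
  shows "garding_cone p UNIV (($) v)"
proof (rule ccontr)
  assume "\<not> garding_cone p UNIV (($) v)"
  then obtain s where s: "0 \<le> s" "garding_cone p UNIV (\<lambda>i. v $ i + s)"
      "root p (esym p UNIV (\<lambda>i. v $ i + s)) = c"
    using garding_cone_shift_level[of UNIV p "($) v" c] p c by auto
  have shift: "($) (v + s *\<^sub>R 1) = (\<lambda>i. v $ i + s)" by (simp add: fun_eq_iff)
  have "v + s *\<^sub>R 1 \<in> {\<mu> - \<delta> *\<^sub>R 1} + Gamma_cone CARD('n)"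
    by (rule translated_orthant_memI) (use assms(1) s(1) in simp)
  moreover have "v + s *\<^sub>R 1 \<in> {\<xi> \<in> Gamma_cone p. root p (elem_sym p \<xi>) = c}"
    using s by (simp only: mem_Collect_eq Gamma_cone_iff elem_sym_eq_esym shift)
  ultimately have "v + s *\<^sub>R 1 \<in> ball 0 R" using subset_ball by blast
  then show False using assms(2)[OF s(1)] unfolding mem_ball_0 by linarith
qed

text \<open>The vector \<open>R (e\<^sub>i - e\<^sub>j)\<close> has component sum zero, so it is outside the cone, and all its translates along the diagonal
upwards have norm at least \<open>R\<close>. If all components of \<open>\<mu>\<close> were at most \<open>- R\<close>, they would lie in the translated orthant.\<close>

lemma largest_component_gt:
  assumes n: "2 \<le> CARD('n)" and mono: "mono (($) \<mu>)" and R: "0 < R" and \<delta>: "0 < \<delta>"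
  shows "- R < \<mu> $ Max UNIV"
proof (rule ccontr)
  assume neg: "\<not> - R < \<mu> $ Max UNIV"
  obtain i j :: 'n where ij: "i \<noteq> j"
    using obtain_subset_with_card_n[OF n] by (metis card_2_iff)
  define v where "v = R *\<^sub>R (axis i 1 - axis j 1 :: 'n rvec)"
  have v: "- R \<le> v $ l" for l using R by (simp add: v_def axis_def)
  have "\<mu> $ l \<le> \<mu> $ Max UNIV" for l using mono by (rule monoD) simp
  then have \<mu>: "\<mu> $ l \<le> - R" for l using neg by (meson not_less order_trans)
  have "garding_cone p UNIV (($) v)"
  proof (rule garding_cone_if_shifts_leave_ball)
    fix l and s :: real assume "0 \<le> s"
    then show "\<mu> $ l - \<delta> < v $ l + s" using \<mu>[of l] v[of l] \<delta> by linarith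
    have "R \<le> \<bar>R + s\<bar>" using \<open>0 \<le> s\<close> R by simp
    also have "R + s = (v + s *\<^sub>R 1) $ i" using ij by (simp add: v_def axis_def)
    also have "\<bar>\<dots>\<bar> \<le> norm (v + s *\<^sub>R 1)" by (rule component_le_norm_cart)
    finally show "R \<le> norm (v + s *\<^sub>R 1)" .
  qed
  then have "0 < esym 1 UNIV (($) v)" using p by (simp add: garding_cone_def)
  also have "esym 1 UNIV (($) v) = (\<Sum>l\<in>UNIV. v $ l)"
    using esym_euler[of UNIV "($) v" 0] by simp
  also have "\<dots> = 0"
    by (simp add: v_def axis_def sum_subtractf flip: sum_distrib_left)
  finally show False by simp
qed

text \<open>The constant \<open>K\<close> is large enough for the last component of the raised vector, and of each of its upward
translates, to be at least \<open>R\<close>.\<close>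

lemma garding_cone_largest_component_raised:
  assumes \<delta>: "0 < \<delta>" and T: "- T \<le> \<mu> $ Max UNIV" and K: "0 \<le> K" "R + T + \<delta> \<le> K"
  shows "garding_cone p UNIV (\<lambda>i. \<mu> $ i - \<delta> / 2 + (if i = Max UNIV then K else 0))"
proof -
  define v where "v = (\<chi> i. \<mu> $ i - \<delta> / 2 + (if i = Max UNIV then K else 0))"
  have "garding_cone p UNIV (($) v)"
  proof (rule garding_cone_if_shifts_leave_ball)
    fix i and s :: real assume "0 \<le> s"
    then show "\<mu> $ i - \<delta> < v $ i + s" using \<delta> K by (simp add: v_def)
    have "R \<le> (v + s *\<^sub>R 1) $ Max UNIV" using \<open>0 \<le> s\<close> K T \<delta> by (simp add: v_def)
    also have "\<dots> \<le> norm (v + s *\<^sub>R 1)" using component_le_norm_cart[of "v + s *\<^sub>R 1" "Max UNIV"] by simp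
    finally show "R \<le> norm (v + s *\<^sub>R 1)" .
  qed
  moreover have "($) v = (\<lambda>i. \<mu> $ i - \<delta> / 2 + (if i = Max UNIV then K else 0))"
    by (simp add: v_def fun_eq_iff)
  ultimately show ?thesis by simp
qed

end

section \<open>Calculus of twice differentiable functions\<close>

lemma frechet_derivative_cong_open:
  assumes "open S" "x \<in> S" "\<And>y. y \<in> S \<Longrightarrow> f y = g y"
  shows "frechet_derivative f (at x) = frechet_derivative g (at x)"
    and "f differentiable (at x) \<longleftrightarrow> g differentiable (at x)"
proof -
  have "(f has_derivative D) (at x) \<longleftrightarrow> (g has_derivative D) (at x)" for D
    using has_derivative_transform_within_open[OF _ assms(1,2)] assms(3) by metis
  then show "frechet_derivative f (at x) = frechet_derivative g (at x)"
    and "f differentiable (at x) \<longleftrightarrow> g differentiable (at x)"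
    by (simp_all add: frechet_derivative_def differentiable_def)
qed

lemma Ck_on_cong:
  assumes "open S" "\<And>x. x \<in> S \<Longrightarrow> f x = g x"
  shows "Ck_on k f S \<longleftrightarrow> Ck_on k g S"
  using assms(2)
proof (induction k arbitrary: f g)
  case 0
  then show ?case by (simp cong: continuous_on_cong)
next
  case (Suc k)
  have "Ck_on k (\<lambda>x. frechet_derivative f (at x) v) S \<longleftrightarrow> Ck_on k (\<lambda>x. frechet_derivative g (at x) v) S" for v
    by (rule Suc.IH) (simp add: frechet_derivative_cong_open(1)[OF assms(1) _ Suc.prems])
  then show ?case using frechet_derivative_cong_open(2)[OF assms(1) _ Suc.prems] by auto
qed

lemma Ck_on_compose_affine:
  fixes f :: "'a::euclidean_space \<Rightarrow> 'c::real_normed_vector" and l :: "'b::euclidean_space \<Rightarrow> 'a"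
  assumes "Ck_on k f S" "open T" "bounded_linear l" "\<And>x. x \<in> T \<Longrightarrow> a + l x \<in> S"
  shows "Ck_on k (\<lambda>x. f (a + l x)) T"
  using assms(1)
proof (induction k arbitrary: f)
  case 0
  then show ?case
    using assms(4)
    by (auto intro!: continuous_on_compose2[of S f T "\<lambda>x. a + l x"] continuous_on_add
        linear_continuous_on[OF assms(3)] simp: image_subset_iff)
next
  case (Suc k)
  have d: "((\<lambda>x. f (a + l x)) has_derivative (\<lambda>v. frechet_derivative f (at (a + l x)) (l v))) (at x)"
    if "x \<in> T" for x
  proof -
    have "(f has_derivative frechet_derivative f (at (a + l x))) (at (a + l x))"
      using Suc.prems assms(4)[OF that] by (simp add: frechet_derivative_works[symmetric])
    moreover have "((\<lambda>x. a + l x) has_derivative l) (at x)"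
      by (auto intro!: derivative_eq_intros bounded_linear_imp_has_derivative assms(3))
    ultimately show ?thesis by (rule has_derivative_compose[rotated])
  qed
  have "Ck_on k (\<lambda>x. frechet_derivative (\<lambda>x. f (a + l x)) (at x) v) T" for v
  proof (subst Ck_on_cong[OF assms(2)])
    show "frechet_derivative (\<lambda>x. f (a + l x)) (at x) v = frechet_derivative f (at (a + l x)) (l v)"
      if "x \<in> T" for x using frechet_derivative_at[OF d[OF that]] by metis
    show "Ck_on k (\<lambda>x. frechet_derivative f (at (a + l x)) (l v)) T"
      by (rule Suc.IH) (use Suc.prems in simp)
  qed
  then show ?case using d by (auto simp: differentiable_def)
qed

lemma Ck_on_bounded_linear:
  fixes f :: "'a::euclidean_space \<Rightarrow> 'b::real_normed_vector" and L :: "'b \<Rightarrow> 'c::real_normed_vector"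
  assumes "Ck_on k f S" "open S" "bounded_linear L"
  shows "Ck_on k (\<lambda>x. L (f x)) S"
  using assms(1)
proof (induction k arbitrary: f)
  case 0
  then show ?case using bounded_linear.continuous_on[OF assms(3)] by simp
next
  case (Suc k)
  have d: "((\<lambda>x. L (f x)) has_derivative (\<lambda>v. L (frechet_derivative f (at x) v))) (at x)"
    if "x \<in> S" for x
    using Suc.prems that
    by (intro bounded_linear.has_derivative[OF assms(3)]) (simp add: frechet_derivative_works[symmetric])
  have "Ck_on k (\<lambda>x. frechet_derivative (\<lambda>x. L (f x)) (at x) v) S" for v
  proof (subst Ck_on_cong[OF assms(2)])
    show "frechet_derivative (\<lambda>x. L (f x)) (at x) v = L (frechet_derivative f (at x) v)"
      if "x \<in> S" for x using frechet_derivative_at[OF d[OF that]] by metis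
    show "Ck_on k (\<lambda>x. L (frechet_derivative f (at x) v)) S"
      by (rule Suc.IH) (use Suc.prems in simp)
  qed
  then show ?case using d by (auto simp: differentiable_def)
qed

lemma C2_onD:
  fixes f :: "'a::euclidean_space \<Rightarrow> 'b::real_normed_vector"
  assumes "Ck_on 2 f S"
  shows "x \<in> S \<Longrightarrow> (f has_derivative frechet_derivative f (at x)) (at x)"
    and "x \<in> S \<Longrightarrow> ((\<lambda>y. frechet_derivative f (at y) v) has_derivative
      frechet_derivative (\<lambda>y. frechet_derivative f (at y) v) (at x)) (at x)"
    and "continuous_on S (\<lambda>x. frechet_derivative (\<lambda>y. frechet_derivative f (at y) v) (at x) w)"
    and "continuous_on S f" and "continuous_on S (\<lambda>y. frechet_derivative f (at y) v)"
proof -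
  have *: "\<And>x. x \<in> S \<Longrightarrow> f differentiable (at x)"
    "\<And>x v. x \<in> S \<Longrightarrow> (\<lambda>y. frechet_derivative f (at y) v) differentiable (at x)"
    "\<And>v w. continuous_on S (\<lambda>x. frechet_derivative (\<lambda>y. frechet_derivative f (at y) v) (at x) w)"
    using assms by (auto simp: numeral_2_eq_2)
  show "x \<in> S \<Longrightarrow> (f has_derivative frechet_derivative f (at x)) (at x)"
    and "x \<in> S \<Longrightarrow> ((\<lambda>y. frechet_derivative f (at y) v) has_derivative
      frechet_derivative (\<lambda>y. frechet_derivative f (at y) v) (at x)) (at x)"
    using * by (auto simp: frechet_derivative_works[symmetric])
  show "continuous_on S (\<lambda>x. frechet_derivative (\<lambda>y. frechet_derivative f (at y) v) (at x) w)"
    using * by blast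
  show "continuous_on S f" "continuous_on S (\<lambda>y. frechet_derivative f (at y) v)"
    using * by (auto intro!: continuous_at_imp_continuous_on differentiable_imp_continuous_within)
qed

lemma has_derivative_line:
  fixes f :: "'a::real_normed_vector \<Rightarrow> real"
  assumes "(f has_derivative D) (at (x + s *\<^sub>R v))"
  shows "((\<lambda>s. f (x + s *\<^sub>R v)) has_real_derivative D v) (at s)"
proof -
  interpret D: bounded_linear D using assms by (rule has_derivative_bounded_linear)
  have "((\<lambda>s. x + s *\<^sub>R v) has_derivative (\<lambda>h. h *\<^sub>R v)) (at s)"
    by (auto intro!: derivative_eq_intros)
  then have "((\<lambda>s. f (x + s *\<^sub>R v)) has_derivative (\<lambda>h. D (h *\<^sub>R v))) (at s)"
    using assms by (rule has_derivative_compose)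
  then show ?thesis
    unfolding has_field_derivative_def by (rule has_derivative_eq_rhs) (simp add: D.scaleR fun_eq_iff)
qed

lemma concave_le_tangent:
  fixes \<psi> :: "'a::euclidean_space \<Rightarrow> real"
  assumes "Ck_on 2 \<psi> UNIV" "\<And>a b. second_frechet \<psi> a b b \<le> 0"
  shows "\<psi> a1 - \<psi> a0 \<le> frechet_derivative \<psi> (at a0) (a1 - a0)"
proof -
  define b where "b = a1 - a0"
  let ?k = "\<lambda>s. frechet_derivative \<psi> (at (a0 + s *\<^sub>R b)) b"
  have h: "((\<lambda>s. \<psi> (a0 + s *\<^sub>R b)) has_real_derivative ?k s) (at s)" for s
    by (rule has_derivative_line) (rule C2_onD(1)[OF assms(1) UNIV_I])
  have k: "(?k has_real_derivative second_frechet \<psi> (a0 + s *\<^sub>R b) b b) (at s)" for s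
    unfolding second_frechet_def
    by (rule has_derivative_line) (rule C2_onD(2)[OF assms(1) UNIV_I])
  obtain z where z: "0 < z" "z < 1" "\<psi> (a0 + 1 *\<^sub>R b) - \<psi> (a0 + 0 *\<^sub>R b) = (1 - 0) * ?k z"
    using MVT2[of 0 1 "\<lambda>s. \<psi> (a0 + s *\<^sub>R b)" ?k] h by auto
  have "?k z \<le> ?k 0"
    by (rule DERIV_nonpos_imp_nonincreasing) (use z k assms(2) in \<open>auto\<close>)
  then show ?thesis using z(3) by (simp add: b_def)
qed

text \<open>The mean value theorem, first in the direction \<open>a\<close> and then in the direction \<open>b\<close>.\<close>

lemma second_difference_quotient:
  fixes f :: "'a::euclidean_space \<Rightarrow> real"
  assumes f: "Ck_on 2 f S" and h: "0 < h"
    and seg: "\<And>s t. 0 \<le> s \<Longrightarrow> s \<le> h \<Longrightarrow> 0 \<le> t \<Longrightarrow> t \<le> h \<Longrightarrow> x + s *\<^sub>R a + t *\<^sub>R b \<in> S"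
  obtains s t where "0 \<le> s" "s \<le> h" "0 \<le> t" "t \<le> h"
    "f (x + h *\<^sub>R a + h *\<^sub>R b) - f (x + h *\<^sub>R a) - f (x + h *\<^sub>R b) + f x =
      h * h * second_frechet f (x + s *\<^sub>R a + t *\<^sub>R b) a b"
proof -
  let ?D = "\<lambda>y. frechet_derivative f (at y) a"
  have 1: "((\<lambda>s. f (x + h *\<^sub>R b + s *\<^sub>R a) - f (x + s *\<^sub>R a)) has_real_derivative
      ?D (x + h *\<^sub>R b + s *\<^sub>R a) - ?D (x + s *\<^sub>R a)) (at s)" if "0 \<le> s" "s \<le> h" for s
    using seg[of s h] seg[of s 0] that h
    by (intro DERIV_diff has_derivative_line C2_onD(1)[OF f]) (simp_all add: add_ac)
  obtain s where s: "0 < s" "s < h"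
    "(f (x + h *\<^sub>R b + h *\<^sub>R a) - f (x + h *\<^sub>R a)) - (f (x + h *\<^sub>R b + 0 *\<^sub>R a) - f (x + 0 *\<^sub>R a)) =
     (h - 0) * (?D (x + h *\<^sub>R b + s *\<^sub>R a) - ?D (x + s *\<^sub>R a))"
    using MVT2[OF h 1] by auto
  have 2: "((\<lambda>t. ?D (x + s *\<^sub>R a + t *\<^sub>R b)) has_real_derivative
      second_frechet f (x + s *\<^sub>R a + t *\<^sub>R b) a b) (at t)" if "0 \<le> t" "t \<le> h" for t
    unfolding second_frechet_def
    by (rule has_derivative_line, rule C2_onD(2)[OF f]) (use seg[of s t] that s in auto)
  obtain t where t: "0 < t" "t < h"
    "?D (x + s *\<^sub>R a + h *\<^sub>R b) - ?D (x + s *\<^sub>R a + 0 *\<^sub>R b) =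
     (h - 0) * second_frechet f (x + s *\<^sub>R a + t *\<^sub>R b) a b"
    using MVT2[OF h 2] by auto
  show ?thesis
    by (rule that[of s t]) (use s t in \<open>auto simp: add_ac\<close>)
qed

text \<open>The second difference is symmetric in the two directions, and by continuity both second derivatives
are limits of its quotient by \<open>h\<^sup>2\<close>.\<close>

lemma second_frechet_sym:
  fixes f :: "'a::euclidean_space \<Rightarrow> real"
  assumes f: "Ck_on 2 f S" and S: "open S" "x \<in> S"
  shows "second_frechet f x a b = second_frechet f x b a"
proof (rule ccontr)
  assume ne: "second_frechet f x a b \<noteq> second_frechet f x b a"
  define e where "e = \<bar>second_frechet f x a b - second_frechet f x b a\<bar> / 2"
  have e: "0 < e" using ne by (simp add: e_def)
  have cont: "isCont (\<lambda>y. second_frechet f y v w) x" for v w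
    using C2_onD(3)[OF f] S by (simp add: second_frechet_def continuous_on_eq_continuous_at)
  obtain d1 where d1: "0 < d1" "\<And>y. dist y x < d1 \<Longrightarrow> \<bar>second_frechet f y a b - second_frechet f x a b\<bar> < e"
    using cont[of a b] e unfolding continuous_at_eps_delta dist_real_def by blast
  obtain d2 where d2: "0 < d2" "\<And>y. dist y x < d2 \<Longrightarrow> \<bar>second_frechet f y b a - second_frechet f x b a\<bar> < e"
    using cont[of b a] e unfolding continuous_at_eps_delta dist_real_def by blast
  obtain d3 where d3: "0 < d3" "ball x d3 \<subseteq> S" using S openE by blast
  define d where "d = min d1 (min d2 d3)"
  \<comment> \<open>So small that the parallelogram spanned by \<open>h a\<close> and \<open>h b\<close> at \<open>x\<close> stays in the ball of radius \<open>d\<close>; the summand 1 covers zero vectors.\<close>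
  define h where "h = d / (2 * (norm a + norm b + 1))"
  have pos: "0 < norm a + norm b + 1" by (simp add: add_nonneg_pos)
  have d: "0 < d" using d1 d2 d3 by (simp add: d_def)
  have h: "0 < h" using d pos by (simp add: h_def)
  have hd: "h * (norm a + norm b + 1) = d / 2" using pos by (simp add: h_def field_simps)
  have near: "dist (x + s *\<^sub>R a + t *\<^sub>R b) x < d" if "0 \<le> s" "s \<le> h" "0 \<le> t" "t \<le> h" for s t
  proof -
    have "dist (x + s *\<^sub>R a + t *\<^sub>R b) x \<le> norm (s *\<^sub>R a) + norm (t *\<^sub>R b)"
      using norm_triangle_ineq[of "s *\<^sub>R a" "t *\<^sub>R b"] by (simp only: dist_norm add.assoc add_diff_cancel_left')
    also have "\<dots> \<le> h * norm a + h * norm b"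
      using that by (auto intro!: add_mono mult_right_mono)
    also have "\<dots> \<le> h * (norm a + norm b + 1)" using h by (simp add: algebra_simps)
    also have "\<dots> < d" using d by (simp add: hd)
    finally show ?thesis .
  qed
  have inS: "x + s *\<^sub>R a + t *\<^sub>R b \<in> S" if "0 \<le> s" "s \<le> h" "0 \<le> t" "t \<le> h" for s t
    using near[OF that] d3 by (auto simp: d_def dist_commute)
  obtain s t where 1: "0 \<le> s" "s \<le> h" "0 \<le> t" "t \<le> h"
    "f (x + h *\<^sub>R a + h *\<^sub>R b) - f (x + h *\<^sub>R a) - f (x + h *\<^sub>R b) + f x =
      h * h * second_frechet f (x + s *\<^sub>R a + t *\<^sub>R b) a b"
    using second_difference_quotient[OF f h inS] by blast
  have inS': "x + s *\<^sub>R b + t *\<^sub>R a \<in> S" if "0 \<le> s" "s \<le> h" "0 \<le> t" "t \<le> h" for s t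
    using inS[of t s] that by (simp add: add_ac)
  obtain s' t' where 2: "0 \<le> s'" "s' \<le> h" "0 \<le> t'" "t' \<le> h"
    "f (x + h *\<^sub>R b + h *\<^sub>R a) - f (x + h *\<^sub>R b) - f (x + h *\<^sub>R a) + f x =
      h * h * second_frechet f (x + s' *\<^sub>R b + t' *\<^sub>R a) b a"
    using second_difference_quotient[OF f h inS'] by blast
  have "f (x + h *\<^sub>R b + h *\<^sub>R a) = f (x + h *\<^sub>R a + h *\<^sub>R b)" by (simp add: add_ac)
  then have "h * h * second_frechet f (x + s *\<^sub>R a + t *\<^sub>R b) a b
      = h * h * second_frechet f (x + s' *\<^sub>R b + t' *\<^sub>R a) b a"
    using 1(5) 2(5) by linarith
  then have "second_frechet f (x + s *\<^sub>R a + t *\<^sub>R b) a b = second_frechet f (x + s' *\<^sub>R b + t' *\<^sub>R a) b a"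
    using h by simp
  moreover have "dist (x + s *\<^sub>R a + t *\<^sub>R b) x < d1" using near[OF 1(1-4)] by (simp add: d_def)
  moreover have "dist (x + s' *\<^sub>R b + t' *\<^sub>R a) x < d2"
    using near[OF 2(3,4,1,2)] by (simp add: d_def add_ac)
  ultimately have "\<bar>second_frechet f x a b - second_frechet f x b a\<bar> < 2 * e"
    using d1(2)[of "x + s *\<^sub>R a + t *\<^sub>R b"] d2(2)[of "x + s' *\<^sub>R b + t' *\<^sub>R a"] by linarith
  then show False by (simp add: e_def)
qed

lemma quadratic_form_bounds:
  fixes G :: "'a::t2_space \<Rightarrow> real ^ 'n ^ 'n"
  assumes K: "compact K" "K \<noteq> {}" and G: "continuous_on K G"
    and pd: "\<And>y v. y \<in> K \<Longrightarrow> v \<noteq> 0 \<Longrightarrow> 0 < v \<bullet> (G y *v v)"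
  obtains m L where "0 < m" "0 < L"
    "\<And>y v. y \<in> K \<Longrightarrow> m * (v \<bullet> v) \<le> v \<bullet> (G y *v v)"
    "\<And>y v. y \<in> K \<Longrightarrow> v \<bullet> (G y *v v) \<le> L * (v \<bullet> v)"
proof -
  let ?S = "sphere (0 :: real ^ 'n) 1" and ?q = "\<lambda>(y, v). v \<bullet> (G y *v v)"
  have nonempty: "K \<times> ?S \<noteq> {}" using K(2) by simp
  have comp: "compact (K \<times> ?S)" using K(1) by (simp add: compact_Times)
  have cont: "continuous_on (K \<times> ?S) ?q"
    unfolding case_prod_unfold inner_vec_def matrix_vector_mult_def
    by (auto intro!: continuous_intros continuous_on_compose2[OF G])
  obtain y0 v0 where lo: "y0 \<in> K" "v0 \<in> ?S" "\<And>y v. y \<in> K \<Longrightarrow> v \<in> ?S \<Longrightarrow> ?q (y0, v0) \<le> ?q (y, v)"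
    using continuous_attains_inf[OF comp nonempty cont] by blast
  obtain y1 v1 where hi: "y1 \<in> K" "v1 \<in> ?S" "\<And>y v. y \<in> K \<Longrightarrow> v \<in> ?S \<Longrightarrow> ?q (y, v) \<le> ?q (y1, v1)"
    using continuous_attains_sup[OF comp nonempty cont] by blast
  have scale: "v \<bullet> (G y *v v) = (norm v)\<^sup>2 * ?q (y, v /\<^sub>R norm v)" "v /\<^sub>R norm v \<in> ?S" if "v \<noteq> 0" for y v
    using that by (simp_all add: matrix_vector_mult_scaleR power2_eq_square field_simps)
  show ?thesis
  proof (rule that[of "?q (y0, v0)" "?q (y1, v1)"])
    have "v0 \<noteq> 0" "v1 \<noteq> 0" using lo(2) hi(2) by auto
    then show "0 < ?q (y0, v0)" "0 < ?q (y1, v1)" using pd lo(1) hi(1) by auto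
    fix y and v :: "real ^ 'n" assume y: "y \<in> K"
    show "?q (y0, v0) * (v \<bullet> v) \<le> v \<bullet> (G y *v v)"
    proof (cases "v = 0")
      case False
      have "(norm v)\<^sup>2 * ?q (y0, v0) \<le> (norm v)\<^sup>2 * ?q (y, v /\<^sub>R norm v)"
        using lo(3)[OF y scale(2)[OF False]] by (intro mult_left_mono) auto
      then show ?thesis using scale(1)[OF False, of y] by (simp only: dot_square_norm mult.commute)
    qed simp
    show "v \<bullet> (G y *v v) \<le> ?q (y1, v1) * (v \<bullet> v)"
    proof (cases "v = 0")
      case False
      have "(norm v)\<^sup>2 * ?q (y, v /\<^sub>R norm v) \<le> (norm v)\<^sup>2 * ?q (y1, v1)"
        using hi(3)[OF y scale(2)[OF False]] by (intro mult_left_mono) auto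
      then show ?thesis using scale(1)[OF False, of y] by (simp only: dot_square_norm mult.commute)
    qed simp
  qed
qed

text \<open>This turns bounds in one chart near each point into bounds on the manifold.\<close>

lemma compact_uniform_bound:
  fixes Q :: "'m::topological_space \<Rightarrow> real \<Rightarrow> bool"
  assumes "compact (UNIV :: 'm set)"
    and mono: "\<And>z M M'. Q z M \<Longrightarrow> M \<le> M' \<Longrightarrow> Q z M'"
    and loc: "\<And>x. \<exists>U M. open U \<and> x \<in> U \<and> (\<forall>z\<in>U. Q z M)"
  obtains M where "\<And>z. Q z M"
proof -
  obtain U M where UM: "\<And>x. open (U x)" "\<And>x. x \<in> U x" "\<And>x z. z \<in> U x \<Longrightarrow> Q z (M x)"
    using loc by metis
  have "UNIV \<subseteq> (\<Union>x\<in>UNIV. U x)" using UM(2) by blast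
  from compactE_image[OF assms(1) UM(1) this] obtain X where X: "finite X" "UNIV \<subseteq> (\<Union>x\<in>X. U x)"
    by metis
  have "Q z (Max (insert 0 (M ` X)))" for z
  proof -
    obtain x where x: "x \<in> X" "z \<in> U x" using X(2) by blast
    then have "M x \<le> Max (insert 0 (M ` X))" using X by (intro Max_ge) auto
    then show ?thesis using mono UM(3)[OF x(2)] by blast
  qed
  then show ?thesis using that by blast
qed

lemma frechet_derivative_eq_sum_partial:
  fixes f :: "'n::finite rvec \<Rightarrow> real"
  assumes "f differentiable (at y)"
  shows "frechet_derivative f (at y) v = (\<Sum>i\<in>UNIV. v $ i * partial i f y)"
proof -
  interpret linear "frechet_derivative f (at y)" by (rule linear_frechet_derivative[OF assms])
  have "frechet_derivative f (at y) v = frechet_derivative f (at y) (\<Sum>i\<in>UNIV. v $ i *s axis i 1)"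
    by (simp add: basis_expansion)
  also have "\<dots> = (\<Sum>i\<in>UNIV. v $ i * partial i f y)"
    by (simp add: sum scale partial_def scalar_mult_eq_scaleR)
  finally show ?thesis .
qed

lemma partial_cong_open:
  "open S \<Longrightarrow> y \<in> S \<Longrightarrow> (\<And>z. z \<in> S \<Longrightarrow> f z = h z) \<Longrightarrow> partial i f y = partial i h y"
  by (simp add: partial_def frechet_derivative_cong_open(1)[of S y f h])

lemma partial_diff:
  assumes "f differentiable (at y)" "h differentiable (at y)"
  shows "partial i (\<lambda>z. f z - h z) y = partial i f y - partial i h y"
proof -
  have "((\<lambda>z. f z - h z) has_derivative
      (\<lambda>v. frechet_derivative f (at y) v - frechet_derivative h (at y) v)) (at y)"
    using assms by (intro has_derivative_diff) (simp_all add: frechet_derivative_works[symmetric])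
  from fun_cong[OF frechet_derivative_at[OF this], of "axis i 1"] show ?thesis by (simp add: partial_def)
qed

lemma C2_on_partial:
  fixes f :: "'n::finite rvec \<Rightarrow> real"
  assumes "Ck_on 2 f S" "y \<in> S"
  shows "f differentiable (at y)" "partial i f differentiable (at y)"
    and "partial j (partial k f) y = second_frechet f y (axis k 1) (axis j 1)"
proof -
  show "f differentiable (at y)" using C2_onD(1)[OF assms] by (auto simp: differentiable_def)
  have eq: "partial k f = (\<lambda>z. frechet_derivative f (at z) (axis k 1))" for k
    by (simp add: partial_def fun_eq_iff)
  show "partial i f differentiable (at y)"
    unfolding eq using C2_onD(2)[OF assms] by (auto simp: differentiable_def)
  show "partial j (partial k f) y = second_frechet f y (axis k 1) (axis j 1)"
    unfolding eq by (simp add: partial_def second_frechet_def)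
qed

lemma C2_on_partial_continuous:
  fixes f :: "'n::finite rvec \<Rightarrow> real"
  assumes "Ck_on 2 f S"
  shows "continuous_on S (partial i f)" "continuous_on S (partial j (partial k f))"
proof -
  have eq: "partial k f = (\<lambda>z. frechet_derivative f (at z) (axis k 1))" for k
    by (simp add: partial_def fun_eq_iff)
  show "continuous_on S (partial i f)" unfolding eq by (rule C2_onD(5)[OF assms])
  have "partial j (partial k f) =
      (\<lambda>x. frechet_derivative (\<lambda>y. frechet_derivative f (at y) (axis k 1)) (at x) (axis j 1))"
    unfolding eq by (simp add: partial_def fun_eq_iff)
  then show "continuous_on S (partial j (partial k f))" by (simp add: C2_onD(3)[OF assms])
qed

lemma positive_definite_inverse:
  fixes G :: "real ^ 'n ^ 'n"
  assumes "\<And>v. v \<noteq> 0 \<Longrightarrow> 0 < v \<bullet> (G *v v)"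
  shows "matrix_inv G ** G = mat 1" "G ** matrix_inv G = mat 1"
proof -
  have "\<forall>v. G *v v = 0 \<longrightarrow> v = 0" using assms by force
  then obtain B where B: "B ** G = mat 1" using matrix_left_invertible_ker by blast
  then have B': "G ** B = mat 1" by (simp add: matrix_left_right_inverse)
  then have "matrix_inv G = B" by (rule matrix_inv_eqI)
  then show "matrix_inv G ** G = mat 1" "G ** matrix_inv G = mat 1" using B B' by auto
qed

text \<open>With \<open>b\<close> the image of \<open>a\<close> under the inverse of \<open>G\<close>, expand the nonnegative form \<open>G\<close> at \<open>b - a / L\<close> for the first
bound and the Euclidean square of \<open>a - m b\<close> for the second.\<close>

lemma inverse_form_bounds:
  fixes G :: "real ^ 'n ^ 'n"
  assumes G: "transpose G = G" "\<And>v. v \<noteq> 0 \<Longrightarrow> 0 < v \<bullet> (G *v v)"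
    and m: "0 < m" "\<And>v. m * (v \<bullet> v) \<le> v \<bullet> (G *v v)"
    and L: "0 < L" "\<And>v. v \<bullet> (G *v v) \<le> L * (v \<bullet> v)"
  shows "a \<bullet> a \<le> L * (a \<bullet> (matrix_inv G *v a))" "m * (a \<bullet> (matrix_inv G *v a)) \<le> a \<bullet> a"
proof -
  define b where "b = matrix_inv G *v a"
  have Gb: "G *v b = a"
    using positive_definite_inverse(2)[OF G(2)] by (simp add: b_def matrix_vector_mul_assoc)
  have nonneg: "0 \<le> v \<bullet> (G *v v)" for v using G(2)[of v] by (cases "v = 0") (auto intro: less_imp_le)
  have sym: "b \<bullet> (G *v a) = a \<bullet> a" using Gb by (simp add: inner_matrix_vector_mult G(1))
  define s where "s = 1 / L"
  have "0 \<le> (b - s *\<^sub>R a) \<bullet> (G *v (b - s *\<^sub>R a))" by (rule nonneg)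
  also have "\<dots> = a \<bullet> b - 2 * s * (a \<bullet> a) + s * s * (a \<bullet> (G *v a))"
    by (simp add: matrix_vector_mult_diff_distrib matrix_vector_mult_scaleR Gb inner_diff_left
        inner_diff_right sym inner_commute[of b a] algebra_simps)
  also have "\<dots> \<le> a \<bullet> b - 2 * s * (a \<bullet> a) + s * s * (L * (a \<bullet> a))"
    using L(2)[of a] by (intro add_left_mono mult_left_mono) auto
  also have "\<dots> = a \<bullet> b - (a \<bullet> a) / L" using L(1) by (simp add: s_def field_simps)
  finally show "a \<bullet> a \<le> L * (a \<bullet> (matrix_inv G *v a))"
    using L(1) by (simp add: b_def field_simps)
  have "m * (a \<bullet> b) \<le> a \<bullet> a"
  proof -
    have "0 \<le> (a - m *\<^sub>R b) \<bullet> (a - m *\<^sub>R b)" by (rule inner_ge_zero)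
    also have "\<dots> = a \<bullet> a - 2 * (m * (a \<bullet> b)) + m * (m * (b \<bullet> b))"
      by (simp add: inner_diff_left inner_diff_right inner_commute[of b a] algebra_simps)
    also have "m * (m * (b \<bullet> b)) \<le> m * (b \<bullet> (G *v b))" using m by (intro mult_left_mono) auto
    also have "b \<bullet> (G *v b) = a \<bullet> b" by (simp add: Gb inner_commute)
    finally show ?thesis by (simp add: algebra_simps)
  qed
  then show "m * (a \<bullet> (matrix_inv G *v a)) \<le> a \<bullet> a" by (simp add: b_def)
qed

lemma covector_norm_alt:
  "covector_norm g c x a = sqrt (a \<bullet> (matrix_inv (g c x) *v a))"
proof -
  have "a \<bullet> (matrix_inv (g c x) *v a) =
      (\<Sum>j\<in>UNIV. \<Sum>k\<in>UNIV. a $ j * (matrix_inv (g c x) $ j $ k * a $ k))"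
    by (simp add: inner_vec_def matrix_vector_mult_def sum_distrib_left)
  then show ?thesis unfolding covector_norm_def by (simp only: ac_simps)
qed

lemma partial_mult:
  assumes "f differentiable (at y)" "h differentiable (at y)"
  shows "partial i (\<lambda>z. f z * h z) y = f y * partial i h y + partial i f y * h y"
proof -
  have "((\<lambda>z. f z * h z) has_derivative
      (\<lambda>v. f y * frechet_derivative h (at y) v + frechet_derivative f (at y) v * h y)) (at y)"
    using assms by (intro has_derivative_mult) (simp_all add: frechet_derivative_works[symmetric])
  from fun_cong[OF frechet_derivative_at[OF this], of "axis i 1"] show ?thesis by (simp add: partial_def)
qed

lemma partial_compose:
  fixes h :: "'n::finite rvec \<Rightarrow> real" and \<tau> :: "'k::finite rvec \<Rightarrow> 'n rvec"
  assumes \<tau>: "\<tau> differentiable (at y)" and h: "h differentiable (at (\<tau> y))"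
  shows "partial j (\<lambda>z. h (\<tau> z)) y = (\<Sum>i\<in>UNIV. partial j (\<lambda>z. \<tau> z $ i) y * partial i h (\<tau> y))"
    and "(\<lambda>z. h (\<tau> z)) differentiable (at y)"
proof -
  have d: "(\<tau> has_derivative frechet_derivative \<tau> (at y)) (at y)"
    using \<tau> by (simp add: frechet_derivative_works[symmetric])
  have hd: "((\<lambda>z. h (\<tau> z)) has_derivative
      (\<lambda>v. frechet_derivative h (at (\<tau> y)) (frechet_derivative \<tau> (at y) v))) (at y)"
    by (rule has_derivative_compose[OF d]) (use h in \<open>simp add: frechet_derivative_works[symmetric]\<close>)
  then show "(\<lambda>z. h (\<tau> z)) differentiable (at y)" by (auto simp: differentiable_def)
  have c: "frechet_derivative \<tau> (at y) (axis j 1) $ i = partial j (\<lambda>z. \<tau> z $ i) y" for i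
    using fun_cong[OF frechet_derivative_at[OF bounded_linear.has_derivative[OF bounded_linear_vec_nth d]], of "axis j 1"]
    by (simp add: partial_def)
  show "partial j (\<lambda>z. h (\<tau> z)) y = (\<Sum>i\<in>UNIV. partial j (\<lambda>z. \<tau> z $ i) y * partial i h (\<tau> y))"
    using fun_cong[OF frechet_derivative_at[OF hd], of "axis j 1"]
    by (simp add: partial_def[of j "\<lambda>z. h (\<tau> z)"] frechet_derivative_eq_sum_partial[OF h] c)
qed

section \<open>Geometry in charts\<close>

locale riemannian_atlas =
  fixes Atl :: "('m::topological_space, 'n::finite) chart set" and g :: "('m, 'n) metric"
  assumes atlas: "smooth_atlas Atl" and metric: "riemannian_metric Atl g"
begin

lemma chart_open: "c \<in> Atl \<Longrightarrow> open (fst c)" "c \<in> Atl \<Longrightarrow> open (snd c ` fst c)"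
  and chart_homeomorphism: "c \<in> Atl \<Longrightarrow> homeomorphism (fst c) (snd c ` fst c) (snd c) (chart_inv c)"
  using atlas[unfolded smooth_atlas_def, THEN conjunct2, THEN conjunct1, rule_format] by simp_all

lemma chart_cover: "\<exists>c\<in>Atl. x \<in> fst c"
  using atlas[unfolded smooth_atlas_def, THEN conjunct1] by blast

lemma chart_inv_simps:
  assumes "c \<in> Atl"
  shows "x \<in> fst c \<Longrightarrow> chart_inv c (snd c x) = x"
    and "y \<in> snd c ` fst c \<Longrightarrow> chart_inv c y \<in> fst c"
    and "y \<in> snd c ` fst c \<Longrightarrow> snd c (chart_inv c y) = y"
proof -
  note h = chart_homeomorphism[OF assms]
  show "x \<in> fst c \<Longrightarrow> chart_inv c (snd c x) = x" by (rule homeomorphism_apply1[OF h])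
  show "y \<in> snd c ` fst c \<Longrightarrow> snd c (chart_inv c y) = y" by (rule homeomorphism_apply2[OF h])
  show "y \<in> snd c ` fst c \<Longrightarrow> chart_inv c y \<in> fst c" using homeomorphism_image2[OF h] by blast
qed

lemma open_overlap:
  assumes "c \<in> Atl" "c' \<in> Atl"
  shows "open (snd c ` (fst c \<inter> fst c'))"
proof -
  have h: "homeomorphism (fst c) (snd c ` fst c) (snd c) (chart_inv c)"
    by (rule chart_homeomorphism[OF assms(1)])
  have "openin (top_of_set (fst c)) (fst c \<inter> fst c')"
    by (rule openin_open_Int[OF chart_open(1)[OF assms(2)]])
  from homeomorphism_imp_open_map[OF h this] show ?thesis
    using chart_open(2)[OF assms(1)] openin_open_trans by blast
qed

lemma transition_facts:
  assumes "c \<in> Atl" "c' \<in> Atl"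
  shows "Ck_on 2 (transition c c') (snd c ` (fst c \<inter> fst c'))"
    and "x \<in> fst c \<Longrightarrow> transition c c' (snd c x) = snd c' x"
    and "y \<in> snd c ` (fst c \<inter> fst c') \<Longrightarrow> transition c c' y \<in> snd c' ` fst c'"
    and "y \<in> snd c ` (fst c \<inter> fst c') \<Longrightarrow> chart_inv c' (transition c c' y) = chart_inv c y"
proof -
  have "smooth_on (transition c c') (snd c ` (fst c \<inter> fst c'))"
    using assms atlas unfolding smooth_atlas_def by blast
  then show "Ck_on 2 (transition c c') (snd c ` (fst c \<inter> fst c'))"
    unfolding smooth_on_def by blast
  show 1: "transition c c' (snd c x) = snd c' x" if "x \<in> fst c" for x
    using chart_inv_simps(1)[OF assms(1) that] by (simp add: transition_def)
  assume "y \<in> snd c ` (fst c \<inter> fst c')"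
  then obtain z where z: "z \<in> fst c" "z \<in> fst c'" "y = snd c z" by blast
  show "transition c c' y \<in> snd c' ` fst c'" using z 1 by simp
  show "chart_inv c' (transition c c' y) = chart_inv c y"
    using z 1 chart_inv_simps(1)[OF assms(1)] chart_inv_simps(1)[OF assms(2)] by simp
qed

lemma transition_has_derivative:
  assumes "c \<in> Atl" "c' \<in> Atl" "x \<in> fst c \<inter> fst c'"
  shows "(transition c c' has_derivative (*v) (chart_jac c c' x)) (at (snd c x))"
  using C2_onD(1)[OF transition_facts(1)[OF assms(1,2)] imageI[OF assms(3)]]
  unfolding chart_jac_def jacobian_works[symmetric] differentiable_def by blast

lemma differential_transform:
  assumes "c \<in> Atl" "c' \<in> Atl" "x \<in> fst c \<inter> fst c'" "C2_fun Atl u"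
  shows "differential c u x = transpose (chart_jac c c' x) *v differential c' u x"
proof -
  let ?J = "chart_jac c c' x" and ?f = "u \<circ> chart_inv c'"
  have f: "?f differentiable (at (snd c' x))"
    using assms C2_on_partial(1)[of ?f "snd c' ` fst c'"] by (auto simp: C2_fun_def)
  have "partial j (u \<circ> chart_inv c) (snd c x) = (\<Sum>i\<in>UNIV. ?J $ i $ j * partial i ?f (snd c' x))" for j
  proof -
    have "partial j (u \<circ> chart_inv c) (snd c x) = partial j (\<lambda>y. ?f (transition c c' y)) (snd c x)"
      by (rule partial_cong_open[OF open_overlap[OF assms(1,2)]])
        (use assms(3) transition_facts(4)[OF assms(1,2)] in auto)
    also have "\<dots> = frechet_derivative ?f (at (snd c' x)) (?J *v axis j 1)"
    proof -
      have "((\<lambda>y. ?f (transition c c' y)) has_derivative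
          (\<lambda>v. frechet_derivative ?f (at (snd c' x)) (?J *v v))) (at (snd c x))"
        by (rule has_derivative_compose[OF transition_has_derivative[OF assms(1-3)]])
          (use f assms(3) in \<open>simp only: transition_facts(2)[OF assms(1,2)] Int_iff
            frechet_derivative_works\<close>)
      from fun_cong[OF frechet_derivative_at[OF this], of "axis j 1"] show ?thesis by (simp add: partial_def)
    qed
    also have "\<dots> = (\<Sum>i\<in>UNIV. ?J $ i $ j * partial i ?f (snd c' x))"
      using frechet_derivative_eq_sum_partial[OF f] by (simp add: matrix_vector_mult_basis column_def)
    finally show ?thesis .
  qed
  then show ?thesis
    by (simp add: differential_def vec_eq_iff matrix_vector_mult_def transpose_def)
qed

lemma metric_at:
  assumes "c \<in> Atl" "x \<in> fst c"
  shows "transpose (g c x) = g c x" "v \<noteq> 0 \<Longrightarrow> 0 < v \<bullet> (g c x *v v)"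
  using metric[unfolded riemannian_metric_def, THEN conjunct2, THEN conjunct1, rule_format, OF assms]
  by simp_all

lemma metric_transform:
  assumes "c \<in> Atl" "c' \<in> Atl" "x \<in> fst c \<inter> fst c'"
  shows "g c x = transpose (chart_jac c c' x) ** g c' x ** chart_jac c c' x"
  by (rule metric[unfolded riemannian_metric_def, THEN conjunct2, THEN conjunct2, rule_format, OF assms])

text \<open>The metric in \<open>c\<close> is the pullback of the one in \<open>c'\<close> under the Jacobian and is nondegenerate, so
the Jacobian is injective.\<close>

lemma chart_jac_inverse:
  assumes "c \<in> Atl" "c' \<in> Atl" "x \<in> fst c \<inter> fst c'"
  obtains K where "K ** chart_jac c c' x = mat 1" "chart_jac c c' x ** K = mat 1"
proof -
  have "v = 0" if "chart_jac c c' x *v v = 0" for v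
  proof (rule ccontr)
    assume "v \<noteq> 0"
    then have "0 < v \<bullet> (g c x *v v)" using metric_at assms by blast
    then show False
      unfolding metric_transform[OF assms] using that by (simp flip: matrix_vector_mul_assoc)
  qed
  then obtain K where "K ** chart_jac c c' x = mat 1" using matrix_left_invertible_ker by blast
  then show ?thesis using that matrix_left_right_inverse by blast
qed

text \<open>If \<open>b\<close> is the vector dual to \<open>a\<close> in \<open>c'\<close>, the vector dual to the transformed covector in \<open>c\<close> is the image of \<open>b\<close>
under the inverse Jacobian, and the pairing of covectors with vectors is invariant.\<close>

lemma covector_norm_transform:
  assumes "c \<in> Atl" "c' \<in> Atl" "x \<in> fst c \<inter> fst c'"
  shows "covector_norm g c x (transpose (chart_jac c c' x) *v a) = covector_norm g c' x a"
proof -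
  let ?J = "chart_jac c c' x"
  obtain K where K: "K ** ?J = mat 1" "?J ** K = mat 1" using chart_jac_inverse[OF assms] by blast
  define b' where "b' = matrix_inv (g c' x) *v a"
  have inv: "matrix_inv (g c x) ** g c x = mat 1" "g c' x ** matrix_inv (g c' x) = mat 1"
    using positive_definite_inverse metric_at assms by blast+
  have "g c x *v (K *v b') = transpose ?J *v (g c' x *v ((?J ** K) *v b'))"
    unfolding metric_transform[OF assms] by (simp add: matrix_vector_mul_assoc matrix_mul_assoc)
  also have "\<dots> = transpose ?J *v a"
    using inv(2) by (simp add: K b'_def matrix_vector_mul_assoc)
  finally have "matrix_inv (g c x) *v (transpose ?J *v a) = (matrix_inv (g c x) ** g c x) *v (K *v b')"
    by (simp flip: matrix_vector_mul_assoc)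
  then have "matrix_inv (g c x) *v (transpose ?J *v a) = K *v b'" by (simp add: inv)
  moreover have "(transpose ?J *v a) \<bullet> (K *v b') = a \<bullet> b'"
    using inner_matrix_vector_mult[of a ?J "K *v b'"] K(2) by (simp add: matrix_vector_mul_assoc)
  ultimately show ?thesis by (simp add: covector_norm_alt b'_def)
qed

lemma compact_chart_neighbourhood:
  assumes "c \<in> Atl" "x \<in> fst c"
  obtains U K where "open U" "x \<in> U" "U \<subseteq> fst c" "compact K" "snd c ` U \<subseteq> K" "K \<subseteq> snd c ` fst c"
proof -
  obtain r where r: "0 < r" "cball (snd c x) r \<subseteq> snd c ` fst c"
    using chart_open(2)[OF assms(1)] assms(2) open_contains_cball by blast
  have "continuous_on (fst c) (snd c)"
    using homeomorphism_cont1[OF chart_homeomorphism[OF assms(1)]] .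
  then have "open (fst c \<inter> snd c -` ball (snd c x) r)"
    using chart_open(1)[OF assms(1)] by (rule continuous_open_preimage) simp
  then show ?thesis
    using r assms by (intro that[of "fst c \<inter> snd c -` ball (snd c x) r" "cball (snd c x) r"]) auto
qed

lemma metric_local_bounds:
  assumes "c \<in> Atl" "compact K" "K \<subseteq> snd c ` fst c" "K \<noteq> {}"
  obtains m L where "0 < m" "0 < L"
    "\<And>z a. z \<in> fst c \<Longrightarrow> snd c z \<in> K \<Longrightarrow> (norm a)\<^sup>2 \<le> L * (covector_norm g c z a)\<^sup>2"
    "\<And>z a. z \<in> fst c \<Longrightarrow> snd c z \<in> K \<Longrightarrow> m * (covector_norm g c z a)\<^sup>2 \<le> (norm a)\<^sup>2"
proof -
  have "Ck_on 0 (\<lambda>y. g c (chart_inv c y)) (snd c ` fst c)"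
    using assms metric unfolding riemannian_metric_def smooth_on_def by blast
  then have "continuous_on K (\<lambda>y. g c (chart_inv c y))"
    using assms(3) continuous_on_subset by auto
  moreover have "0 < v \<bullet> (g c (chart_inv c y) *v v)" if "y \<in> K" "v \<noteq> 0" for y v
    using that assms by (intro metric_at chart_inv_simps) auto
  ultimately obtain m L where mL: "0 < m" "0 < L"
      "\<And>y v. y \<in> K \<Longrightarrow> m * (v \<bullet> v) \<le> v \<bullet> (g c (chart_inv c y) *v v)"
      "\<And>y v. y \<in> K \<Longrightarrow> v \<bullet> (g c (chart_inv c y) *v v) \<le> L * (v \<bullet> v)"
    using quadratic_form_bounds[OF assms(2,4)] by metis
  have *: "(norm a)\<^sup>2 \<le> L * (a \<bullet> (matrix_inv (g c z) *v a)) \<and> m * (a \<bullet> (matrix_inv (g c z) *v a)) \<le> (norm a)\<^sup>2"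
    if z: "z \<in> fst c" "snd c z \<in> K" for z a
    using inverse_form_bounds[of "g c z" m L a] metric_at[OF assms(1) z(1)] mL(1,2)
      mL(3,4)[OF z(2)] by (simp add: chart_inv_simps[OF assms(1)] z dot_square_norm)
  have "0 \<le> a \<bullet> (matrix_inv (g c z) *v a)" if "z \<in> fst c" "snd c z \<in> K" for z a
    using *[OF that, of a] mL(2) by (meson order_trans zero_le_mult_iff zero_le_power2 not_le)
  then have "(covector_norm g c z a)\<^sup>2 = a \<bullet> (matrix_inv (g c z) *v a)" if "z \<in> fst c" "snd c z \<in> K" for z a
    using that by (simp add: covector_norm_alt)
  then show ?thesis using that[of m L] mL(1,2) * by simp
qed

lemma covector_norm_nonneg:
  assumes "c \<in> Atl" "z \<in> fst c"
  shows "0 \<le> covector_norm g c z a"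
proof -
  let ?b = "matrix_inv (g c z) *v a"
  have "g c z *v ?b = a"
    using positive_definite_inverse(2)[of "g c z"] metric_at(2)[OF assms]
    by (simp add: matrix_vector_mul_assoc)
  moreover have "0 \<le> ?b \<bullet> (g c z *v ?b)" using metric_at(2)[OF assms, of ?b] by (cases "?b = 0") auto
  ultimately show ?thesis by (simp add: covector_norm_alt inner_commute)
qed

text \<open>Near a point, the covectors of length at most \<open>C\<close> have bounded components in one chart \<open>c0\<close>, where \<open>\<phi>\<close> is
continuous. The values of \<open>\<phi>\<close> and the lengths in any other chart agree with those in \<open>c0\<close>.\<close>

lemma positive_fun_bounded:
  assumes comp: "compact (UNIV :: 'm set)" and \<phi>: "smooth_positive_fun Atl \<phi>"
  obtains M where "\<And>c z a t. c \<in> Atl \<Longrightarrow> z \<in> fst c \<Longrightarrow> covector_norm g c z a \<le> C \<Longrightarrow> \<bar>t\<bar> \<le> C \<Longrightarrow>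
    \<phi> c z a t \<le> M"
proof -
  let ?Q = "\<lambda>z M. \<forall>c\<in>Atl. z \<in> fst c \<longrightarrow> (\<forall>a t. covector_norm g c z a \<le> C \<longrightarrow> \<bar>t\<bar> \<le> C \<longrightarrow> \<phi> c z a t \<le> M)"
  have mono: "?Q z M'" if "?Q z M" "M \<le> M'" for z M M'
    using that(1) order_trans[OF _ that(2)] by blast
  have loc: "\<exists>U M. open U \<and> x \<in> U \<and> (\<forall>z\<in>U. ?Q z M)" for x
  proof -
    obtain c0 where c0: "c0 \<in> Atl" "x \<in> fst c0" using chart_cover by blast
    obtain U K where UK: "open U" "x \<in> U" "U \<subseteq> fst c0" "compact K" "snd c0 ` U \<subseteq> K" "K \<subseteq> snd c0 ` fst c0"
      by (rule compact_chart_neighbourhood[OF c0])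
    have K: "K \<noteq> {}" using UK by blast
    obtain m L where mL: "0 < m" "0 < L"
      "\<And>z a. z \<in> fst c0 \<Longrightarrow> snd c0 z \<in> K \<Longrightarrow> (norm a)\<^sup>2 \<le> L * (covector_norm g c0 z a)\<^sup>2"
      "\<And>z a. z \<in> fst c0 \<Longrightarrow> snd c0 z \<in> K \<Longrightarrow> m * (covector_norm g c0 z a)\<^sup>2 \<le> (norm a)\<^sup>2"
      by (rule metric_local_bounds[OF c0(1) UK(4,6) K]) (rule that)
    let ?f = "\<lambda>(y, a, t). \<phi> c0 (chart_inv c0 y) a t"
    let ?B = "K \<times> cball (0 :: 'n rvec) (sqrt (L * C\<^sup>2)) \<times> cball (0::real) C"
    have "smooth_on ?f ((snd c0 ` fst c0) \<times> UNIV \<times> UNIV)"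
      using \<phi> c0(1) unfolding smooth_positive_fun_def by blast
    then have "Ck_on 0 ?f ((snd c0 ` fst c0) \<times> UNIV \<times> UNIV)" unfolding smooth_on_def by blast
    then have "continuous_on ?B ?f" using UK(6) by (auto intro: continuous_on_subset)
    moreover have "compact ?B" using UK(4) by (intro compact_Times compact_cball)
    ultimately have "bounded (?f ` ?B)" by (intro compact_imp_bounded compact_continuous_image)
    then obtain M where M: "\<And>v. v \<in> ?f ` ?B \<Longrightarrow> norm v \<le> M" unfolding bounded_iff by blast
    have "\<phi> c z a t \<le> M" if z: "z \<in> U" and c: "c \<in> Atl" "z \<in> fst c"
      and a: "covector_norm g c z a \<le> C" and t: "\<bar>t\<bar> \<le> C" for z c a t
    proof -
      have z0: "z \<in> fst c0" "snd c0 z \<in> K" using z UK by auto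
      have both: "z \<in> fst c \<inter> fst c0" using z0 c by simp
      let ?J = "chart_jac c c0 z"
      obtain N where N: "N ** ?J = mat 1" using chart_jac_inverse[OF c(1) c0(1) both] by blast
      define b where "b = transpose N *v a"
      have "transpose ?J *v b = transpose (N ** ?J) *v a"
        by (simp only: b_def matrix_vector_mul_assoc matrix_transpose_mul)
      then have ab: "a = transpose ?J *v b" by (simp only: N transpose_mat matrix_vector_mul_lid)
      have "covector_norm g c0 z b \<le> C"
        using a unfolding ab covector_norm_transform[OF c(1) c0(1) both] .
      then have "L * (covector_norm g c0 z b)\<^sup>2 \<le> L * C\<^sup>2"
        using mL(2) covector_norm_nonneg[OF c0(1) z0(1)] by (intro mult_left_mono power_mono) auto
      then have "(norm b)\<^sup>2 \<le> L * C\<^sup>2" using mL(3)[OF z0, of b] by linarith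
      then have "norm b \<le> sqrt (L * C\<^sup>2)" by (rule real_le_rsqrt)
      then have "(snd c0 z, b, t) \<in> ?B" using z0 t by simp
      from M[OF imageI[OF this]] have "\<phi> c0 z b t \<le> M"
        by (simp add: chart_inv_simps[OF c0(1)] z0)
      moreover have "\<phi> c z (transpose ?J *v b) t = \<phi> c0 z b t"
        using \<phi> c(1) c0(1) both unfolding smooth_positive_fun_def by blast
      ultimately show ?thesis by (simp only: ab)
    qed
    then show ?thesis using UK by blast
  qed
  obtain M where M: "\<And>z. ?Q z M"
    by (rule compact_uniform_bound[OF comp, of ?Q]) (rule mono, assumption+, rule loc, rule that)
  show ?thesis by (rule that[of M]) (use M in auto)
qed

lemma C2_fun_chart: "C2_fun Atl u \<Longrightarrow> c \<in> Atl \<Longrightarrow> Ck_on 2 (u \<circ> chart_inv c) (snd c ` fst c)"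
  by (simp add: C2_fun_def)

lemma C2_fun_bounded:
  assumes comp: "compact (UNIV :: 'm set)" and u: "C2_fun Atl u"
  obtains M where "\<And>z. \<bar>u z\<bar> \<le> M"
    "\<And>c z. c \<in> Atl \<Longrightarrow> z \<in> fst c \<Longrightarrow> covector_norm g c z (differential c u z) \<le> M"
proof -
  let ?Q = "\<lambda>z M. \<bar>u z\<bar> \<le> M \<and>
    (\<forall>c\<in>Atl. z \<in> fst c \<longrightarrow> covector_norm g c z (differential c u z) \<le> M)"
  have mono: "?Q z M'" if "?Q z M" "M \<le> M'" for z M M'
    using that(1) order_trans[OF _ that(2)] by blast
  have loc: "\<exists>U M. open U \<and> x \<in> U \<and> (\<forall>z\<in>U. ?Q z M)" for x
  proof -
    obtain c0 where c0: "c0 \<in> Atl" "x \<in> fst c0" using chart_cover by blast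
    obtain U K where UK: "open U" "x \<in> U" "U \<subseteq> fst c0" "compact K" "snd c0 ` U \<subseteq> K" "K \<subseteq> snd c0 ` fst c0"
      by (rule compact_chart_neighbourhood[OF c0])
    have K: "K \<noteq> {}" using UK by blast
    obtain m L where mL: "0 < m" "0 < L"
      "\<And>z a. z \<in> fst c0 \<Longrightarrow> snd c0 z \<in> K \<Longrightarrow> (norm a)\<^sup>2 \<le> L * (covector_norm g c0 z a)\<^sup>2"
      "\<And>z a. z \<in> fst c0 \<Longrightarrow> snd c0 z \<in> K \<Longrightarrow> m * (covector_norm g c0 z a)\<^sup>2 \<le> (norm a)\<^sup>2"
      by (rule metric_local_bounds[OF c0(1) UK(4,6) K]) (rule that)
    note u0 = C2_fun_chart[OF u c0(1)]
    let ?f = "u \<circ> chart_inv c0" and ?d = "\<lambda>y. (\<chi> j. partial j (u \<circ> chart_inv c0) y)"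
    have "continuous_on K ?f" using C2_onD(4)[OF u0] UK(6) continuous_on_subset by blast
    then have "bounded (?f ` K)" using UK(4) by (intro compact_imp_bounded compact_continuous_image)
    then obtain M1 where M1: "\<And>y. y \<in> K \<Longrightarrow> norm (?f y) \<le> M1" unfolding bounded_iff by blast
    have "continuous_on K ?d"
      using C2_on_partial_continuous(1)[OF u0] UK(6)
      by (intro continuous_on_vec_lambda) (rule continuous_on_subset)
    then have "bounded (?d ` K)" using UK(4) by (intro compact_imp_bounded compact_continuous_image)
    then obtain M2 where M2: "\<And>y. y \<in> K \<Longrightarrow> norm (?d y) \<le> M2" unfolding bounded_iff by blast
    have "?Q z (max M1 (sqrt (M2\<^sup>2 / m)))" if z: "z \<in> U" for z
    proof -
      have z0: "z \<in> fst c0" "snd c0 z \<in> K" using z UK by auto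
      have "\<bar>u z\<bar> \<le> M1" using M1[OF z0(2)] by (simp add: chart_inv_simps[OF c0(1)] z0)
      moreover have "covector_norm g c z (differential c u z) \<le> sqrt (M2\<^sup>2 / m)"
        if c: "c \<in> Atl" "z \<in> fst c" for c
      proof -
        have both: "z \<in> fst c \<inter> fst c0" using z0 c by simp
        have "m * (covector_norm g c0 z (differential c0 u z))\<^sup>2 \<le> (norm (?d (snd c0 z)))\<^sup>2"
          using mL(4)[OF z0, of "differential c0 u z"] by (simp add: differential_def)
        also have "\<dots> \<le> M2\<^sup>2" using M2[OF z0(2)] by (intro power_mono) auto
        finally have "(covector_norm g c0 z (differential c0 u z))\<^sup>2 \<le> M2\<^sup>2 / m"
          using mL(1) by (simp add: pos_le_divide_eq mult.commute)
        then have "covector_norm g c0 z (differential c0 u z) \<le> sqrt (M2\<^sup>2 / m)" by (rule real_le_rsqrt)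
        then show ?thesis
          by (simp only: differential_transform[OF c(1) c0(1) both u] covector_norm_transform[OF c(1) c0(1) both])
      qed
      ultimately show ?thesis by (auto simp: le_max_iff_disj)
    qed
    then show ?thesis using UK by blast
  qed
  obtain M where M: "\<And>z. ?Q z M"
    by (rule compact_uniform_bound[OF comp, of ?Q]) (rule mono, assumption+, rule loc, rule that)
  show ?thesis by (rule that[of M]) (use M in auto)
qed

text \<open>A supremum of reals bounds the set only if the set is bounded above; this is where \<open>C2_fun_bounded\<close> enters.\<close>

lemma sup_norm_bounds:
  assumes comp: "compact (UNIV :: 'm set)" and u: "C2_fun Atl u"
    and C: "(SUP x. \<bar>u x\<bar>) + Sup {covector_norm g c x (differential c u x) | c x. c \<in> Atl \<and> x \<in> fst c} \<le> C"
  shows "\<bar>u z\<bar> \<le> C" "c \<in> Atl \<Longrightarrow> z \<in> fst c \<Longrightarrow> covector_norm g c z (differential c u z) \<le> C"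
proof -
  let ?N = "{covector_norm g c x (differential c u x) | c x. c \<in> Atl \<and> x \<in> fst c}"
  obtain M where M: "\<And>z. \<bar>u z\<bar> \<le> M"
    "\<And>c z. c \<in> Atl \<Longrightarrow> z \<in> fst c \<Longrightarrow> covector_norm g c z (differential c u z) \<le> M"
    using C2_fun_bounded[OF comp u] by blast
  have bdd: "bdd_above (range (\<lambda>x. \<bar>u x\<bar>))" "bdd_above ?N"
    using M by (auto intro!: bdd_aboveI[of _ M])
  have 1: "\<bar>u x\<bar> \<le> (SUP x. \<bar>u x\<bar>)" for x by (rule cSUP_upper[OF UNIV_I bdd(1)])
  have 2: "covector_norm g c x (differential c u x) \<le> Sup ?N" if "c \<in> Atl" "x \<in> fst c" for c x
    by (rule cSup_upper[OF _ bdd(2)]) (use that in blast)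
  have "0 \<le> (SUP x. \<bar>u x\<bar>)" by (rule order_trans[OF abs_ge_zero 1[of z]])
  moreover have "0 \<le> Sup ?N"
  proof -
    obtain c where c: "c \<in> Atl" "z \<in> fst c" using chart_cover by blast
    show ?thesis by (rule order_trans[OF covector_norm_nonneg[OF c] 2[OF c]])
  qed
  ultimately have le: "(SUP x. \<bar>u x\<bar>) \<le> C" "Sup ?N \<le> C" using C by simp_all
  show "\<bar>u z\<bar> \<le> C" by (rule order_trans[OF 1 le(1)])
  show "covector_norm g c z (differential c u z) \<le> C" if "c \<in> Atl" "z \<in> fst c"
    by (rule order_trans[OF 2[OF that] le(2)])
qed

lemma christoffel_symmetric:
  assumes "c \<in> Atl" "x \<in> fst c"
  shows "christoffel g c x i j k = christoffel g c x i k j"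
proof -
  have "partial l (\<lambda>y. g c (chart_inv c y) $ a $ b) (snd c x) =
      partial l (\<lambda>y. g c (chart_inv c y) $ b $ a) (snd c x)" for l a b
  proof (rule partial_cong_open[OF chart_open(2)[OF assms(1)]])
    show "snd c x \<in> snd c ` fst c" using assms by simp
    fix y assume "y \<in> snd c ` fst c"
    then have "transpose (g c (chart_inv c y)) = g c (chart_inv c y)"
      by (intro metric_at chart_inv_simps assms)
    from arg_cong[OF this, of "\<lambda>M. M $ b $ a"]
    show "g c (chart_inv c y) $ a $ b = g c (chart_inv c y) $ b $ a" by (simp add: transpose_def)
  qed
  from this[of _ j k] show ?thesis unfolding christoffel_def Let_def by (simp add: add.commute)
qed

lemma hessian_symmetric:
  assumes "c \<in> Atl" "x \<in> fst c" "C2_fun Atl u"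
  shows "transpose (hessian g c u x) = hessian g c u x"
proof -
  note f = C2_fun_chart[OF assms(3,1)]
  have x: "snd c x \<in> snd c ` fst c" using assms by simp
  have "partial j (partial k (u \<circ> chart_inv c)) (snd c x) = partial k (partial j (u \<circ> chart_inv c)) (snd c x)" for j k
    unfolding C2_on_partial(3)[OF f x]
    by (rule second_frechet_sym[OF f chart_open(2)[OF assms(1)] x])
  then show ?thesis
    using christoffel_symmetric[OF assms(1,2)]
    by (simp add: hessian_def transpose_def vec_eq_iff)
qed

lemma differential_diff:
  assumes "c \<in> Atl" "x \<in> fst c" "C2_fun Atl w" "C2_fun Atl u"
  shows "differential c (\<lambda>z. w z - u z) x = differential c w x - differential c u x"
  using partial_diff[OF C2_on_partial(1)[OF C2_fun_chart[OF assms(3,1)] imageI[OF assms(2)]]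
      C2_on_partial(1)[OF C2_fun_chart[OF assms(4,1)] imageI[OF assms(2)]]]
  by (simp add: differential_def vec_eq_iff o_def)

lemma hessian_diff:
  assumes "c \<in> Atl" "x \<in> fst c" "C2_fun Atl w" "C2_fun Atl u"
  shows "hessian g c (\<lambda>z. w z - u z) x = hessian g c w x - hessian g c u x"
proof -
  note w = C2_fun_chart[OF assms(3,1)] and u = C2_fun_chart[OF assms(4,1)]
  let ?w = "w \<circ> chart_inv c" and ?u = "u \<circ> chart_inv c"
  have "partial j (partial k ((\<lambda>z. w z - u z) \<circ> chart_inv c)) (snd c x) =
      partial j (partial k ?w) (snd c x) - partial j (partial k ?u) (snd c x)" for j k
  proof -
    have "partial j (partial k ((\<lambda>z. w z - u z) \<circ> chart_inv c)) (snd c x) =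
        partial j (\<lambda>y. partial k ?w y - partial k ?u y) (snd c x)"
    proof (rule partial_cong_open[OF chart_open(2)[OF assms(1)] imageI[OF assms(2)]])
      fix y assume y: "y \<in> snd c ` fst c"
      show "partial k ((\<lambda>z. w z - u z) \<circ> chart_inv c) y = partial k ?w y - partial k ?u y"
        using partial_diff[OF C2_on_partial(1)[OF w y] C2_on_partial(1)[OF u y]] by (simp add: o_def)
    qed
    also have "\<dots> = partial j (partial k ?w) (snd c x) - partial j (partial k ?u) (snd c x)"
      by (rule partial_diff) (rule C2_on_partial(2)[OF w imageI[OF assms(2)]],
        rule C2_on_partial(2)[OF u imageI[OF assms(2)]])
    finally show ?thesis .
  qed
  then show ?thesis
    using differential_diff[OF assms]
    by (simp add: hessian_def vec_eq_iff right_diff_distrib sum_subtractf)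
qed

lemma form_C2:
  assumes "smooth_symmetric_form Atl A" "c \<in> Atl" "x \<in> fst c"
  shows "Ck_on 2 (\<lambda>a. A c x a t) UNIV"
proof -
  let ?f = "\<lambda>(y, a, t). A c (chart_inv c y) a t"
  have "smooth_on ?f ((snd c ` fst c) \<times> UNIV \<times> UNIV)"
    using assms unfolding smooth_symmetric_form_def by blast
  then have "Ck_on 2 ?f ((snd c ` fst c) \<times> UNIV \<times> UNIV)" unfolding smooth_on_def by blast
  then have "Ck_on 2 (\<lambda>a. ?f ((snd c x, 0, t) + (0, a, 0))) UNIV"
    by (rule Ck_on_compose_affine)
      (use assms in \<open>auto intro!: bounded_linear_Pair bounded_linear_zero bounded_linear_ident\<close>)
  then show ?thesis by (simp add: chart_inv_simps[OF assms(2)] assms(3))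
qed

text \<open>The function is \<open>C\<^sup>2\<close> in the covector and has nonpositive second derivatives, so it is concave.\<close>

lemma form_below_tangent:
  assumes A: "smooth_symmetric_form Atl A" and c: "c \<in> Atl" "x \<in> fst c"
    and concave: "\<And>a b. second_frechet (\<lambda>a'. v \<bullet> (A c x a' t *v v)) a b b \<le> 0"
  shows "v \<bullet> (A c x a1 t *v v) - v \<bullet> (A c x a0 t *v v) \<le>
    v \<bullet> ((\<chi> j k. frechet_derivative (\<lambda>a. A c x a t $ j $ k) (at a0) (a1 - a0)) *v v)"
proof -
  note C2 = form_C2[OF A c, of t]
  have lin: "bounded_linear (\<lambda>M :: 'n rmat. v \<bullet> (M *v v))"
    by (rule linear_conv_bounded_linear[THEN iffD1], rule linearI)
      (simp_all add: matrix_vector_mult_add_rdistrib inner_add_right scaleR_matrix_vector_assoc[symmetric])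
  have lin_entry: "bounded_linear (\<lambda>M :: 'n rmat. M $ j $ k)" for j k
    by (intro bounded_linear_compose[OF bounded_linear_vec_nth] bounded_linear_vec_nth)
  note d = C2_onD(1)[OF C2 UNIV_I, of a0]
  have "v \<bullet> (A c x a1 t *v v) - v \<bullet> (A c x a0 t *v v) \<le>
      frechet_derivative (\<lambda>a. v \<bullet> (A c x a t *v v)) (at a0) (a1 - a0)"
    by (rule concave_le_tangent[OF Ck_on_bounded_linear[OF C2 open_UNIV lin] concave])
  also have "\<dots> = v \<bullet> (frechet_derivative (\<lambda>a. A c x a t) (at a0) (a1 - a0) *v v)"
    using fun_cong[OF frechet_derivative_at[OF bounded_linear.has_derivative[OF lin d]]] by simp
  also have "frechet_derivative (\<lambda>a. A c x a t) (at a0) (a1 - a0) =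
      (\<chi> j k. frechet_derivative (\<lambda>a. A c x a t $ j $ k) (at a0) (a1 - a0))"
    using fun_cong[OF frechet_derivative_at[OF bounded_linear.has_derivative[OF lin_entry d]], of "a1 - a0"]
    by (simp add: vec_eq_iff)
  finally show ?thesis .
qed

section \<open>Dimension one\<close>

lemma metric_entry_C2:
  assumes "c \<in> Atl"
  shows "Ck_on 2 (\<lambda>y. g c (chart_inv c y) $ j $ k) (snd c ` fst c)"
proof -
  have "smooth_on (\<lambda>y. g c (chart_inv c y)) (snd c ` fst c)"
    using metric assms unfolding riemannian_metric_def by blast
  then have C2: "Ck_on 2 (\<lambda>y. g c (chart_inv c y)) (snd c ` fst c)" unfolding smooth_on_def by blast
  have "bounded_linear (\<lambda>M :: 'n rmat. M $ j $ k)"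
    by (intro bounded_linear_compose[OF bounded_linear_vec_nth] bounded_linear_vec_nth)
  from Ck_on_bounded_linear[OF C2 chart_open(2)[OF assms] this] show ?thesis .
qed

context
  fixes i :: 'n
  assumes n: "(UNIV :: 'n set) = {i}"
begin

lemma metric_dim1_pos:
  assumes "c \<in> Atl" "x \<in> fst c"
  shows "0 < g c x $ i $ i"
  using metric_at(2)[OF assms, of "axis i 1"]
  by (simp add: matrix_vector_mult_basis column_def inner_axis' axis_eq_0_iff)

lemma christoffel_dim1:
  assumes "c \<in> Atl" "x \<in> fst c"
  shows "christoffel g c x i i i =
    partial i (\<lambda>y. g c (chart_inv c y) $ i $ i) (snd c x) / (2 * g c x $ i $ i)"
proof -
  have "g c x ** matrix_inv (g c x) = mat 1"
    using positive_definite_inverse(2) metric_at(2)[OF assms] by blast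
  from arg_cong[OF this, of "\<lambda>M. M $ i $ i"]
  have "g c x $ i $ i * matrix_inv (g c x) $ i $ i = 1"
    by (simp add: matrix_matrix_mult_def mat_def n)
  then have "matrix_inv (g c x) $ i $ i = 1 / g c x $ i $ i"
    using metric_dim1_pos[OF assms] by (simp add: field_simps)
  then show ?thesis by (simp add: christoffel_def Let_def n)
qed

lemma hessian_dim1:
  assumes "c \<in> Atl" "x \<in> fst c"
  shows "hessian g c u x $ i $ i = partial i (partial i (u \<circ> chart_inv c)) (snd c x)
    - partial i (\<lambda>y. g c (chart_inv c y) $ i $ i) (snd c x) / (2 * g c x $ i $ i)
      * partial i (u \<circ> chart_inv c) (snd c x)"
  by (simp add: hessian_def differential_def n christoffel_dim1[OF assms])

text \<open>The second derivative of the transition map enters both through the second derivative of \<open>u\<close> and through the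
derivative of the metric in the Christoffel symbol; the two contributions cancel.\<close>

lemma hessian_transform_dim1:
  assumes c: "c \<in> Atl" "c' \<in> Atl" "x \<in> fst c \<inter> fst c'" and u: "C2_fun Atl u"
  shows "hessian g c u x $ i $ i = (chart_jac c c' x $ i $ i)\<^sup>2 * hessian g c' u x $ i $ i"
proof -
  let ?O = "snd c ` (fst c \<inter> fst c')" and ?\<tau> = "transition c c'"
  let ?J = "partial i (\<lambda>z. ?\<tau> z $ i)"
  let ?f = "u \<circ> chart_inv c'" and ?h = "\<lambda>y. g c' (chart_inv c' y) $ i $ i"
  let ?y = "snd c x"
  have yO: "?y \<in> ?O" and O: "open ?O" using c open_overlap by auto
  have \<tau>S: "?\<tau> z \<in> snd c' ` fst c'" if "z \<in> ?O" for z
    by (rule transition_facts(3)[OF c(1,2) that])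
  have \<tau>y: "?\<tau> ?y = snd c' x" using transition_facts(2)[OF c(1,2)] c(3) by simp
  have \<tau>d: "?\<tau> differentiable (at z)" if "z \<in> ?O" for z
    using C2_onD(1)[OF transition_facts(1)[OF c(1,2)] that] by (auto simp: differentiable_def)
  have \<tau>i: "Ck_on 2 (\<lambda>z. ?\<tau> z $ i) ?O"
    by (rule Ck_on_bounded_linear[OF transition_facts(1)[OF c(1,2)] O bounded_linear_vec_nth])
  note f = C2_fun_chart[OF u c(2)] and h = metric_entry_C2[OF c(2), of i i]
  have jac: "chart_jac c c' z $ i $ i = ?J (snd c z)" if z: "z \<in> fst c \<inter> fst c'" for z
  proof -
    have "((\<lambda>y. ?\<tau> y $ i) has_derivative (\<lambda>v. (chart_jac c c' z *v v) $ i)) (at (snd c z))"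
      by (rule bounded_linear.has_derivative[OF bounded_linear_vec_nth
            transition_has_derivative[OF c(1,2) z]])
    from fun_cong[OF frechet_derivative_at[OF this], of "axis i 1"] show ?thesis
      by (simp add: partial_def matrix_vector_mult_basis column_def)
  qed
  have chain: "partial i (\<lambda>z. k (?\<tau> z)) z = ?J z * partial i k (?\<tau> z)"
    "(\<lambda>z. k (?\<tau> z)) differentiable (at z)"
    if "z \<in> ?O" "k differentiable (at (?\<tau> z))" for k z
    using partial_compose[OF \<tau>d[OF that(1)] that(2)] by (simp_all add: n)
  have u1: "partial i (u \<circ> chart_inv c) z = partial i ?f (?\<tau> z) * ?J z" if z: "z \<in> ?O" for z
  proof -
    have "partial i (u \<circ> chart_inv c) z = partial i (\<lambda>z. ?f (?\<tau> z)) z"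
      by (rule partial_cong_open[OF O z]) (simp add: transition_facts(4)[OF c(1,2)])
    then show ?thesis using chain(1)[OF z C2_on_partial(1)[OF f \<tau>S[OF z]]] by simp
  qed
  have u2: "partial i (partial i (u \<circ> chart_inv c)) ?y =
      partial i ?f (snd c' x) * partial i ?J ?y + ?J ?y * partial i (partial i ?f) (snd c' x) * ?J ?y"
  proof -
    have "partial i (partial i (u \<circ> chart_inv c)) ?y = partial i (\<lambda>z. partial i ?f (?\<tau> z) * ?J z) ?y"
      by (rule partial_cong_open[OF O yO u1])
    also have "\<dots> = partial i ?f (?\<tau> ?y) * partial i ?J ?y
        + ?J ?y * partial i (partial i ?f) (?\<tau> ?y) * ?J ?y"
      using chain[OF yO C2_on_partial(2)[OF f \<tau>S[OF yO]], of i]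
      by (simp add: partial_mult[OF _ C2_on_partial(2)[OF \<tau>i yO]])
    finally show ?thesis by (simp only: \<tau>y)
  qed
  have g1: "g c z $ i $ i = (chart_jac c c' z $ i $ i)\<^sup>2 * g c' z $ i $ i"
    if "z \<in> fst c \<inter> fst c'" for z
    unfolding metric_transform[OF c(1,2) that]
    by (simp add: matrix_matrix_mult_def transpose_def n power2_eq_square)
  have g2: "partial i (\<lambda>y. g c (chart_inv c y) $ i $ i) ?y =
      (?J ?y * ?J ?y) * (?J ?y * partial i ?h (snd c' x))
        + (?J ?y * partial i ?J ?y + partial i ?J ?y * ?J ?y) * ?h (snd c' x)"
  proof -
    have "partial i (\<lambda>y. g c (chart_inv c y) $ i $ i) ?y = partial i (\<lambda>z. (?J z * ?J z) * ?h (?\<tau> z)) ?y"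
    proof (rule partial_cong_open[OF O yO])
      fix z assume z: "z \<in> ?O"
      then obtain q where q: "q \<in> fst c \<inter> fst c'" "z = snd c q" by blast
      then show "g c (chart_inv c z) $ i $ i = (?J z * ?J z) * ?h (?\<tau> z)"
        using g1[OF q(1)] jac[OF q(1)] transition_facts(4)[OF c(1,2) z] chart_inv_simps(1)[OF c(1), of q]
        by (simp add: power2_eq_square)
    qed
    also have "\<dots> = (?J ?y * ?J ?y) * (?J ?y * partial i ?h (?\<tau> ?y))
        + (?J ?y * partial i ?J ?y + partial i ?J ?y * ?J ?y) * ?h (?\<tau> ?y)"
    proof -
      note J = C2_on_partial(2)[OF \<tau>i yO]
      have "(\<lambda>z. ?J z * ?J z) differentiable (at ?y)" using J by (rule differentiable_mult[OF J])
      then show ?thesis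
        using chain[OF yO C2_on_partial(1)[OF h \<tau>S[OF yO]]]
        by (simp add: partial_mult J)
    qed
    finally show ?thesis by (simp only: \<tau>y)
  qed
  have x': "chart_inv c' (snd c' x) = x" using c chart_inv_simps(1)[OF c(2)] by simp
  define J DJ G DG F DF where "J = ?J ?y" and "DJ = partial i ?J ?y" and "G = g c' x $ i $ i"
    and "DG = partial i ?h (snd c' x)" and "F = partial i ?f (snd c' x)"
    and "DF = partial i (partial i ?f) (snd c' x)"
  have Gpos: "0 < G" using metric_dim1_pos c by (simp add: G_def)
  have gc: "g c x $ i $ i = J\<^sup>2 * G" using g1[OF c(3)] jac[OF c(3)] by (simp add: J_def G_def)
  moreover have "0 < g c x $ i $ i" using metric_dim1_pos c by simp
  ultimately have J: "J \<noteq> 0" by auto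
  have "hessian g c u x $ i $ i =
      (F * DJ + J * DF * J) - (J * J * (J * DG) + (J * DJ + DJ * J) * G) / (2 * (J\<^sup>2 * G)) * (F * J)"
    using c u1[OF yO]
    by (simp add: hessian_dim1 u2 g2 gc \<tau>y x' J_def DJ_def DG_def F_def DF_def G_def)
  also have "\<dots> = J\<^sup>2 * (DF - DG / (2 * G) * F)"
    using J Gpos by (simp add: field_simps power2_eq_square)
  also have "DF - DG / (2 * G) * F = hessian g c' u x $ i $ i"
    using c by (simp add: hessian_dim1 DG_def F_def DF_def G_def)
  finally show ?thesis by (simp add: J_def jac[OF c(3)])
qed

lemma augmented_quotient_transform_dim1:
  assumes c: "c \<in> Atl" "c' \<in> Atl" "x \<in> fst c \<inter> fst c'" and u: "C2_fun Atl u"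
    and A: "smooth_symmetric_form Atl A"
  shows "augmented_hessian g A c u x $ i $ i / g c x $ i $ i =
    augmented_hessian g A c' u x $ i $ i / g c' x $ i $ i"
proof -
  let ?J = "chart_jac c c' x"
  have "A c x (transpose ?J *v differential c' u x) (u x) =
      transpose ?J ** A c' x (differential c' u x) (u x) ** ?J"
    using A c unfolding smooth_symmetric_form_def by blast
  then have "augmented_hessian g A c u x $ i $ i = (?J $ i $ i)\<^sup>2 * augmented_hessian g A c' u x $ i $ i"
    unfolding augmented_hessian_def differential_transform[OF c u]
    by (simp add: hessian_transform_dim1[OF c u] matrix_matrix_mult_def transpose_def n
        power2_eq_square algebra_simps)
  moreover have g: "g c x $ i $ i = (?J $ i $ i)\<^sup>2 * g c' x $ i $ i"
    unfolding metric_transform[OF c]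
    by (simp add: matrix_matrix_mult_def transpose_def n power2_eq_square)
  moreover have "(?J $ i $ i)\<^sup>2 \<noteq> 0" using metric_dim1_pos[of c x] c g by auto
  ultimately show ?thesis by simp
qed

lemma augmented_quotient_bounded_dim1:
  assumes comp: "compact (UNIV :: 'm set)" and u: "C2_fun Atl u" and A: "smooth_symmetric_form Atl A"
  obtains T where "\<And>c z. c \<in> Atl \<Longrightarrow> z \<in> fst c \<Longrightarrow> \<bar>augmented_hessian g A c u z $ i $ i / g c z $ i $ i\<bar> \<le> T"
proof -
  let ?q = "\<lambda>c z. augmented_hessian g A c u z $ i $ i / g c z $ i $ i"
  let ?Q = "\<lambda>z T. \<forall>c\<in>Atl. z \<in> fst c \<longrightarrow> \<bar>?q c z\<bar> \<le> T"
  have mono: "?Q z T'" if "?Q z T" "T \<le> T'" for z T T'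
    using that(1) order_trans[OF _ that(2)] by blast
  have loc: "\<exists>U T. open U \<and> x \<in> U \<and> (\<forall>z\<in>U. ?Q z T)" for x
  proof -
    obtain c0 where c0: "c0 \<in> Atl" "x \<in> fst c0" using chart_cover by blast
    obtain U K where UK: "open U" "x \<in> U" "U \<subseteq> fst c0" "compact K" "snd c0 ` U \<subseteq> K" "K \<subseteq> snd c0 ` fst c0"
      by (rule compact_chart_neighbourhood[OF c0])
    let ?S = "snd c0 ` fst c0" and ?f = "u \<circ> chart_inv c0" and ?h = "\<lambda>y. g c0 (chart_inv c0 y) $ i $ i"
    note f = C2_fun_chart[OF u c0(1)] and h = metric_entry_C2[OF c0(1), of i i]
    have "smooth_on (\<lambda>(y, a, t). A c0 (chart_inv c0 y) a t) (?S \<times> UNIV \<times> UNIV)"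
      using A c0(1) unfolding smooth_symmetric_form_def by blast
    then have "Ck_on 0 (\<lambda>(y, a, t). A c0 (chart_inv c0 y) a t) (?S \<times> UNIV \<times> UNIV)"
      unfolding smooth_on_def by blast
    then have contA: "continuous_on (?S \<times> UNIV \<times> UNIV) (\<lambda>(y, a, t). A c0 (chart_inv c0 y) a t)" by simp
    have "continuous_on ?S (\<lambda>y. (y, (\<chi> j. partial j ?f y), ?f y))"
      by (intro continuous_on_Pair continuous_on_id continuous_on_vec_lambda
          C2_on_partial_continuous(1)[OF f] C2_onD(4)[OF f])
    from continuous_on_compose2[OF contA this]
    have "continuous_on ?S (\<lambda>y. A c0 (chart_inv c0 y) (\<chi> j. partial j ?f y) (?f y))" by auto
    then have contA': "continuous_on ?S (\<lambda>y. A c0 (chart_inv c0 y) (\<chi> j. partial j ?f y) (?f y) $ i $ i)"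
      by (intro continuous_intros)
    have pos: "?h y \<noteq> 0" if "y \<in> ?S" for y
      using metric_dim1_pos[OF c0(1) chart_inv_simps(2)[OF c0(1) that]] by simp
    have "continuous_on ?S (\<lambda>y. (A c0 (chart_inv c0 y) (\<chi> j. partial j ?f y) (?f y) $ i $ i +
        (partial i (partial i ?f) y - partial i ?h y / (2 * ?h y) * partial i ?f y)) / ?h y)"
      using pos
      by (intro continuous_intros contA' C2_on_partial_continuous[OF f] C2_on_partial_continuous(1)[OF h]
          C2_onD(4)[OF h]) auto
    also have "?this \<longleftrightarrow> continuous_on ?S (\<lambda>y. ?q c0 (chart_inv c0 y))"
      by (intro continuous_on_cong refl)
        (simp add: augmented_hessian_def hessian_dim1[OF c0(1)] chart_inv_simps[OF c0(1)]
          differential_def)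
    finally have "continuous_on K (\<lambda>y. ?q c0 (chart_inv c0 y))" using UK(6) by (rule continuous_on_subset)
    then have "bounded ((\<lambda>y. ?q c0 (chart_inv c0 y)) ` K)"
      using UK(4) by (intro compact_imp_bounded compact_continuous_image)
    then obtain T where T: "\<And>y. y \<in> K \<Longrightarrow> \<bar>?q c0 (chart_inv c0 y)\<bar> \<le> T"
      unfolding bounded_iff by force
    have "\<bar>?q c z\<bar> \<le> T" if z: "z \<in> U" and c: "c \<in> Atl" "z \<in> fst c" for c z
    proof -
      have z0: "z \<in> fst c0" "snd c0 z \<in> K" using z UK by auto
      then have "\<bar>?q c0 z\<bar> \<le> T" using T[OF z0(2)] by (simp add: chart_inv_simps[OF c0(1)])
      then show ?thesis
        using augmented_quotient_transform_dim1[OF c(1) c0(1) _ u A, of z] z0 c by simp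
    qed
    then show ?thesis using UK by blast
  qed
  obtain T where T: "\<And>z. ?Q z T"
    by (rule compact_uniform_bound[OF comp, of ?Q]) (rule mono, assumption+, rule loc, rule that)
  show ?thesis by (rule that[of T]) (use T in auto)
qed

end

end

section \<open>The pseudo-subsolution condition\<close>

text \<open>The pointwise form of the theorem. The matrix \<open>M\<close> stands for the sum of the Hessian of \<open>w - u\<close> and the linearisation of \<open>A\<close>,
and \<open>W - B\<close> lies below it because \<open>A\<close> is concave.\<close>

lemma elliptic_operator_lower_bound:
  fixes G B W :: "'n::{finite,linorder} rmat" and \<mu> :: "'n rvec"
  assumes G: "transpose G = G" "\<And>v. v \<noteq> 0 \<Longrightarrow> 0 < v \<bullet> (G *v v)"
    and B: "transpose B = B" and W: "transpose W = W" and p: "1 \<le> p" "p \<le> CARD('n)"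
    and B_cone: "eigvals (matrix_inv G ** B) \<in> Gamma_cone p"
    and W_cone: "garding_cone p UNIV
      (\<lambda>i. eigvals (matrix_inv G ** W) $ i - \<epsilon> + (if i = Max UNIV then K else 0))"
    and F: "F = (\<chi> j k. deriv (\<lambda>s. hessian_op p G (B + s *\<^sub>R axis j (axis k 1))) 0)"
    and below: "\<And>v. v \<bullet> ((W - B) *v v) \<le> v \<bullet> (M *v v)"
  shows "0 \<le> min_eigval (F ** G)"
    and "\<epsilon> * (\<Sum>j\<in>UNIV. \<Sum>k\<in>UNIV. F $ j $ k * G $ j $ k) - K * min_eigval (F ** G)
      - root p (elem_sym p (eigvals (matrix_inv G ** B)))
    \<le> (\<Sum>j\<in>UNIV. \<Sum>k\<in>UNIV. F $ j $ k * M $ j $ k)"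
proof -
  obtain P :: "'n rmat" and d :: "'n rvec" where P: "transpose P ** G ** P = mat 1" "transpose P ** B ** P = diag_mat d" "mono (($) d)"
    by (rule simultaneous_diagonalization[OF G B])
  let ?w = "grad_weight p d" and ?X = "transpose P ** W ** P"
  have sim: "similar_to_diag (transpose P ** B ** P) d"
    unfolding similar_to_diag_def P(2) by (intro exI[of _ "mat 1"]) simp
  have B_eig: "eigvals (matrix_inv G ** B) = d" by (rule eigvals_pencil[OF P(1) sim P(3)])
  have d: "garding_cone p UNIV (($) d)" using B_cone by (simp add: B_eig Gamma_cone_iff)
  then have pos: "0 < esym p UNIV (($) d)" by (rule garding_cone_esym_pos) simp_all
  have F: "F = P ** diag_mat ?w ** transpose P"
    unfolding F by (rule gradient_hessian_op[OF P(1) B P(2) p pos])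
  have "transpose ?X = ?X" by (simp add: transpose_congruence W)
  then obtain Q :: "'n rmat" and \<mu> :: "'n rvec" where Q: "orthogonal_matrix Q" "transpose Q ** ?X ** Q = diag_mat \<mu>" "mono (($) \<mu>)"
    by (rule sorted_spectral_theorem)
  have W_eig: "eigvals (matrix_inv G ** W) = \<mu>"
    by (rule eigvals_pencil[OF P(1) orthogonal_similar_to_diag[OF Q(1,2)] Q(3)])
  have G_ii: "column i P \<bullet> (G *v column i P) = 1" for i
    using arg_cong[OF P(1), of "\<lambda>X. X $ i $ i"] by (simp add: congruence_entry mat_def)
  have trace: "(\<Sum>j\<in>UNIV. \<Sum>k\<in>UNIV. F $ j $ k * G $ j $ k) = (\<Sum>i\<in>UNIV. ?w $ i)"
    unfolding F sum_congruence_diag by (simp add: G_ii)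
  have min: "min_eigval (F ** G) = Min (range (($) ?w))"
    unfolding F by (rule min_eigval_congruence[OF P(1)])
  show "0 \<le> min_eigval (F ** G)"
    unfolding min using grad_weight_nonneg[OF d P(3) p(1)] by simp
  have "?X $ i $ i - d $ i = column i P \<bullet> ((W - B) *v column i P)" for i
    using arg_cong[OF P(2), of "\<lambda>X. X $ i $ i"]
    by (simp add: congruence_entry diag_mat_def matrix_vector_mult_diff_rdistrib inner_diff_right)
  then have "(\<Sum>i\<in>UNIV. ?w $ i * (?X $ i $ i - d $ i)) \<le> (\<Sum>i\<in>UNIV. ?w $ i * (column i P \<bullet> (M *v column i P)))"
    using below grad_weight_nonneg[OF d P(3) p(1)] by (auto intro!: sum_mono mult_left_mono)
  also have "\<dots> = (\<Sum>j\<in>UNIV. \<Sum>k\<in>UNIV. F $ j $ k * M $ j $ k)"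
    unfolding F sum_congruence_diag ..
  finally show "\<epsilon> * (\<Sum>j\<in>UNIV. \<Sum>k\<in>UNIV. F $ j $ k * G $ j $ k) - K * min_eigval (F ** G)
      - root p (elem_sym p (eigvals (matrix_inv G ** B)))
    \<le> (\<Sum>j\<in>UNIV. \<Sum>k\<in>UNIV. F $ j $ k * M $ j $ k)"
    using gradient_pairing_lower_bound[OF d P(3) p(1) Q W_cone[unfolded W_eig]]
    unfolding trace min B_eig elem_sym_eq_esym by linarith
qed

theorem proposition3p6:
  fixes Atl :: "('m::{t2_space, second_countable_topology}, 'n::{finite, linorder}) chart set"
    and g :: "('m, 'n) metric"
    and p :: nat
    and A :: "('m, 'n) cotangent_form"
    and \<phi> :: "('m, 'n) cotangent_fun"
    and w :: "'m \<Rightarrow> real"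
    and \<phi>' :: "'m \<Rightarrow> real"
  assumes "smooth_atlas Atl"
    and "compact (UNIV :: 'm set)"
    and "connected (UNIV :: 'm set)"
    and "riemannian_metric Atl g"
    and "p \<in> {1..CARD('n)}"
    and "smooth_symmetric_form Atl A"
    and "smooth_positive_fun Atl \<phi>"
    and "\<And>c x a t t'. c \<in> Atl \<Longrightarrow> x \<in> fst c \<Longrightarrow> A c x a t = A c x a t'"
    and "\<And>c x t a b v. c \<in> Atl \<Longrightarrow> x \<in> fst c \<Longrightarrow>
           second_frechet (\<lambda>a'. v \<bullet> (A c x a' t *v v)) a b b \<le> 0"
    and "C2_fun Atl w"
    and "\<And>x. \<phi>' x > 0"
    and "\<exists>\<delta>>0. \<exists>R>0. \<forall>c\<in>Atl. \<forall>x\<in>fst c.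
           {\<xi> \<in> Gamma_cone p. root p (elem_sym p \<xi>) = \<phi>' x}
             \<inter> ({hessian_eigvals g A c w x - \<delta> *\<^sub>R 1} + Gamma_cone CARD('n))
           \<subseteq> ball 0 R"
  shows "pseudo_subsolution Atl g p A \<phi> w"
proof -
  interpret riemannian_atlas Atl g by standard (rule assms)+
  note comp = assms(2) and A = assms(6) and \<phi> = assms(7) and w = assms(10)
  have p: "1 \<le> p" "p \<le> CARD('n)" using assms(5) by auto
  obtain \<delta> R where \<delta>: "0 < \<delta>" and R: "0 < R"
    and ball: "\<And>c x. c \<in> Atl \<Longrightarrow> x \<in> fst c \<Longrightarrow>
      {\<xi> \<in> Gamma_cone p. root p (elem_sym p \<xi>) = \<phi>' x}
        \<inter> ({hessian_eigvals g A c w x - \<delta> *\<^sub>R 1} + Gamma_cone CARD('n)) \<subseteq> ball 0 R"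
    using assms(12) by blast
  have aug_sym: "transpose (augmented_hessian g A c u x) = augmented_hessian g A c u x"
    if "c \<in> Atl" "x \<in> fst c" "C2_fun Atl u" for c x u
  proof -
    have "transpose (A c x (differential c u x) (u x)) = A c x (differential c u x) (u x)"
      using A that unfolding smooth_symmetric_form_def by blast
    then show ?thesis
      using hessian_symmetric[OF that]
      by (simp add: augmented_hessian_def transpose_def vec_eq_iff)
  qed
  have eig_mono: "mono (($) (hessian_eigvals g A c w x))" if c: "c \<in> Atl" "x \<in> fst c" for c x
  proof -
    obtain P :: "'n rmat" and d :: "'n rvec" where P: "transpose P ** g c x ** P = mat 1"
      "transpose P ** augmented_hessian g A c w x ** P = diag_mat d" "mono (($) d)"
      by (rule simultaneous_diagonalization[OF metric_at[OF c] aug_sym[OF c w]])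
    have "similar_to_diag (transpose P ** augmented_hessian g A c w x ** P) d"
      unfolding similar_to_diag_def P(2) by (intro exI[of _ "mat 1"]) simp
    from eigvals_pencil[OF P(1) this P(3)] P(3) show ?thesis by (simp add: hessian_eigvals_def)
  qed
  \<comment> \<open>The lower bound for the greatest eigenvalue must be uniform in the point and in the chart.\<close>
  obtain T where T: "\<And>c x. c \<in> Atl \<Longrightarrow> x \<in> fst c \<Longrightarrow> - T \<le> hessian_eigvals g A c w x $ Max UNIV"
  proof (cases "2 \<le> CARD('n)")
    case True
    have "- R \<le> hessian_eigvals g A c w x $ Max UNIV" if "c \<in> Atl" "x \<in> fst c" for c x
      using largest_component_gt[OF p assms(11) ball[OF that] True eig_mono[OF that] R \<delta>] by simp
    then show ?thesis by (rule that)
  next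
    case False
    then have "CARD('n) = 1" using p by simp
    then obtain i where i: "(UNIV :: 'n set) = {i}" by (metis card_1_singletonE)
    obtain T where T: "\<And>c z. c \<in> Atl \<Longrightarrow> z \<in> fst c \<Longrightarrow>
        \<bar>augmented_hessian g A c w z $ i $ i / g c z $ i $ i\<bar> \<le> T"
      by (rule augmented_quotient_bounded_dim1[OF i comp w A]) (rule that)
    have "- T \<le> hessian_eigvals g A c w x $ Max UNIV" if c: "c \<in> Atl" "x \<in> fst c" for c x
    proof -
      have "g c x $ i $ i \<noteq> 0" using metric_dim1_pos[OF i c] by simp
      from eigvals_dim1[OF i this, of "augmented_hessian g A c w x"]
      have "hessian_eigvals g A c w x $ i = augmented_hessian g A c w x $ i $ i / g c x $ i $ i"
        by (simp add: hessian_eigvals_def)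
      then show ?thesis using T[OF c, THEN abs_le_D2] by (simp add: i)
    qed
    then show ?thesis by (rule that)
  qed
  define K where "K = max 0 (R + T + \<delta>)"
  have w_cone: "garding_cone p UNIV
      (\<lambda>i. hessian_eigvals g A c w x $ i - \<delta> / 2 + (if i = Max UNIV then K else 0))"
    if c: "c \<in> Atl" "x \<in> fst c" for c x
    by (rule garding_cone_largest_component_raised[OF p assms(11) ball[OF c] \<delta> T[OF c]])
      (simp_all add: K_def)
  show ?thesis
    unfolding pseudo_subsolution_def Let_def
  proof (intro allI impI)
    fix C :: real assume "0 \<le> C"
    obtain \<Phi> where \<Phi>: "\<And>c z a t. c \<in> Atl \<Longrightarrow> z \<in> fst c \<Longrightarrow> covector_norm g c z a \<le> C \<Longrightarrow> \<bar>t\<bar> \<le> C \<Longrightarrow>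
        \<phi> c z a t \<le> \<Phi>"
      by (rule positive_fun_bounded[OF comp \<phi>]) (rule that)
    define M where "M = max K \<Phi>"
    have M: "0 \<le> M" "K \<le> M" "\<Phi> \<le> M" by (simp_all add: M_def K_def)
    have main: "\<delta> / 2 * (\<Sum>j\<in>UNIV. \<Sum>k\<in>UNIV. F_coeff g p A c u x $ j $ k * g c x $ j $ k)
        - M * min_eigval (F_coeff g p A c u x ** g c x) - M
        \<le> (\<Sum>j\<in>UNIV. \<Sum>k\<in>UNIV. F_coeff g p A c u x $ j $ k * hessian g c (\<lambda>z. w z - u z) x $ j $ k) +
          (\<Sum>j\<in>UNIV. \<Sum>k\<in>UNIV. F_coeff g p A c u x $ j $ k *
             frechet_derivative (\<lambda>a. A c x a (u x) $ j $ k)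
               (at (differential c u x)) (differential c (\<lambda>z. w z - u z) x))"
      if sol: "is_solution Atl g p A \<phi> u"
        and C: "(SUP x. \<bar>u x\<bar>) + Sup {covector_norm g c x (differential c u x) |c x. c \<in> Atl \<and> x \<in> fst c} \<le> C"
        and c: "c \<in> Atl" "x \<in> fst c" for u c x
    proof -
      have u: "C2_fun Atl u" using sol by (simp add: is_solution_def)
      let ?F = "F_coeff g p A c u x" and ?G = "g c x"
      let ?B = "augmented_hessian g A c u x" and ?W = "augmented_hessian g A c w x"
      let ?DA = "\<chi> j k. frechet_derivative (\<lambda>a. A c x a (u x) $ j $ k) (at (differential c u x))
               (differential c (\<lambda>z. w z - u z) x)"
      let ?M = "hessian g c (\<lambda>z. w z - u z) x + ?DA"
      have below: "v \<bullet> ((?W - ?B) *v v) \<le> v \<bullet> (?M *v v)" for v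
      proof -
        have "v \<bullet> (A c x (differential c w x) (u x) *v v) - v \<bullet> (A c x (differential c u x) (u x) *v v)
            \<le> v \<bullet> (?DA *v v)"
          unfolding differential_diff[OF c w u]
          by (rule form_below_tangent[OF A c assms(9)[OF c]])
        then show ?thesis
          unfolding augmented_hessian_def hessian_diff[OF c w u] assms(8)[OF c, of _ "w x" "u x"]
          by (simp add: matrix_vector_mult_add_rdistrib matrix_vector_mult_diff_rdistrib
              inner_add_right inner_diff_right)
      qed
      have sol_x: "root p (elem_sym p (eigvals (matrix_inv ?G ** ?B))) = \<phi> c x (differential c u x) (u x)"
        "eigvals (matrix_inv ?G ** ?B) \<in> Gamma_cone p"
        using sol c unfolding is_solution_def hessian_eigvals_def by blast+
      have root_le: "root p (elem_sym p (eigvals (matrix_inv ?G ** ?B))) \<le> M"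
        unfolding sol_x(1)
        by (rule order_trans[OF \<Phi>[OF c sup_norm_bounds(2)[OF comp u C c] sup_norm_bounds(1)[OF comp u C]] M(3)])
      note elliptic = elliptic_operator_lower_bound[OF metric_at[OF c] aug_sym[OF c u]
          aug_sym[OF c w] p sol_x(2) w_cone[OF c, unfolded hessian_eigvals_def] F_coeff_def below]
      have "\<delta> / 2 * (\<Sum>j\<in>UNIV. \<Sum>k\<in>UNIV. ?F $ j $ k * ?G $ j $ k) - K * min_eigval (?F ** ?G)
          - root p (elem_sym p (eigvals (matrix_inv ?G ** ?B)))
          \<le> (\<Sum>j\<in>UNIV. \<Sum>k\<in>UNIV. ?F $ j $ k * ?M $ j $ k)"
        by (rule elliptic(2))
      moreover have "K * min_eigval (?F ** ?G) \<le> M * min_eigval (?F ** ?G)"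
        by (rule mult_right_mono[OF M(2) elliptic(1)])
      moreover have "(\<Sum>j\<in>UNIV. \<Sum>k\<in>UNIV. ?F $ j $ k * ?M $ j $ k) =
          (\<Sum>j\<in>UNIV. \<Sum>k\<in>UNIV. ?F $ j $ k * hessian g c (\<lambda>z. w z - u z) x $ j $ k) +
          (\<Sum>j\<in>UNIV. \<Sum>k\<in>UNIV. ?F $ j $ k * ?DA $ j $ k)"
        by (simp add: distrib_left sum.distrib)
      ultimately show ?thesis using root_le by simp
    qed
    show "\<exists>\<delta>\<^sub>1>0. \<exists>M\<^sub>1\<ge>0. \<forall>u. is_solution Atl g p A \<phi> u \<and>
        (SUP x. \<bar>u x\<bar>) + Sup {covector_norm g c x (differential c u x) |c x. c \<in> Atl \<and> x \<in> fst c} \<le> C \<longrightarrow>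
        (\<forall>c\<in>Atl. \<forall>x\<in>fst c.
          (\<Sum>j\<in>UNIV. \<Sum>k\<in>UNIV. F_coeff g p A c u x $ j $ k * hessian g c (\<lambda>z. w z - u z) x $ j $ k) +
          (\<Sum>j\<in>UNIV. \<Sum>k\<in>UNIV. F_coeff g p A c u x $ j $ k *
             frechet_derivative (\<lambda>a. A c x a (u x) $ j $ k)
               (at (differential c u x)) (differential c (\<lambda>z. w z - u z) x))
          \<ge> \<delta>\<^sub>1 * (\<Sum>j\<in>UNIV. \<Sum>k\<in>UNIV. F_coeff g p A c u x $ j $ k * g c x $ j $ k)
            - M\<^sub>1 * min_eigval (F_coeff g p A c u x ** g c x) - M\<^sub>1)"
      by (rule exI[of _ "\<delta> / 2"], rule conjI, simp add: \<delta>, rule exI[of _ M], rule conjI, rule M(1))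
        (use main in blast)
  qed
qed

end
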